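(* Let $L$ be a differentiable, slowly varying function with $L(x)\nearrow\infty$ and $xL'(x)/L(x)\searrow$ as $x\to\infty$. Let $a_n = n/L(n)$, $d_n=\log L(n)+\log\log n$ and $f(n)=\min\{a_n d_n,\, n\}$, with inverse function $f^{-1}$. Let $X,X_1,X_2,\ldots$ be i.i.d. random variables and let $T_{n,n+k}=\sum_{j=n+1}^{n+k}X_j$. (Sufficiency) Suppose that $X$ has mean $0$ and finite variance $\sigma^2$. If $$E\big(f^{-1}(X^2)\big)<\infty, \qquad (1)$$ then $$\limsup_{n\to\infty}\frac{T_{n,n+a_n}}{\sqrt{2a_nd_n}}=\sigma\quad\text{a.s.} \qquad (2)$$ (Converse) If $$P\Big(\limsup_{n\to\infty}\frac{|T_{n,n+a_n}|}{\sqrt{a_nd_n}}<\infty\Big)>0,$$ then (1) holds, $EX=0$, and (2) holds with $\sigma^2=\operatorname{Var}X$.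
   Context: $L$ is a positive function defined for all sufficiently large $x$; $L(x)\nearrow\infty$ means that $L$ is nondecreasing and tends to infinity, and $xL'(x)/L(x)\searrow$ as $x\to\infty$ means that this quotient is (ultimately) decreasing. All sequences are considered for $n$ large enough that they are defined. Window lengths are rounded to integers: $T_{n,n+a_n}$ means $T_{n,n+[a_n]}$, where $[\cdot]$ is the integer part. The function $f$ is extended to real arguments by $f(x)=f([x])$, and $f^{-1}$ is its suitably defined (generalized) inverse, e.g. $f^{-1}(y)=\inf\{x\ge n_0: f(x)\ge y\}$, where $n_0$ is fixed and so large that $f$ is defined and monotone on $[n_0,\infty)$. *)

theory Defs
  imports "HOL-Probability.Probability"
begin

definition slowly_varying :: "(real \<Rightarrow> real) \<Rightarrow> bool" where
  "slowly_varying L \<longleftrightarrow> (\<forall>c>0. ((\<lambda>x. L (c * x) / L x) \<longlongrightarrow> 1) at_top)"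

text \<open>\<open>L\<close> is modelled as a total function whose values are meaningful only for large
  arguments, so every requirement is imposed only on some half-line. Monotonicity is
  understood in the weak sense.\<close>

definition admissible_L :: "(real \<Rightarrow> real) \<Rightarrow> bool" where
  "admissible_L L \<longleftrightarrow>
     (\<exists>x\<^sub>0. (\<forall>x\<ge>x\<^sub>0. L x > 0 \<and> L differentiable (at x)) \<and>
           mono_on {x\<^sub>0..} L \<and>
           antimono_on {x\<^sub>0..} (\<lambda>x. x * deriv L x / L x)) \<and>
     filterlim L at_top at_top \<and>
     slowly_varying L"

definition a_seq :: "(real \<Rightarrow> real) \<Rightarrow> nat \<Rightarrow> real" where
  "a_seq L n = real n / L (real n)"

definition d_seq :: "(real \<Rightarrow> real) \<Rightarrow> nat \<Rightarrow> real" where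
  "d_seq L n = ln (L (real n)) + ln (ln (real n))"

definition f_seq :: "(real \<Rightarrow> real) \<Rightarrow> nat \<Rightarrow> real" where
  "f_seq L n = min (a_seq L n * d_seq L n) (real n)"

definition f_real :: "(real \<Rightarrow> real) \<Rightarrow> real \<Rightarrow> real" where
  "f_real L x = f_seq L (nat \<lfloor>x\<rfloor>)"

text \<open>The starting point \<open>n\<^sub>0\<close> of the generalized inverse must be so large that \<open>f\<close> is defined
  (both logarithms make sense) and monotone on \<open>[n\<^sub>0, \<infinity>)\<close>. The bound 2 is what makes
  \<open>ln (ln n)\<close> meaningful at \<open>n = \<lfloor>n\<^sub>0\<rfloor>\<close>.\<close>

definition admissible_start :: "(real \<Rightarrow> real) \<Rightarrow> real \<Rightarrow> bool" where
  "admissible_start L n\<^sub>0 \<longleftrightarrow>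
     2 \<le> n\<^sub>0 \<and> (\<forall>n\<ge>nat \<lfloor>n\<^sub>0\<rfloor>. L (real n) > 0) \<and> mono_on {n\<^sub>0..} (f_real L)"

definition f_inv :: "(real \<Rightarrow> real) \<Rightarrow> real \<Rightarrow> real \<Rightarrow> real" where
  "f_inv L n\<^sub>0 y = Inf {x. n\<^sub>0 \<le> x \<and> y \<le> f_real L x}"

definition window_sum :: "(nat \<Rightarrow> 'a \<Rightarrow> real) \<Rightarrow> nat \<Rightarrow> real \<Rightarrow> 'a \<Rightarrow> real" where
  "window_sum Xs n a \<omega> = (\<Sum>j = n + 1..n + nat \<lfloor>a\<rfloor>. Xs j \<omega>)"

text \<open>Only \<open>Xs 1, Xs 2, \<dots>\<close> are constrained; \<open>X\<close> is a generic variable with the common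
  distribution. Independence of \<open>X\<close> from the sequence is not required.\<close>

definition iid_copies :: "'a measure \<Rightarrow> ('a \<Rightarrow> real) \<Rightarrow> (nat \<Rightarrow> 'a \<Rightarrow> real) \<Rightarrow> bool" where
  "iid_copies M X Xs \<longleftrightarrow>
     X \<in> borel_measurable M \<and>
     prob_space.indep_vars M (\<lambda>_. borel) Xs {1..} \<and>
     (\<forall>j\<ge>1. distr M borel (Xs j) = distr M borel X)"

text \<open>Both limits superior are taken in the extended reals; the finitely many indices at which
  \<open>a\<^sub>n\<close> or \<open>d\<^sub>n\<close> is not meaningful do not affect them.\<close>

definition window_limsup_eq ::
  "'a measure \<Rightarrow> (real \<Rightarrow> real) \<Rightarrow> (nat \<Rightarrow> 'a \<Rightarrow> real) \<Rightarrow> real \<Rightarrow> bool" where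
  "window_limsup_eq M L Xs \<sigma> \<longleftrightarrow>
     (AE \<omega> in M. limsup (\<lambda>n. ereal (window_sum Xs n (a_seq L n) \<omega> /
                                   sqrt (2 * a_seq L n * d_seq L n))) = ereal \<sigma>)"

definition window_limsup_finite_event ::
  "'a measure \<Rightarrow> (real \<Rightarrow> real) \<Rightarrow> (nat \<Rightarrow> 'a \<Rightarrow> real) \<Rightarrow> 'a set" where
  "window_limsup_finite_event M L Xs =
     {\<omega> \<in> space M. limsup (\<lambda>n. ereal (\<bar>window_sum Xs n (a_seq L n) \<omega>\<bar> /
                                   sqrt (a_seq L n * d_seq L n))) < \<infinity>}"

end

theory Submission
  imports Defs "HOL-Real_Asymp.Real_Asymp"
begin

text \<open>Write \<open>s n = sqrt (a n * d n)\<close> for the norming sequence. The function \<open>L\<close> enters only through a few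
  regularity properties, collected in the locale \<open>window_seq\<close>. They hold because the elasticity
  \<open>x L'(x) / L(x)\<close> of a slowly varying \<open>L\<close> cannot stay above \<open>1/4\<close>, and being decreasing it is
  eventually at most \<open>1/4\<close>; so \<open>L\<close> grows at most like a fourth root and \<open>a n\<close> at least like
  \<open>n powr (3/4)\<close>. The choice of \<open>d\<close> makes \<open>exp (- d n) / a n\<close> exactly \<open>1 / (n ln n)\<close>, the term of a
  borderline divergent series. On a grid whose spacing is proportional to \<open>a n\<close>, sums of
  \<open>exp (- c * d)\<close> behave like the full series of \<open>exp (- c * d n) / a n\<close>: they converge for \<open>c > 1\<close>
  and diverge for \<open>c = 1\<close>. This dichotomy, fed into the two Borel-Cantelli lemmas, is the theorem.

  \<^bold>\<open>Upper bound.\<close> For centred summands with second moment below \<open>V\<close>, the inequality of Fuk and Nagaev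
  (\<open>fuk_nagaev\<close>) bounds \<open>P(S\<^sub>N \<ge> t)\<close> by a multiple of \<open>exp (- t\<^sup>2 / (2 N V))\<close> plus a multiple of
  \<open>N * E (min (\<bar>X\<bar> / K) 1)^4\<close>, with the sharp constant in the exponent and with a truncation level \<open>K\<close>
  as large as a small multiple of \<open>s n\<close>. Treating all summands up to this level at once makes the
  argument insensitive to the growth of \<open>L\<close>: when \<open>L\<close> grows more slowly than the powers of \<open>d\<close>, a
  window may well contain many summands of intermediate size. The fourth clipped
  moments at level \<open>s n\<close> are summable as soon as \<open>P(\<bar>X\<bar> > s n)\<close> is, by comparing \<open>n\<close> with \<open>4 n\<close>
  (\<open>summable_clipped\<close>). Ottaviani's inequality controls the windows between grid points.

  \<^bold>\<open>Lower bound.\<close> A sum of \<open>N\<close> terms is large if it is large on each of \<open>d / R\<close> consecutive blocks, and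
  each block obeys the central limit theorem; for large \<open>R\<close> this gives the sharp exponent
  (\<open>tail_moderate_deviation\<close>). Adjacent disjoint windows are independent.

  \<^bold>\<open>Converse.\<close> Bounded window sums exclude three things in turn. With infinite variance, the block
  argument applied to symmetrized and truncated variables yields arbitrarily large multiples of \<open>s n\<close>
  infinitely often. With a nonzero mean, \<open>T n\<close> has size \<open>a n\<close>, which is much more than \<open>s n\<close>. If
  \<open>P(\<bar>X\<bar> > C * s n)\<close> is not summable, then the first summand of a window exceeds \<open>C * s n\<close> infinitely
  often, while the rest of the window is independent of it and, by Chebyshev, with high probability
  at most \<open>s n\<close>. Finally, the condition on the inverse function says that \<open>P(X\<^sup>2 > f n)\<close> is summable
  (\<open>integrable_f_inv_iff\<close>), which combines summability of \<open>P(\<bar>X\<bar> > s n)\<close> with finite variance.\<close>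

section \<open>Sums of independent identically distributed variables\<close>

lemma disjoint_familyI_less:
  fixes A :: "nat \<Rightarrow> 'b set"
  assumes "\<And>k l. k < l \<Longrightarrow> A k \<inter> A l = {}"
  shows "disjoint_family A"
  unfolding disjoint_family_on_def
proof (intro ballI impI)
  fix k l :: nat assume "k \<noteq> l"
  then show "A k \<inter> A l = {}" using assms[of k l] assms[of l k] by (cases "k < l") auto
qed

locale iid_seq = prob_space +
  fixes \<xi> :: "nat \<Rightarrow> 'a \<Rightarrow> real"
  assumes indep: "indep_vars (\<lambda>_. borel) \<xi> UNIV"
    and ident: "distr M borel (\<xi> j) = distr M borel (\<xi> 0)"
begin

lemma rv [measurable]: "\<xi> j \<in> borel_measurable M"
  using indep by (auto simp: indep_vars_def)

lemma integrable_ident: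
  fixes g :: "real \<Rightarrow> real"
  assumes [measurable]: "g \<in> borel_measurable borel"
  shows "integrable M (\<lambda>\<omega>. g (\<xi> j \<omega>)) \<longleftrightarrow> integrable M (\<lambda>\<omega>. g (\<xi> 0 \<omega>))"
  using integrable_distr_eq[of "\<xi> j" M borel g] integrable_distr_eq[of "\<xi> 0" M borel g] ident[of j] by simp

lemma expectation_ident:
  fixes g :: "real \<Rightarrow> real"
  assumes [measurable]: "g \<in> borel_measurable borel"
  shows "expectation (\<lambda>\<omega>. g (\<xi> j \<omega>)) = expectation (\<lambda>\<omega>. g (\<xi> 0 \<omega>))"
  using integral_distr[of "\<xi> j" M borel g] integral_distr[of "\<xi> 0" M borel g] ident[of j] by simp

lemma prob_ident:
  assumes [measurable]: "Measurable.pred borel P"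
  shows "prob {\<omega>\<in>space M. P (\<xi> j \<omega>)} = prob {\<omega>\<in>space M. P (\<xi> 0 \<omega>)}"
proof -
  have eq: "prob {\<omega>\<in>space M. P (\<xi> j \<omega>)} = measure (distr M borel (\<xi> j)) {x. P x}" for j
    by (subst measure_distr) (auto intro!: arg_cong[where f=prob] simp: vimage_def)
  show ?thesis unfolding eq ident[of j] ..
qed

lemma iid_map:
  assumes [measurable]: "g \<in> borel_measurable borel"
  shows "iid_seq M (\<lambda>j \<omega>. g (\<xi> j \<omega>))"
proof
  show "indep_vars (\<lambda>_. borel) (\<lambda>j \<omega>. g (\<xi> j \<omega>)) UNIV"
    using indep by (rule indep_vars_compose2) auto
  show "distr M borel (\<lambda>\<omega>. g (\<xi> j \<omega>)) = distr M borel (\<lambda>\<omega>. g (\<xi> 0 \<omega>))" for j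
    using distr_distr[of g borel borel "\<xi> j" M] distr_distr[of g borel borel "\<xi> 0" M] ident[of j]
    by (simp add: comp_def)
qed

lemma indep_restrictions:
  assumes "A \<inter> B = {}"
  shows "indep_var (PiM A (\<lambda>_. borel :: real measure)) (\<lambda>\<omega>. restrict (\<lambda>i. \<xi> i \<omega>) A)
          (PiM B (\<lambda>_. borel :: real measure)) (\<lambda>\<omega>. restrict (\<lambda>i. \<xi> i \<omega>) B)"
  by (rule indep_var_restrict[OF indep assms]) auto

lemma distr_difference:
  assumes "i \<noteq> j"
  shows "distr M borel (\<lambda>\<omega>. \<xi> i \<omega> - \<xi> j \<omega>) =
      distr (distr M borel (\<xi> 0) \<Otimes>\<^sub>M distr M borel (\<xi> 0)) borel (\<lambda>p. fst p - snd p)"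
proof -
  have "{i} \<inter> {j} = {}" using assms by simp
  from indep_var_compose[OF indep_restrictions[OF this], of "\<lambda>x. x i" borel "\<lambda>x. x j" borel]
  have "indep_var borel (\<xi> i) borel (\<xi> j)" by (simp add: comp_def)
  then have "distr M borel (\<xi> i) \<Otimes>\<^sub>M distr M borel (\<xi> j) =
      distr M (borel \<Otimes>\<^sub>M borel) (\<lambda>x. (\<xi> i x, \<xi> j x))"
    by (simp add: indep_var_distribution_eq)
  then show ?thesis
    unfolding ident[of i] ident[of j]
    by (simp add: distr_distr comp_def)
qed

lemma iid_pairwise_differences: "iid_seq M (\<lambda>j \<omega>. \<xi> (2 * j) \<omega> - \<xi> (2 * j + 1) \<omega>)"
proof
  have "indep_vars (\<lambda>j. PiM {2*j, 2*j+1} (\<lambda>_. borel :: real measure))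
      (\<lambda>j \<omega>. restrict (\<lambda>i. \<xi> i \<omega>) {2*j, 2*j+1}) UNIV"
  proof (rule indep_vars_restrict[OF indep])
    show "disjoint_family_on (\<lambda>j. {2 * j, 2 * j + 1 :: nat}) UNIV"
      unfolding disjoint_family_on_def by (auto; presburger)
  qed auto
  then have "indep_vars (\<lambda>_. borel)
      (\<lambda>j \<omega>. (\<lambda>x. x (2*j) - x (2*j+1)) (restrict (\<lambda>i. \<xi> i \<omega>) {2*j, 2*j+1})) UNIV"
    by (rule indep_vars_compose2) auto
  then show "indep_vars (\<lambda>_. borel) (\<lambda>j \<omega>. \<xi> (2 * j) \<omega> - \<xi> (2 * j + 1) \<omega>) UNIV"
    by simp
  show "distr M borel (\<lambda>\<omega>. \<xi> (2 * j) \<omega> - \<xi> (2 * j + 1) \<omega>) =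
     distr M borel (\<lambda>\<omega>. \<xi> (2 * 0) \<omega> - \<xi> (2 * 0 + 1) \<omega>)" for j
    using distr_difference[of "2 * j" "2 * j + 1"] distr_difference[of "2 * 0" "2 * 0 + 1"] by simp
qed

lemma indep_blocks:
  assumes "A \<inter> B = {}" "P \<in> sets (PiM A (\<lambda>_. borel))" "Q \<in> sets (PiM B (\<lambda>_. borel))"
  shows "prob {\<omega>\<in>space M. restrict (\<lambda>i. \<xi> i \<omega>) A \<in> P \<and> restrict (\<lambda>i. \<xi> i \<omega>) B \<in> Q} =
     prob {\<omega>\<in>space M. restrict (\<lambda>i. \<xi> i \<omega>) A \<in> P} * prob {\<omega>\<in>space M. restrict (\<lambda>i. \<xi> i \<omega>) B \<in> Q}"
proof -
  from indep_varD[OF indep_restrictions[OF assms(1)] assms(2,3)] show ?thesis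
    by (simp add: vimage_def Int_def conj_commute)
qed

lemma indep_block_sums:
  assumes "A \<inter> B = {}"
  shows "indep_var borel (\<lambda>\<omega>. \<Sum>j\<in>A. \<xi> j \<omega>) borel (\<lambda>\<omega>. \<Sum>j\<in>B. \<xi> j \<omega>)"
proof -
  from indep_var_compose[OF indep_restrictions[OF assms], of "\<lambda>x. \<Sum>j\<in>A. x j" borel "\<lambda>x. \<Sum>j\<in>B. x j" borel]
  show ?thesis by (simp add: comp_def)
qed

end

text \<open>Both laws are iterated convolutions of the same law. Two sequences are allowed, so that a
  sequence can be compared with a transformed copy of itself that has the same marginals.\<close>

lemma iid_sum_distr_eq:
  assumes "iid_seq M \<xi>" "iid_seq M \<zeta>" "distr M borel (\<xi> 0) = distr M borel (\<zeta> 0)"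
  assumes "finite J" "finite J'" "card J = card J'"
  shows "distr M borel (\<lambda>\<omega>. \<Sum>j\<in>J. \<xi> j \<omega>) = distr M borel (\<lambda>\<omega>. \<Sum>j\<in>J'. \<zeta> j \<omega>)"
  using assms(4-6)
proof (induction J arbitrary: J' rule: finite_induct)
  case empty then show ?case by simp
next
  case (insert i J)
  interpret x: iid_seq M \<xi> by fact
  interpret z: iid_seq M \<zeta> by fact
  obtain i' J0 where J': "J' = insert i' J0" "i' \<notin> J0" "card J0 = card J"
    using insert.prems insert.hyps by (metis card_Suc_eq card_insert_disjoint)
  have fin: "finite J0" using J' insert.prems by simp
  have "x.indep_var borel (\<xi> i) borel (\<lambda>\<omega>. \<Sum>j\<in>J. \<xi> j \<omega>)"
    using x.indep_block_sums[of "{i}" J] insert.hyps by simp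
  then have 1: "distr M borel (\<lambda>\<omega>. \<xi> i \<omega> + (\<Sum>j\<in>J. \<xi> j \<omega>)) =
      convolution (distr M borel (\<xi> i)) (distr M borel (\<lambda>\<omega>. \<Sum>j\<in>J. \<xi> j \<omega>))"
    by (intro x.sum_indep_random_variable) auto
  have "x.indep_var borel (\<zeta> i') borel (\<lambda>\<omega>. \<Sum>j\<in>J0. \<zeta> j \<omega>)"
    using z.indep_block_sums[of "{i'}" J0] J' by simp
  then have 2: "distr M borel (\<lambda>\<omega>. \<zeta> i' \<omega> + (\<Sum>j\<in>J0. \<zeta> j \<omega>)) =
      convolution (distr M borel (\<zeta> i')) (distr M borel (\<lambda>\<omega>. \<Sum>j\<in>J0. \<zeta> j \<omega>))"
    by (intro x.sum_indep_random_variable) auto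
  have "distr M borel (\<xi> i) = distr M borel (\<zeta> i')"
    using x.ident[of i] z.ident[of i'] assms(3) by simp
  with 1 2 insert.IH[of J0] J' fin insert.hyps show ?case by simp
qed

context iid_seq
begin

definition tail :: "nat \<Rightarrow> real \<Rightarrow> real" where
  "tail r t = prob {\<omega>\<in>space M. t \<le> (\<Sum>j<r. \<xi> j \<omega>)}"

lemma prob_sum_pred:
  assumes [measurable]: "Measurable.pred borel P" and "finite J"
  shows "prob {\<omega>\<in>space M. P (\<Sum>j\<in>J. \<xi> j \<omega>)} = prob {\<omega>\<in>space M. P (\<Sum>j<card J. \<xi> j \<omega>)}"
proof -
  have eq: "prob {\<omega>\<in>space M. P (\<Sum>j\<in>J. \<xi> j \<omega>)} = measure (distr M borel (\<lambda>\<omega>. \<Sum>j\<in>J. \<xi> j \<omega>)) {x. P x}" for J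
    by (subst measure_distr) (auto intro!: arg_cong[where f=prob] simp: vimage_def)
  show ?thesis unfolding eq
    using iid_sum_distr_eq[OF iid_seq_axioms iid_seq_axioms refl \<open>finite J\<close>, of "{..<card J}"] by simp
qed

lemma prob_sum_ge_eq_tail:
  "finite J \<Longrightarrow> prob {\<omega>\<in>space M. t \<le> (\<Sum>j\<in>J. \<xi> j \<omega>)} = tail (card J) t"
  unfolding tail_def by (rule prob_sum_pred) auto

lemma tail_le_1: "tail r t \<le> 1"
  by (simp add: tail_def)

lemma tail_antimono: "t \<le> u \<Longrightarrow> tail r u \<le> tail r t"
  unfolding tail_def by (intro finite_measure_mono) auto

lemma tail_superadditive: "tail r t * tail q u \<le> tail (r + q) (t + u)"
proof -
  have "indep_var borel (\<lambda>\<omega>. \<Sum>j\<in>{..<r}. \<xi> j \<omega>) borel (\<lambda>\<omega>. \<Sum>j\<in>{r..<r+q}. \<xi> j \<omega>)"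
    by (rule indep_block_sums) auto
  from indep_varD[OF this, of "{t..}" "{u..}"]
  have "prob {\<omega>\<in>space M. t \<le> (\<Sum>j<r. \<xi> j \<omega>) \<and> u \<le> (\<Sum>j\<in>{r..<r+q}. \<xi> j \<omega>)} =
     prob {\<omega>\<in>space M. t \<le> (\<Sum>j<r. \<xi> j \<omega>)} * prob {\<omega>\<in>space M. u \<le> (\<Sum>j\<in>{r..<r+q}. \<xi> j \<omega>)}"
    by (simp add: vimage_def Int_def conj_commute)
  also have "\<dots> = tail r t * tail q u"
    by (simp add: prob_sum_ge_eq_tail)
  finally have "tail r t * tail q u =
    prob {\<omega>\<in>space M. t \<le> (\<Sum>j<r. \<xi> j \<omega>) \<and> u \<le> (\<Sum>j\<in>{r..<r+q}. \<xi> j \<omega>)}" ..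
  also have "\<dots> \<le> tail (r + q) (t + u)"
    unfolding tail_def
  proof (intro finite_measure_mono subsetI)
    fix \<omega> assume "\<omega> \<in> {\<omega>\<in>space M. t \<le> (\<Sum>j<r. \<xi> j \<omega>) \<and> u \<le> (\<Sum>j\<in>{r..<r+q}. \<xi> j \<omega>)}"
    moreover have "(\<Sum>j<r+q. \<xi> j \<omega>) = (\<Sum>j<r. \<xi> j \<omega>) + (\<Sum>j\<in>{r..<r+q}. \<xi> j \<omega>)"
      by (metis lessThan_atLeast0 sum.atLeastLessThan_concat zero_le le_add1)
    ultimately show "\<omega> \<in> {\<omega>\<in>space M. t + u \<le> (\<Sum>j<r+q. \<xi> j \<omega>)}" by auto
  qed auto
  finally show ?thesis .
qed

text \<open>The hypothesis is uniform in all block lengths from \<open>r\<close> on, so the last block may absorb the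
  remainder of the division of \<open>N\<close> into blocks of length \<open>r\<close>.\<close>

lemma tail_blocks:
  assumes p: "\<And>s. s \<ge> r \<Longrightarrow> p \<le> tail s (y * sqrt (real s))" and "0 \<le> p" "0 \<le> y"
  assumes "m \<ge> 1" "m * r \<le> N"
  shows "p ^ m \<le> tail N (real m * (y * sqrt (real r)))"
  using assms(4,5)
proof (induction m arbitrary: N rule: nat_induct_at_least)
  case base
  have "p \<le> tail N (y * sqrt (real N))" using base p by simp
  also have "\<dots> \<le> tail N (y * sqrt (real r))"
    using base \<open>0 \<le> y\<close> by (intro tail_antimono mult_left_mono) auto
  finally show ?case by simp
next
  case (Suc m)
  have "p ^ Suc m = p * p ^ m" by simp
  also have "\<dots> \<le> tail r (y * sqrt (real r)) * tail (N - r) (real m * (y * sqrt (real r)))"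
    using p[of r] Suc \<open>0 \<le> p\<close> by (intro mult_mono Suc.IH) auto
  also have "\<dots> \<le> tail (r + (N - r)) (y * sqrt (real r) + real m * (y * sqrt (real r)))"
    by (rule tail_superadditive)
  also have "r + (N - r) = N" using Suc.prems by simp
  finally show ?case by (simp add: algebra_simps)
qed

text \<open>With about \<open>d / R\<close> blocks, each costing a factor \<open>exp (- R)\<close>, the total cost is \<open>exp (- d)\<close>, and the
  sum reaches \<open>(d / R) * y * sqrt (N * R / d) = (y / sqrt R) * sqrt (N * d)\<close>. The factor \<open>c < 1\<close> pays for
  rounding the number and the length of the blocks.\<close>

lemma tail_moderate_deviation:
  assumes lb: "\<And>r. r \<ge> r0 \<Longrightarrow> exp (- R) \<le> tail r (y * sqrt (real r))"
    and "R > 0" "y > 0" "0 < c" "c < 1"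
  shows "\<exists>D>0. \<forall>N d. d \<ge> D \<longrightarrow> real N \<ge> D * d \<longrightarrow>
           exp (- d) \<le> tail N (c * y / sqrt R * sqrt (real N * d))"
proof -
  \<comment> \<open>lower bounds that make both roundings cost at most a factor \<open>c\<close> and give blocks of length at least \<open>r0\<close>\<close>
  define D where "D = Max {R / (1 - c), R, 1 / (R * (1 - c)), (real r0 + 1) / R}"
  have D: "D \<ge> R / (1 - c)" "D \<ge> R" "D \<ge> 1 / (R * (1 - c))" "D \<ge> (real r0 + 1) / R"
    unfolding D_def by (intro Max_ge; simp)+
  have "D > 0" using D \<open>R > 0\<close> by linarith
  show ?thesis
  proof (intro exI[of _ D] conjI allI impI)
    show "D > 0" by fact
    fix N :: nat and d :: real assume d: "d \<ge> D" and N: "real N \<ge> D * d"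
    define m where "m = nat \<lfloor>d / R\<rfloor>"
    have "d > 0" using d \<open>D > 0\<close> by linarith
    have dR: "d / R \<ge> 1" using d D \<open>R > 0\<close> by (simp add: field_simps)
    have m1: "m \<ge> 1" unfolding m_def using dR by linarith
    have mle: "real m \<le> d / R" unfolding m_def using dR by linarith
    have "d / R - 1 \<le> real m" unfolding m_def using dR by linarith
    moreover have "1 \<le> (1 - c) * (d / R)"
    proof -
      have "R / (1 - c) \<le> d" using d D(1) by linarith
      then show ?thesis using \<open>R > 0\<close> \<open>c < 1\<close> by (simp add: field_simps)
    qed
    moreover have "c * (d / R) = d / R - (1 - c) * (d / R)"
      unfolding left_diff_distrib by simp
    ultimately have mge: "c * (d / R) \<le> real m" by linarith
    define r where "r = N div m"
    have rm: "m * r \<le> N" unfolding r_def by simp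
    have NR: "real N * R / d \<le> real N / real m"
      using mle m1 \<open>d > 0\<close> \<open>R > 0\<close> mult_left_mono[of "real m * R" d "real N"]
      by (simp add: field_simps)
    have DR: "D * R \<le> real N * R / d" using N \<open>d > 0\<close> \<open>R > 0\<close> by (simp add: field_simps)
    have rfl: "real r \<ge> real N / real m - 1"
    proof -
      have "N < m * r + m"
        unfolding r_def using mult_div_mod_eq[of m N] mod_less_divisor[of m N] m1 by linarith
      then have "real N < real (m * r + m)" by (simp only: of_nat_less_iff)
      then have "real N / real m < real r + 1" using m1 by (simp add: divide_less_eq algebra_simps)
      then show ?thesis by simp
    qed
    have "D * R \<ge> real r0 + 1" using D(4) \<open>R > 0\<close> by (simp add: field_simps)
    then have rr0: "r \<ge> r0" using rfl NR DR by linarith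
    have "(1 - c) * (D * R) \<ge> 1" using D(3) \<open>R > 0\<close> \<open>c < 1\<close> by (simp add: field_simps)
    moreover have "(1 - c) * (D * R) \<le> (1 - c) * (real N / real m)"
      using NR DR \<open>c < 1\<close> by (intro mult_left_mono) auto
    moreover have "c * (real N / real m) = real N / real m - (1 - c) * (real N / real m)"
      unfolding left_diff_distrib by simp
    ultimately have rge: "c * (real N / real m) \<le> real r" using rfl by linarith
    have "exp (- d) \<le> exp (- R * real m)" using mle \<open>R > 0\<close> by (simp add: field_simps)
    also have "\<dots> = exp (- R) ^ m" by (simp add: exp_of_nat_mult[symmetric] mult.commute)
    also have "\<dots> \<le> tail N (real m * (y * sqrt (real r)))"
      using lb rr0 \<open>y > 0\<close> m1 rm by (intro tail_blocks) auto
    also have "\<dots> \<le> tail N (c * y / sqrt R * sqrt (real N * d))"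
    proof (rule tail_antimono)
      have "c\<^sup>2 * (real N * d / R) = (c * (d / R)) * (c * real N)" by (simp add: power2_eq_square)
      also have "\<dots> \<le> real m * (c * real N)" using mge \<open>c > 0\<close> by (intro mult_right_mono) auto
      also have "\<dots> = (real m)\<^sup>2 * (c * (real N / real m))" using m1 by (simp add: power2_eq_square)
      also have "\<dots> \<le> (real m)\<^sup>2 * real r" using rge by (intro mult_left_mono) auto
      finally have "sqrt (c\<^sup>2 * (real N * d / R)) \<le> sqrt ((real m)\<^sup>2 * real r)" by (rule real_sqrt_le_mono)
      then have "c * (sqrt (real N * d) / sqrt R) \<le> real m * sqrt (real r)"
        using \<open>c > 0\<close> by (simp add: real_sqrt_mult real_sqrt_divide)
      then have "y * (c * (sqrt (real N * d) / sqrt R)) \<le> y * (real m * sqrt (real r))"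
        using \<open>y > 0\<close> by (intro mult_left_mono) auto
      then show "c * y / sqrt R * sqrt (real N * d) \<le> real m * (y * sqrt (real r))"
        by (simp add: algebra_simps)
    qed
    finally show "exp (- d) \<le> tail N (c * y / sqrt R * sqrt (real N * d))" .
  qed
qed

end

text \<open>By independence, the probability that no \<open>A k\<close> with \<open>k \<ge> n\<close> occurs is a product of the factors
  \<open>1 - prob (A k) \<le> exp (- prob (A k))\<close>, hence zero.\<close>

lemma (in prob_space) borel_cantelli_independent:
  assumes ind: "indep_events A UNIV" and ns: "\<not> summable (\<lambda>k. prob (A k))"
  shows "AE \<omega> in M. \<exists>\<^sub>F k in sequentially. \<omega> \<in> A k"
proof -
  have ev [measurable]: "A k \<in> events" for k using ind by (auto simp: indep_events_def)
  have ns': "\<not> summable (\<lambda>k. prob (A (k + n)))" for n using ns by (subst summable_iff_shift)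
  have null: "prob (\<Inter>k\<in>{n..}. space M - A k) = 0" for n
  proof -
    have fin: "prob (\<Inter>k\<in>{n..<n+Suc m}. space M - A k) = (\<Prod>k\<in>{n..<n+Suc m}. 1 - prob (A k))" for m
    proof -
      have "indep_events (\<lambda>k. space M - A k) UNIV"
      proof -
        have "indep_sets (\<lambda>i. {A i}) UNIV" using ind by (simp add: indep_events_def_alt)
        then have "indep_sets (\<lambda>i. sigma_sets (space M) {A i}) UNIV"
          by (rule indep_sets_sigma) (simp add: Int_stable_def)
        then have "indep_sets (\<lambda>i. {space M - A i}) UNIV"
          by (rule indep_sets_mono_sets) (auto intro: sigma_sets.intros)
        then show ?thesis by (simp add: indep_events_def_alt)
      qed
      then show ?thesis
        unfolding indep_events_def by (auto simp: prob_compl)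
    qed
    have le: "prob (\<Inter>k\<in>{n..}. space M - A k) \<le> exp (- (\<Sum>k<Suc m. prob (A (k + n))))" for m
    proof -
      have "prob (\<Inter>k\<in>{n..}. space M - A k) \<le> prob (\<Inter>k\<in>{n..<n+Suc m}. space M - A k)"
        by (intro finite_measure_mono) (auto intro!: sets.finite_INT)
      also have "\<dots> \<le> (\<Prod>k\<in>{n..<n+Suc m}. exp (- prob (A k)))"
        unfolding fin using exp_ge_add_one_self[of "- prob (A k)" for k]
        by (intro prod_mono) (auto simp: exp_ge_add_one_self)
      also have "\<dots> = exp (- (\<Sum>k\<in>{n..<n+Suc m}. prob (A k)))"
      proof -
        have "exp (\<Sum>k\<in>{n..<n+Suc m}. - prob (A k)) = (\<Prod>k\<in>{n..<n+Suc m}. exp (- prob (A k)))"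
          by (rule exp_sum) simp
        then show ?thesis unfolding sum_negf ..
      qed
      also have "(\<Sum>k\<in>{n..<n+Suc m}. prob (A k)) = (\<Sum>k<Suc m. prob (A (k + n)))"
        using sum.shift_bounds_nat_ivl[of "\<lambda>k. prob (A k)" 0 n "Suc m"]
        by (simp only: add_0 lessThan_atLeast0 add.commute[of n "Suc m"])
      finally show ?thesis .
    qed
    show ?thesis
    proof (rule ccontr)
      assume "prob (\<Inter>k\<in>{n..}. space M - A k) \<noteq> 0"
      then have pos: "prob (\<Inter>k\<in>{n..}. space M - A k) > 0" by (simp add: zero_less_measure_iff)
      have "(\<Sum>k<m. prob (A (k + n))) \<le> - ln (prob (\<Inter>k\<in>{n..}. space M - A k))" for m
      proof -
        have "ln (prob (\<Inter>k\<in>{n..}. space M - A k)) \<le> - (\<Sum>k<Suc m. prob (A (k + n)))"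
        proof -
          have "ln (prob (\<Inter>k\<in>{n..}. space M - A k)) \<le> ln (exp (- (\<Sum>k<Suc m. prob (A (k + n)))))"
            using le[of m] pos by (subst ln_le_cancel_iff) auto
          then show ?thesis by (simp only: ln_exp)
        qed
        moreover have "(\<Sum>k<m. prob (A (k + n))) \<le> (\<Sum>k<Suc m. prob (A (k + n)))" by simp
        ultimately show ?thesis by linarith
      qed
      then have "summable (\<lambda>k. prob (A (k + n)))"
        by (intro summableI_nonneg_bounded) auto
      with ns' show False by blast
    qed
  qed
  have "AE \<omega> in M. \<omega> \<notin> (\<Inter>k\<in>{n..}. space M - A k)" for n
  proof (rule AE_not_in, rule null_setsI)
    show "emeasure M (\<Inter>k\<in>{n..}. space M - A k) = 0"
      unfolding emeasure_eq_measure null by simp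
  qed (auto intro!: sets.countable_INT')
  then have "AE \<omega> in M. \<forall>n. \<omega> \<notin> (\<Inter>k\<in>{n..}. space M - A k)" by (simp add: AE_all_countable)
  then show ?thesis
    using AE_space by eventually_elim (auto simp: frequently_sequentially)
qed

section \<open>Moderate deviations from below\<close>

text \<open>The density is at least its value at \<open>v + 1\<close> on the unit interval above \<open>v\<close>. Losing the unit shift
  is harmless because only the leading term \<open>v\<^sup>2 / 2\<close> of the exponent matters for large \<open>v\<close>.\<close>

lemma std_normal_upper_tail:
  "1 / sqrt (2 * pi) * exp (- (v + 1)\<^sup>2 / 2) \<le> 1 - cdf std_normal_distribution v" if "v \<ge> 0" for v :: real
proof -
  interpret N: real_distribution std_normal_distribution by (rule real_dist_normal_dist) 
  let ?c = "1 / sqrt (2 * pi) * exp (- (v + 1)\<^sup>2 / 2)"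
  have "ennreal ?c = (\<integral>\<^sup>+x. ennreal ?c * indicator {v<..v+1} x \<partial>lborel)"
    by (simp add: nn_integral_cmult_indicator)
  also have "\<dots> \<le> (\<integral>\<^sup>+x. ennreal (std_normal_density x) * indicator {v<..v+1} x \<partial>lborel)"
  proof (intro nn_integral_mono)
    fix x :: real
    have "ennreal ?c \<le> ennreal (std_normal_density x)" if "x \<in> {v<..v+1}"
    proof -
      have "x\<^sup>2 \<le> (v + 1)\<^sup>2" using that \<open>v \<ge> 0\<close> by (intro power_mono) auto
      then show ?thesis by (intro ennreal_leI) (simp add: std_normal_density_def divide_right_mono)
    qed
    then show "ennreal ?c * indicator {v<..v+1} x \<le> ennreal (std_normal_density x) * indicator {v<..v+1} x"
      by (auto split: split_indicator)
  qed
  also have "\<dots> = emeasure std_normal_distribution {v<..v+1}"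
    by (subst emeasure_density) auto
  also have "\<dots> \<le> emeasure std_normal_distribution {v<..}"
    by (intro emeasure_mono) auto
  also have "\<dots> = ennreal (measure std_normal_distribution {v<..})"
    by (simp add: N.emeasure_eq_measure)
  finally have "?c \<le> measure std_normal_distribution {v<..}"
    by (simp add: ennreal_le_iff)
  also have "{v<..} = space std_normal_distribution - {..v}" by auto
  also have "measure std_normal_distribution \<dots> = 1 - cdf std_normal_distribution v"
    unfolding cdf_def by (rule N.prob_compl) simp
  finally show ?thesis .
qed

lemma isCont_cdf_std_normal: "isCont (cdf std_normal_distribution) v"
proof -
  interpret N: real_distribution std_normal_distribution by (rule real_dist_normal_dist)
  have "emeasure std_normal_distribution {v} = 0"
    by (subst emeasure_density) (auto simp: nn_integral_indicator_singleton' nn_integral_0_iff_AE intro!: AE_I[where N="{v}"])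
  then show ?thesis by (simp add: N.isCont_cdf measure_def)
qed

context iid_seq
begin

lemma tail_clt:
  assumes "integrable M (\<lambda>\<omega>. (\<xi> 0 \<omega>)\<^sup>2)" and "expectation (\<xi> 0) = 0"
    and var: "expectation (\<lambda>\<omega>. (\<xi> 0 \<omega>)\<^sup>2) = \<sigma>\<^sup>2" and "\<sigma> > 0" "v \<ge> 0"
    and c: "c < 1 / sqrt (2 * pi) * exp (- (v + 1)\<^sup>2 / 2)"
  shows "eventually (\<lambda>r. c \<le> tail r (\<sigma> * v * sqrt (real r))) sequentially"
proof -
  have mean: "expectation (\<xi> n) = 0" for n using expectation_ident[of "\<lambda>x. x" n] assms(2) by simp
  have "weak_conv_m (\<lambda>n. distr M borel (\<lambda>x. (\<Sum>i<n. \<xi> i x) / sqrt (real n * \<sigma>\<^sup>2))) std_normal_distribution"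
  proof (rule central_limit_theorem_zero_mean[where \<mu>="distr M borel (\<xi> 0)"])
    show "integrable M (\<lambda>x. (\<xi> n x)\<^sup>2)" for n using integrable_ident[of "\<lambda>x. x\<^sup>2" n] assms(1) by simp
    show "variance (\<xi> n) = \<sigma>\<^sup>2" for n
      unfolding mean using expectation_ident[of "\<lambda>x. x\<^sup>2" n] var by simp
  qed (use assms indep ident mean in auto)
  then have "(\<lambda>n. 1 - cdf (distr M borel (\<lambda>x. (\<Sum>i<n. \<xi> i x) / sqrt (real n * \<sigma>\<^sup>2))) v)
       \<longlonglongrightarrow> 1 - cdf std_normal_distribution v"
    unfolding weak_conv_m_def weak_conv_def using isCont_cdf_std_normal by (intro tendsto_intros) auto
  moreover have "c < 1 - cdf std_normal_distribution v"
    using std_normal_upper_tail[OF \<open>v \<ge> 0\<close>] c by linarith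
  ultimately have "eventually (\<lambda>n. c < 1 - cdf (distr M borel (\<lambda>x. (\<Sum>i<n. \<xi> i x) / sqrt (real n * \<sigma>\<^sup>2))) v) sequentially"
    by (rule order_tendstoD)
  then show ?thesis
    using eventually_gt_at_top[of 0]
  proof eventually_elim
    case (elim n)
    let ?A = "{\<omega>\<in>space M. (\<Sum>i<n. \<xi> i \<omega>) / sqrt (real n * \<sigma>\<^sup>2) \<le> v}"
    have "cdf (distr M borel (\<lambda>x. (\<Sum>i<n. \<xi> i x) / sqrt (real n * \<sigma>\<^sup>2))) v = prob ?A"
      unfolding cdf_def by (subst measure_distr) (auto intro!: arg_cong[where f=prob])
    then have "c \<le> 1 - prob ?A" using elim by simp
    also have "\<dots> = prob (space M - ?A)" by (subst prob_compl) auto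
    also have "\<dots> \<le> tail n (\<sigma> * v * sqrt (real n))"
      unfolding tail_def
    proof (intro finite_measure_mono subsetI)
      fix \<omega> assume "\<omega> \<in> space M - ?A"
      then have \<omega>: "\<omega> \<in> space M" "v < (\<Sum>i<n. \<xi> i \<omega>) / (sqrt (real n) * \<sigma>)"
        using \<open>\<sigma> > 0\<close> by (auto simp: real_sqrt_mult)
      then have "v * (sqrt (real n) * \<sigma>) < (\<Sum>i<n. \<xi> i \<omega>)"
        using elim(2) \<open>\<sigma> > 0\<close> by (simp add: pos_less_divide_eq)
      then show "\<omega> \<in> {\<omega> \<in> space M. \<sigma> * v * sqrt (real n) \<le> (\<Sum>i<n. \<xi> i \<omega>)}"
        using \<omega> by (simp add: mult.commute mult.left_commute)
    qed auto
    finally show ?case .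
  qed
qed

text \<open>Taking \<open>\<sigma> * v\<close> standard units per block with \<open>v\<close> large makes the normal tail \<open>exp (- v\<^sup>2 / 2)\<close> up to
  an arbitrarily small relative error in the exponent, so \<open>y / sqrt R\<close> comes as close to \<open>\<sigma> * sqrt 2\<close> as
  desired.\<close>

lemma tail_moderate_deviation_finite_variance:
  assumes "integrable M (\<lambda>\<omega>. (\<xi> 0 \<omega>)\<^sup>2)" and "expectation (\<xi> 0) = 0"
    and var: "expectation (\<lambda>\<omega>. (\<xi> 0 \<omega>)\<^sup>2) = \<sigma>\<^sup>2" and "0 < z" "z < \<sigma>"
  shows "\<exists>D>0. \<forall>N d. d \<ge> D \<longrightarrow> real N \<ge> D * d \<longrightarrow>
           exp (- d) \<le> tail N (z * sqrt 2 * sqrt (real N * d))"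
proof -
  \<comment> \<open>the loss \<open>z / \<sigma>\<close> is split evenly between the Gaussian exponent and the rounding of blocks\<close>
  define b where "b = sqrt (z / \<sigma>)"
  have "\<sigma> > 0" using assms by linarith
  have b: "0 < b" "b < 1" "b\<^sup>2 = z / \<sigma>" using assms by (auto simp: b_def)
  have "filterlim (\<lambda>v::real. v\<^sup>2 / (2 * b\<^sup>2) - (v + 1)\<^sup>2 / 2 - ln (sqrt (2 * pi))) at_top at_top"
  proof -
    have "1 / b\<^sup>2 > 1" unfolding b(3) using assms by simp
    then have k: "(1 / b\<^sup>2 - 1) / 2 > 0" by simp
    have eq: "v\<^sup>2 / (2 * b\<^sup>2) - (v + 1)\<^sup>2 / 2 - ln (sqrt (2 * pi)) =
       v * ((1 / b\<^sup>2 - 1) / 2 * v - 1) + (- 1 / 2 - ln (sqrt (2 * pi)))" for v :: real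
      using b(1) by (simp add: field_simps power2_eq_square)
    have "filterlim (\<lambda>v::real. (1 / b\<^sup>2 - 1) / 2 * v + - 1) at_top at_top"
      unfolding add.commute[of _ "- 1"]
      by (intro filterlim_tendsto_add_at_top[OF tendsto_const]
            filterlim_tendsto_pos_mult_at_top[OF tendsto_const k] filterlim_ident)
    then show ?thesis
      unfolding eq add.commute[of _ "- 1 / 2 - ln (sqrt (2 * pi))"]
      by (intro filterlim_tendsto_add_at_top[OF tendsto_const] filterlim_at_top_mult_at_top filterlim_ident) simp
  qed
  then have "eventually (\<lambda>v::real. v\<^sup>2 / (2 * b\<^sup>2) - (v + 1)\<^sup>2 / 2 - ln (sqrt (2 * pi)) > 0) at_top"
    by (rule filterlim_at_top_dense[THEN iffD1, rule_format])
  from eventually_happens'[OF _ eventually_conj[OF this eventually_gt_at_top[of 0]]]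
  obtain v :: real where v: "v\<^sup>2 / (2 * b\<^sup>2) - (v + 1)\<^sup>2 / 2 - ln (sqrt (2 * pi)) > 0" "v > 0" by auto
  define R where "R = v\<^sup>2 / (2 * b\<^sup>2)"
  have "R > 0" using v(2) b(1) by (simp add: R_def)
  have "exp (- R) < exp (- (v + 1)\<^sup>2 / 2 - ln (sqrt (2 * pi)))" using v by (simp add: R_def)
  also have "\<dots> = 1 / sqrt (2 * pi) * exp (- (v + 1)\<^sup>2 / 2)" by (simp add: exp_diff)
  finally have "eventually (\<lambda>r. exp (- R) \<le> tail r (\<sigma> * v * sqrt (real r))) sequentially"
    using assms v \<open>\<sigma> > 0\<close> by (intro tail_clt) auto
  then obtain r0 where r0: "\<And>r. r \<ge> r0 \<Longrightarrow> exp (- R) \<le> tail r (\<sigma> * v * sqrt (real r))"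
    by (auto simp: eventually_sequentially)
  have "b * (\<sigma> * v) / sqrt R = z * sqrt 2"
  proof -
    have "sqrt R = v / (sqrt 2 * b)" using v(2) b(1) by (simp add: R_def real_sqrt_divide real_sqrt_mult)
    then have "b * (\<sigma> * v) / sqrt R = b * (\<sigma> * v) / (v / (sqrt 2 * b))" by (simp only:)
    also have "\<dots> = b\<^sup>2 * \<sigma> * sqrt 2" using v(2) b(1) by (simp add: field_simps power2_eq_square)
    also have "\<dots> = z * sqrt 2" unfolding b(3) using \<open>\<sigma> > 0\<close> by simp
    finally show ?thesis .
  qed
  with tail_moderate_deviation[of r0 R "\<sigma> * v" b] r0 \<open>R > 0\<close> v(2) b \<open>\<sigma> > 0\<close>
  show ?thesis by simp
qed

text \<open>Changing the sign of the summands that exceed \<open>c\<close> does not change their law, and the truncated sum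
  is the average of the original sum and the sum with these signs changed. So if the truncated sum is
  at least \<open>t\<close>, one of two identically distributed sums is.\<close>

lemma tail_truncation:
  assumes sym: "distr M borel (\<lambda>\<omega>. - \<xi> 0 \<omega>) = distr M borel (\<xi> 0)"
  shows "prob {\<omega>\<in>space M. t \<le> (\<Sum>j<r. if \<bar>\<xi> j \<omega>\<bar> \<le> c then \<xi> j \<omega> else 0)} \<le> 2 * tail r t"
proof -
  define g where "g x = (if \<bar>x\<bar> \<le> c then x else - x)" for x :: real
  have [measurable]: "g \<in> borel_measurable borel" unfolding g_def by measurable
  interpret W: iid_seq M "\<lambda>j \<omega>. g (\<xi> j \<omega>)" by (rule iid_map) simp
  have "distr M borel (\<lambda>\<omega>. g (\<xi> 0 \<omega>)) = distr M borel (\<xi> 0)"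
  proof (rule measure_eqI)
    fix B :: "real set" assume "B \<in> sets (distr M borel (\<lambda>\<omega>. g (\<xi> 0 \<omega>)))"
    then have [measurable]: "B \<in> sets borel" by simp
    let ?in = "\<lambda>f. emeasure M {\<omega>\<in>space M. f \<omega>}"
    have split: "?in (\<lambda>\<omega>. P \<omega>) = ?in (\<lambda>\<omega>. P \<omega> \<and> \<bar>\<xi> 0 \<omega>\<bar> \<le> c) + ?in (\<lambda>\<omega>. P \<omega> \<and> \<not> \<bar>\<xi> 0 \<omega>\<bar> \<le> c)"
      if [measurable]: "Measurable.pred M P" for P
      by (subst plus_emeasure) (auto intro!: arg_cong[where f="emeasure M"])
    have "emeasure (distr M borel (\<lambda>\<omega>. - \<xi> 0 \<omega>)) {x\<in>B. \<not> \<bar>x\<bar> \<le> c} =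
       emeasure (distr M borel (\<xi> 0)) {x\<in>B. \<not> \<bar>x\<bar> \<le> c}" unfolding sym ..
    then have "?in (\<lambda>\<omega>. - \<xi> 0 \<omega> \<in> B \<and> \<not> \<bar>\<xi> 0 \<omega>\<bar> \<le> c) = ?in (\<lambda>\<omega>. \<xi> 0 \<omega> \<in> B \<and> \<not> \<bar>\<xi> 0 \<omega>\<bar> \<le> c)"
      by (simp add: emeasure_distr vimage_def Int_def conj_commute conj_left_commute)
    moreover have "?in (\<lambda>\<omega>. g (\<xi> 0 \<omega>) \<in> B \<and> \<bar>\<xi> 0 \<omega>\<bar> \<le> c) = ?in (\<lambda>\<omega>. \<xi> 0 \<omega> \<in> B \<and> \<bar>\<xi> 0 \<omega>\<bar> \<le> c)"
      by (intro arg_cong[where f="emeasure M"]) (auto simp: g_def)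
    moreover have "?in (\<lambda>\<omega>. g (\<xi> 0 \<omega>) \<in> B \<and> \<not> \<bar>\<xi> 0 \<omega>\<bar> \<le> c) = ?in (\<lambda>\<omega>. - \<xi> 0 \<omega> \<in> B \<and> \<not> \<bar>\<xi> 0 \<omega>\<bar> \<le> c)"
      by (intro arg_cong[where f="emeasure M"]) (auto simp: g_def)
    ultimately have "?in (\<lambda>\<omega>. g (\<xi> 0 \<omega>) \<in> B) = ?in (\<lambda>\<omega>. \<xi> 0 \<omega> \<in> B)"
      by (subst (1 2) split) auto
    then show "emeasure (distr M borel (\<lambda>\<omega>. g (\<xi> 0 \<omega>))) B = emeasure (distr M borel (\<xi> 0)) B"
      by (simp add: emeasure_distr vimage_def Int_def conj_commute)
  qed simp
  then have "distr M borel (\<lambda>\<omega>. \<Sum>j<r. g (\<xi> j \<omega>)) = distr M borel (\<lambda>\<omega>. \<Sum>j<r. \<xi> j \<omega>)"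
    by (intro iid_sum_distr_eq W.iid_seq_axioms iid_seq_axioms) auto
  then have "measure (distr M borel (\<lambda>\<omega>. \<Sum>j<r. g (\<xi> j \<omega>))) {t..} = measure (distr M borel (\<lambda>\<omega>. \<Sum>j<r. \<xi> j \<omega>)) {t..}"
    by simp
  then have same: "prob {\<omega>\<in>space M. t \<le> (\<Sum>j<r. g (\<xi> j \<omega>))} = tail r t"
    by (simp add: measure_distr vimage_def Int_def conj_commute tail_def)
  have "prob {\<omega>\<in>space M. t \<le> (\<Sum>j<r. if \<bar>\<xi> j \<omega>\<bar> \<le> c then \<xi> j \<omega> else 0)} \<le>
      prob ({\<omega>\<in>space M. t \<le> (\<Sum>j<r. \<xi> j \<omega>)} \<union> {\<omega>\<in>space M. t \<le> (\<Sum>j<r. g (\<xi> j \<omega>))})"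
  proof (intro finite_measure_mono subsetI)
    fix \<omega> assume \<omega>: "\<omega> \<in> {\<omega>\<in>space M. t \<le> (\<Sum>j<r. if \<bar>\<xi> j \<omega>\<bar> \<le> c then \<xi> j \<omega> else 0)}"
    have "2 * (\<Sum>j<r. if \<bar>\<xi> j \<omega>\<bar> \<le> c then \<xi> j \<omega> else 0) = (\<Sum>j<r. \<xi> j \<omega>) + (\<Sum>j<r. g (\<xi> j \<omega>))"
      unfolding sum_distrib_left sum.distrib[symmetric] by (intro sum.cong) (auto simp: g_def)
    then show "\<omega> \<in> {\<omega>\<in>space M. t \<le> (\<Sum>j<r. \<xi> j \<omega>)} \<union> {\<omega>\<in>space M. t \<le> (\<Sum>j<r. g (\<xi> j \<omega>))}"
      using \<omega> by auto
  qed auto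
  also have "\<dots> \<le> tail r t + tail r t"
    using measure_Un_le[of "{\<omega>\<in>space M. t \<le> (\<Sum>j<r. \<xi> j \<omega>)}" M "{\<omega>\<in>space M. t \<le> (\<Sum>j<r. g (\<xi> j \<omega>))}"]
    unfolding same by (simp add: tail_def)
  finally show ?thesis by simp
qed

lemma truncated_second_moments_unbounded:
  assumes "\<not> integrable M (\<lambda>\<omega>. (\<xi> 0 \<omega>)\<^sup>2)"
  shows "\<exists>c>0. B < expectation (\<lambda>\<omega>. (if \<bar>\<xi> 0 \<omega>\<bar> \<le> c then \<xi> 0 \<omega> else 0)\<^sup>2)"
proof (rule ccontr)
  define T where "T c \<omega> = (if \<bar>\<xi> 0 \<omega>\<bar> \<le> c then \<xi> 0 \<omega> else 0)\<^sup>2" for c \<omega>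
  have [measurable]: "T c \<in> borel_measurable M" for c unfolding T_def by measurable
  assume "\<not> ?thesis"
  then have B: "expectation (T c) \<le> B" if "c > 0" for c using that unfolding T_def by force
  have int: "integrable M (T c)" for c
    by (rule integrable_const_bound[where B="c\<^sup>2"]) (auto simp: T_def abs_le_square_iff[symmetric])
  have "(\<integral>\<^sup>+\<omega>. ennreal ((\<xi> 0 \<omega>)\<^sup>2) \<partial>M) \<le> (\<integral>\<^sup>+\<omega>. liminf (\<lambda>n. ennreal (T (real (Suc n)) \<omega>)) \<partial>M)"
  proof (rule nn_integral_mono)
    fix \<omega>
    have "eventually (\<lambda>n. ennreal (T (real (Suc n)) \<omega>) = ennreal ((\<xi> 0 \<omega>)\<^sup>2)) sequentially"
      using eventually_ge_at_top[of "nat \<lceil>\<bar>\<xi> 0 \<omega>\<bar>\<rceil>"]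
    proof eventually_elim
      case (elim n)
      then have "\<bar>\<xi> 0 \<omega>\<bar> \<le> real (Suc n)" by linarith
      then show ?case by (simp add: T_def)
    qed
    then have "(\<lambda>n. ennreal (T (real (Suc n)) \<omega>)) \<longlonglongrightarrow> ennreal ((\<xi> 0 \<omega>)\<^sup>2)" by (rule tendsto_eventually)
    then have "liminf (\<lambda>n. ennreal (T (real (Suc n)) \<omega>)) = ennreal ((\<xi> 0 \<omega>)\<^sup>2)" by (intro lim_imp_Liminf) auto
    then show "ennreal ((\<xi> 0 \<omega>)\<^sup>2) \<le> liminf (\<lambda>n. ennreal (T (real (Suc n)) \<omega>))" by simp
  qed
  also have "\<dots> \<le> liminf (\<lambda>n. \<integral>\<^sup>+\<omega>. ennreal (T (real (Suc n)) \<omega>) \<partial>M)"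
    by (rule nn_integral_liminf) auto
  also have "\<dots> \<le> ennreal B"
  proof (rule Liminf_le)
    have "(\<integral>\<^sup>+\<omega>. ennreal (T (real (Suc n)) \<omega>) \<partial>M) \<le> ennreal B" for n
      using B[of "real (Suc n)"] int by (subst nn_integral_eq_integral) (auto simp: T_def intro!: ennreal_leI)
    then show "\<forall>\<^sub>F n in sequentially. (\<integral>\<^sup>+\<omega>. ennreal (T (real (Suc n)) \<omega>) \<partial>M) \<le> ennreal B" by simp
  qed simp
  finally have "(\<integral>\<^sup>+\<omega>. ennreal ((\<xi> 0 \<omega>)\<^sup>2) \<partial>M) < \<infinity>" by (simp add: le_less_trans)
  then have "integrable M (\<lambda>\<omega>. (\<xi> 0 \<omega>)\<^sup>2)" by (intro integrableI_nonneg) auto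
  with assms show False by simp
qed

text \<open>Unlike in the case of finite variance, the cost \<open>R\<close> per block is fixed, and the gain per block is
  the standard deviation of the truncated variables, which is unbounded in the truncation level.\<close>

lemma tail_moderate_deviation_symmetric:
  assumes sym: "distr M borel (\<lambda>\<omega>. - \<xi> 0 \<omega>) = distr M borel (\<xi> 0)"
    and inf: "\<not> integrable M (\<lambda>\<omega>. (\<xi> 0 \<omega>)\<^sup>2)" and "K > 0"
  shows "\<exists>D>0. \<forall>N d. d \<ge> D \<longrightarrow> real N \<ge> D * d \<longrightarrow> exp (- d) \<le> tail N (K * sqrt (real N * d))"
proof -
  \<comment> \<open>\<open>exp (- R)\<close> is a quarter of the bound for the normal tail above one standard deviation: one factor 2 leaves room in the limit theorem, the other is lost to truncation\<close>
  define R where "R = - ln (1 / sqrt (2 * pi) * exp (- 2) / 4 :: real)"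
  have expR: "exp (- R) = 1 / sqrt (2 * pi) * exp (- 2) / 4" by (simp add: R_def)
  have "exp (- R) < 1"
  proof -
    have "1 / sqrt (2 * pi) \<le> 1" using pi_gt3 by simp
    moreover have "exp (- 2 :: real) \<le> 1" by simp
    ultimately have "1 / sqrt (2 * pi) * exp (- 2 :: real) \<le> 1 * 1" by (intro mult_mono) auto
    then show ?thesis unfolding expR by argo
  qed
  then have "R > 0" by simp
  obtain c where "c > 0" and c: "(2 * K)\<^sup>2 * R < expectation (\<lambda>\<omega>. (if \<bar>\<xi> 0 \<omega>\<bar> \<le> c then \<xi> 0 \<omega> else 0)\<^sup>2)"
    using truncated_second_moments_unbounded[OF inf] by blast
  define g where "g x = (if \<bar>x\<bar> \<le> c then x else 0)" for x :: real
  have [measurable]: "g \<in> borel_measurable borel" unfolding g_def by measurable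
  interpret Y: iid_seq M "\<lambda>j \<omega>. g (\<xi> j \<omega>)" by (rule iid_map) simp
  define s where "s = sqrt (expectation (\<lambda>\<omega>. (g (\<xi> 0 \<omega>))\<^sup>2))"
  have sq: "expectation (\<lambda>\<omega>. (g (\<xi> 0 \<omega>))\<^sup>2) = s\<^sup>2" by (simp add: s_def)
  have sK: "(2 * K)\<^sup>2 * R < s\<^sup>2" using c unfolding sq[symmetric] g_def .
  have "s \<ge> 0" by (simp add: s_def)
  moreover have "s \<noteq> 0" using sK \<open>R > 0\<close> by (auto simp: mult_less_0_iff not_less)
  ultimately have "s > 0" by simp
  have "expectation (\<lambda>\<omega>. g (\<xi> 0 \<omega>)) = 0"
  proof -
    have "expectation (\<lambda>\<omega>. g (- \<xi> 0 \<omega>)) = integral\<^sup>L (distr M borel (\<lambda>\<omega>. - \<xi> 0 \<omega>)) g" by (simp add: integral_distr)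
    also have "\<dots> = expectation (\<lambda>\<omega>. g (\<xi> 0 \<omega>))" unfolding sym by (simp add: integral_distr)
    finally have "expectation (\<lambda>\<omega>. - g (\<xi> 0 \<omega>)) = expectation (\<lambda>\<omega>. g (\<xi> 0 \<omega>))"
      by (simp add: g_def if_distrib cong: if_cong)
    then show ?thesis by simp
  qed
  moreover have "integrable M (\<lambda>\<omega>. (g (\<xi> 0 \<omega>))\<^sup>2)"
    by (rule integrable_const_bound[where B="c\<^sup>2"]) (auto simp: g_def abs_le_square_iff[symmetric])
  ultimately have "eventually (\<lambda>r. 2 * exp (- R) \<le> Y.tail r (s * 1 * sqrt (real r))) sequentially"
    using sq \<open>s > 0\<close> by (intro Y.tail_clt) (auto simp: expR field_simps)
  then obtain r0 where r0: "\<And>r. r \<ge> r0 \<Longrightarrow> 2 * exp (- R) \<le> Y.tail r (s * sqrt (real r))"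
    by (auto simp: eventually_sequentially)
  have "exp (- R) \<le> tail r (s * sqrt (real r))" if "r \<ge> r0" for r
    using r0[OF that, unfolded Y.tail_def] tail_truncation[OF sym, of "s * sqrt (real r)" c r]
    unfolding g_def by linarith
  from tail_moderate_deviation[of r0 R s "1 / 2", OF this \<open>R > 0\<close> \<open>s > 0\<close>]
  obtain D where D: "D > 0" "\<And>N d. d \<ge> D \<Longrightarrow> real N \<ge> D * d \<Longrightarrow>
      exp (- d) \<le> tail N (1 / 2 * s / sqrt R * sqrt (real N * d))" by auto
  have "sqrt ((2 * K)\<^sup>2 * R) \<le> sqrt (s\<^sup>2)" using sK by (intro real_sqrt_le_mono) auto
  then have "2 * K * sqrt R \<le> s" using \<open>K > 0\<close> \<open>s > 0\<close> by (simp add: real_sqrt_mult)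
  then have Ks: "K \<le> 1 / 2 * s / sqrt R" using \<open>R > 0\<close> by (simp add: field_simps)
  show ?thesis
  proof (intro exI[of _ D] conjI allI impI D(1))
    fix N d assume Nd: "d \<ge> D" "real N \<ge> D * d"
    have "d > 0" using Nd D(1) by linarith
    have "exp (- d) \<le> tail N (1 / 2 * s / sqrt R * sqrt (real N * d))" using Nd D by blast
    also have "\<dots> \<le> tail N (K * sqrt (real N * d))"
      by (intro tail_antimono mult_right_mono Ks) (use \<open>d > 0\<close> in auto)
    finally show "exp (- d) \<le> tail N (K * sqrt (real N * d))" .
  qed
qed

text \<open>On the event that \<open>\<xi> 1\<close> is bounded by \<open>K\<close>, which is independent of \<open>\<xi> 0\<close> and has positive
  probability, the square of \<open>\<xi> 0\<close> is dominated by that of the difference.\<close>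

lemma square_integrable_if_difference:
  assumes "integrable M (\<lambda>\<omega>. (\<xi> 0 \<omega> - \<xi> 1 \<omega>)\<^sup>2)"
  shows "integrable M (\<lambda>\<omega>. (\<xi> 0 \<omega>)\<^sup>2)"
proof -
  have "(\<lambda>n. prob {\<omega>\<in>space M. \<bar>\<xi> 1 \<omega>\<bar> \<le> real n}) \<longlonglongrightarrow> prob (\<Union>n. {\<omega>\<in>space M. \<bar>\<xi> 1 \<omega>\<bar> \<le> real n})"
    by (rule finite_Lim_measure_incseq) (auto simp: incseq_def)
  also have "(\<Union>n. {\<omega>\<in>space M. \<bar>\<xi> 1 \<omega>\<bar> \<le> real n}) = space M"
    using real_arch_simple by auto
  finally have "(\<lambda>n. prob {\<omega>\<in>space M. \<bar>\<xi> 1 \<omega>\<bar> \<le> real n}) \<longlonglongrightarrow> 1" by (simp add: prob_space)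
  then have "eventually (\<lambda>n. 1 / 2 < prob {\<omega>\<in>space M. \<bar>\<xi> 1 \<omega>\<bar> \<le> real n}) sequentially"
    by (rule order_tendstoD) simp
  then obtain K :: nat where K: "1 / 2 < prob {\<omega>\<in>space M. \<bar>\<xi> 1 \<omega>\<bar> \<le> real K}"
    by (auto simp: eventually_sequentially)
  define G where "G i x = (if i = 0 then ennreal (x\<^sup>2) else indicator {x. \<bar>x\<bar> \<le> real K} x)" for i :: nat and x :: real
  have [measurable]: "G i \<in> borel_measurable borel" for i unfolding G_def by measurable
  have "indep_vars (\<lambda>_. borel) (\<lambda>i \<omega>. G i (\<xi> i \<omega>)) {0, 1}"
    by (rule indep_vars_compose2[OF indep_vars_subset[OF indep]]) auto
  from indep_vars_nn_integral[OF _ this]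
  have prod: "(\<integral>\<^sup>+\<omega>. G 0 (\<xi> 0 \<omega>) * G 1 (\<xi> 1 \<omega>) \<partial>M) = (\<integral>\<^sup>+\<omega>. G 0 (\<xi> 0 \<omega>) \<partial>M) * (\<integral>\<^sup>+\<omega>. G 1 (\<xi> 1 \<omega>) \<partial>M)"
    by simp
  have "(\<integral>\<^sup>+\<omega>. G 1 (\<xi> 1 \<omega>) \<partial>M) = (\<integral>\<^sup>+\<omega>. indicator {\<omega>\<in>space M. \<bar>\<xi> 1 \<omega>\<bar> \<le> real K} \<omega> \<partial>M)"
    by (intro nn_integral_cong) (auto simp: G_def split: split_indicator)
  also have "\<dots> = ennreal (prob {\<omega>\<in>space M. \<bar>\<xi> 1 \<omega>\<bar> \<le> real K})" by (simp add: emeasure_eq_measure)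
  finally have G1: "(\<integral>\<^sup>+\<omega>. G 1 (\<xi> 1 \<omega>) \<partial>M) = ennreal (prob {\<omega>\<in>space M. \<bar>\<xi> 1 \<omega>\<bar> \<le> real K})" .
  have int: "integrable M (\<lambda>\<omega>. 2 * (\<xi> 0 \<omega> - \<xi> 1 \<omega>)\<^sup>2 + 2 * (real K)\<^sup>2)" using assms by simp
  have "(\<integral>\<^sup>+\<omega>. G 0 (\<xi> 0 \<omega>) * G 1 (\<xi> 1 \<omega>) \<partial>M) \<le> (\<integral>\<^sup>+\<omega>. ennreal (2 * (\<xi> 0 \<omega> - \<xi> 1 \<omega>)\<^sup>2 + 2 * (real K)\<^sup>2) \<partial>M)"
  proof (rule nn_integral_mono)
    fix \<omega>
    have "x\<^sup>2 \<le> 2 * (x - y)\<^sup>2 + 2 * (real K)\<^sup>2" if "\<bar>y\<bar> \<le> real K" for x y :: real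
    proof -
      have "y\<^sup>2 \<le> (real K)\<^sup>2" using that by (simp add: abs_le_square_iff[symmetric])
      moreover have "0 \<le> (x - 2 * y)\<^sup>2" by simp
      ultimately show ?thesis by (simp add: power2_eq_square algebra_simps)
    qed
    then show "G 0 (\<xi> 0 \<omega>) * G 1 (\<xi> 1 \<omega>) \<le> ennreal (2 * (\<xi> 0 \<omega> - \<xi> 1 \<omega>)\<^sup>2 + 2 * (real K)\<^sup>2)"
      by (auto simp: G_def intro!: ennreal_leI simp del: ennreal_plus split: split_indicator)
  qed
  also have "\<dots> < \<infinity>" using int by (subst nn_integral_eq_integral) auto
  finally have "(\<integral>\<^sup>+\<omega>. G 0 (\<xi> 0 \<omega>) \<partial>M) * ennreal (prob {\<omega>\<in>space M. \<bar>\<xi> 1 \<omega>\<bar> \<le> real K}) < \<infinity>"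
    unfolding prod G1 .
  moreover have "0 < prob {\<omega>\<in>space M. \<bar>\<xi> 1 \<omega>\<bar> \<le> real K}" using K by linarith
  ultimately have "(\<integral>\<^sup>+\<omega>. G 0 (\<xi> 0 \<omega>) \<partial>M) < \<infinity>"
    by (auto simp: ennreal_mult_less_top ennreal_eq_0_iff)
  then show ?thesis by (intro integrableI_nonneg) (auto simp: G_def)
qed

text \<open>Symmetrization within a single sequence: the differences of consecutive terms are symmetric, and a
  sum of \<open>N\<close> differences is a difference of two sums of \<open>N\<close> terms, one of which must be at least half as
  large in absolute value.\<close>

lemma two_sided_moderate_deviation_infinite_variance:
  assumes inf: "\<not> integrable M (\<lambda>\<omega>. (\<xi> 0 \<omega>)\<^sup>2)" and "K > 0"
  shows "\<exists>D>0. \<forall>N d. d \<ge> D \<longrightarrow> real N \<ge> D * d \<longrightarrow>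
     exp (- d) / 2 \<le> prob {\<omega>\<in>space M. K * sqrt (real N * d) \<le> \<bar>\<Sum>j<N. \<xi> j \<omega>\<bar>}"
proof -
  interpret Z: iid_seq M "\<lambda>j \<omega>. \<xi> (2 * j) \<omega> - \<xi> (2 * j + 1) \<omega>" by (rule iid_pairwise_differences)
  have "distr M borel (\<lambda>\<omega>. \<xi> 1 \<omega> - \<xi> 0 \<omega>) = distr M borel (\<lambda>\<omega>. \<xi> 0 \<omega> - \<xi> 1 \<omega>)"
    using distr_difference[of 1 0] distr_difference[of 0 1] by simp
  then have "distr M borel (\<lambda>\<omega>. - (\<xi> (2 * 0) \<omega> - \<xi> (2 * 0 + 1) \<omega>)) = distr M borel (\<lambda>\<omega>. \<xi> (2 * 0) \<omega> - \<xi> (2 * 0 + 1) \<omega>)"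
    by simp
  moreover have "\<not> integrable M (\<lambda>\<omega>. (\<xi> (2 * 0) \<omega> - \<xi> (2 * 0 + 1) \<omega>)\<^sup>2)"
    using inf square_integrable_if_difference by auto
  ultimately obtain D where D: "D > 0" "\<And>N d. d \<ge> D \<Longrightarrow> real N \<ge> D * d \<Longrightarrow> exp (- d) \<le> Z.tail N (2 * K * sqrt (real N * d))"
    using Z.tail_moderate_deviation_symmetric[of "2 * K"] \<open>K > 0\<close> by auto
  show ?thesis
  proof (intro exI[of _ D] conjI allI impI D(1))
    fix N d assume Nd: "d \<ge> D" "real N \<ge> D * d"
    let ?t = "K * sqrt (real N * d)"
    let ?P = "prob {\<omega>\<in>space M. ?t \<le> \<bar>\<Sum>j<N. \<xi> j \<omega>\<bar>}"
    let ?A = "\<lambda>J. {\<omega>\<in>space M. ?t \<le> \<bar>\<Sum>j\<in>J. \<xi> j \<omega>\<bar>}"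
    have J: "prob (?A ((\<lambda>j. 2 * j + i) ` {..<N})) = ?P" for i
      by (subst prob_sum_pred) (auto simp: card_image inj_on_def)
    have "exp (- d) \<le> Z.tail N (2 * K * sqrt (real N * d))" using D Nd by blast
    also have "\<dots> \<le> prob (?A ((\<lambda>j. 2 * j + 0) ` {..<N}) \<union> ?A ((\<lambda>j. 2 * j + 1) ` {..<N}))"
      unfolding Z.tail_def
      by (intro finite_measure_mono) (auto simp: sum.reindex inj_on_def sum_subtractf)
    also have "\<dots> \<le> ?P + ?P"
      using measure_Un_le[of "?A ((\<lambda>j. 2 * j + 0) ` {..<N})" M "?A ((\<lambda>j. 2 * j + 1) ` {..<N})"] unfolding J by simp
    finally show "exp (- d) / 2 \<le> ?P" by simp
  qed
qed

end

section \<open>Tail and maximal inequalities\<close>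

lemma exp_le_quadratic_neg:
  fixes u :: real assumes "u \<le> 0" shows "exp u \<le> 1 + u + u\<^sup>2 / 2"
proof -
  define w where "w = - u"
  have w: "w \<ge> 0" using assms by (simp add: w_def)
  have "1 + w + w\<^sup>2 / 2 \<le> exp w" by (rule exp_lower_Taylor_quadratic[OF w])
  moreover have "0 < 1 + w + w\<^sup>2 / 2" using w by (simp add: add_pos_nonneg)
  ultimately have "exp (- w) \<le> 1 / (1 + w + w\<^sup>2 / 2)"
    by (simp add: exp_minus inverse_eq_divide frac_le)
  also have "\<dots> \<le> 1 - w + w\<^sup>2 / 2"
  proof -
    have "(1 - w + w\<^sup>2 / 2) * (1 + w + w\<^sup>2 / 2) = 1 + (w\<^sup>2)\<^sup>2 / 4"
      by (simp add: power2_eq_square algebra_simps)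
    then have "1 \<le> (1 - w + w\<^sup>2 / 2) * (1 + w + w\<^sup>2 / 2)" by simp
    then show ?thesis using \<open>0 < 1 + w + w\<^sup>2 / 2\<close> by (simp only: divide_le_eq) simp
  qed
  finally show ?thesis by (simp add: w_def)
qed

lemma exp_le_quadratic_pos:
  fixes u :: real assumes "u \<ge> 0" shows "exp u \<le> 1 + u + u\<^sup>2 / 2 * exp u"
proof -
  obtain t where t: "\<bar>t\<bar> \<le> \<bar>u\<bar>" "exp u = (\<Sum>m<2. u ^ m / fact m) + exp t / fact 2 * u ^ 2"
    using Maclaurin_exp_le[of u 2] by blast
  have "t \<le> u" using t(1) assms by simp
  then have "exp t \<le> exp u" by (subst exp_le_cancel_iff)
  then have "u\<^sup>2 / 2 * exp t \<le> u\<^sup>2 / 2 * exp u" by (intro mult_left_mono) auto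
  moreover have "exp u = 1 + u + u\<^sup>2 / 2 * exp t" using t(2) by (simp add: numeral_2_eq_2)
  ultimately show ?thesis by linarith
qed

text \<open>Small values of \<open>h * y\<close> contribute the sharp quadratic term, values between \<open>\<delta>\<close> and \<open>4\<close> a crude one
  that is rare, and above \<open>4\<close> the function \<open>exp u / u^4\<close> increases, so that \<open>exp (h * y)\<close> is at most
  \<open>(y / K)^4\<close> times its value at the truncation level \<open>K\<close>.\<close>

lemma exp_truncated_bound:
  fixes h K y \<delta> :: real
  assumes "h > 0" "K > 0" "\<delta> > 0"
  shows "exp (h * (if y \<le> K then y else 0)) \<le>
     1 + h * (if y \<le> K then y else 0)
     + h\<^sup>2 / 2 * (exp \<delta> * y\<^sup>2 + exp 4 * (if \<delta> / h < \<bar>y\<bar> then y\<^sup>2 else 0))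
     + exp (h * K) * (min (\<bar>y\<bar> / K) 1) ^ 4"
proof -
  define Y where "Y = (if y \<le> K then y else 0)"
  define A where "A = h\<^sup>2 / 2 * (exp \<delta> * y\<^sup>2 + exp 4 * (if \<delta> / h < \<bar>y\<bar> then y\<^sup>2 else 0))"
  define B where "B = exp (h * K) * (min (\<bar>y\<bar> / K) 1) ^ 4"
  have A0: "0 \<le> A" and B0: "0 \<le> B" using assms by (auto simp: A_def B_def)
  have A1: "h\<^sup>2 / 2 * (exp \<delta> * y\<^sup>2) \<le> A" unfolding A_def by (intro mult_left_mono) auto
  have A2: "h\<^sup>2 / 2 * (exp 4 * y\<^sup>2) \<le> A" if "\<delta> / h < \<bar>y\<bar>"
    unfolding A_def using that by (intro mult_left_mono) auto
  have Yy: "Y = y" if "y \<le> K" using that by (simp add: Y_def)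
  consider "y > K" | "y \<le> K" "h * y \<le> 0" | "y \<le> K" "0 < h * y" "h * y \<le> \<delta>"
    | "y \<le> K" "\<delta> < h * y" "h * y \<le> 4" | "y \<le> K" "h * y > 4" "0 < h * y" by linarith
  then have "exp (h * Y) \<le> 1 + h * Y + A + B"
  proof cases
    case 1 then show ?thesis using A0 B0 by (simp add: Y_def)
  next
    case 2
    have "exp (h * y) \<le> 1 + h * y + (h * y)\<^sup>2 / 2" by (rule exp_le_quadratic_neg) (use 2 in auto)
    also have "(h * y)\<^sup>2 / 2 \<le> h\<^sup>2 / 2 * (exp \<delta> * y\<^sup>2)"
    proof -
      have "(h * y)\<^sup>2 / 2 * 1 \<le> (h * y)\<^sup>2 / 2 * exp \<delta>" using \<open>\<delta> > 0\<close> by (intro mult_left_mono) auto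
      then show ?thesis by (simp add: power_mult_distrib mult.commute mult.left_commute)
    qed
    also note A1
    finally show ?thesis using B0 Yy[OF 2(1)] by simp
  next
    case 3
    have "exp (h * y) \<le> 1 + h * y + (h * y)\<^sup>2 / 2 * exp (h * y)" by (rule exp_le_quadratic_pos) (use 3 in auto)
    also have "(h * y)\<^sup>2 / 2 * exp (h * y) \<le> (h * y)\<^sup>2 / 2 * exp \<delta>" using 3 by (intro mult_left_mono) auto
    also have "\<dots> = h\<^sup>2 / 2 * (exp \<delta> * y\<^sup>2)" by (simp add: power_mult_distrib)
    also note A1
    finally show ?thesis using B0 Yy[OF 3(1)] by simp
  next
    case 4
    have "\<delta> / h < \<bar>y\<bar>"
    proof -
      have "\<delta> / h < y" using 4 assms by (simp add: divide_less_eq mult.commute)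
      then show ?thesis by linarith
    qed
    have "exp (h * y) \<le> 1 + h * y + (h * y)\<^sup>2 / 2 * exp (h * y)"
      by (rule exp_le_quadratic_pos) (use 4 assms in auto)
    also have "(h * y)\<^sup>2 / 2 * exp (h * y) \<le> (h * y)\<^sup>2 / 2 * exp 4" using 4 by (intro mult_left_mono) auto
    also have "\<dots> = h\<^sup>2 / 2 * (exp 4 * y\<^sup>2)" by (simp add: power_mult_distrib)
    also note A2[OF \<open>\<delta> / h < \<bar>y\<bar>\<close>]
    finally show ?thesis using B0 Yy[OF 4(1)] by simp
  next
    case 5
    then have "y > 0" using assms by (simp add: zero_less_mult_iff)
    have "K / y \<le> exp ((K - y) / y)"
      using exp_ge_add_one_self[of "(K - y) / y"] \<open>y > 0\<close> by (simp add: diff_divide_distrib)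
    then have "(K / y) ^ 4 \<le> exp ((K - y) / y) ^ 4" using \<open>y > 0\<close> assms by (intro power_mono) auto
    also have "\<dots> = exp (4 / y * (K - y))" by (simp add: exp_of_nat_mult[symmetric])
    also have "4 / y * (K - y) \<le> h * (K - y)"
      using 5 \<open>y > 0\<close> by (intro mult_right_mono) (auto simp: divide_le_eq)
    finally have "(K / y) ^ 4 \<le> exp (h * (K - y))" by simp
    then have "(K / y) ^ 4 * exp (h * y) \<le> exp (h * (K - y)) * exp (h * y)" by (intro mult_right_mono) auto
    also have "\<dots> = exp (h * K)" by (simp add: exp_add[symmetric] algebra_simps)
    finally have "(y / K) ^ 4 * ((K / y) ^ 4 * exp (h * y)) \<le> (y / K) ^ 4 * exp (h * K)"
      by (intro mult_left_mono) auto
    moreover have "(y / K) ^ 4 * (K / y) ^ 4 = 1"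
      using \<open>y > 0\<close> assms by (simp add: power_mult_distrib[symmetric])
    ultimately have "exp (h * y) \<le> exp (h * K) * (y / K) ^ 4"
      unfolding mult.assoc[symmetric] by (simp only: mult_1 mult.commute)
    moreover have "min (\<bar>y\<bar> / K) 1 = y / K" using 5 \<open>y > 0\<close> assms by (auto simp: min_def)
    ultimately have "exp (h * y) \<le> B" by (simp add: B_def)
    moreover have "0 \<le> 1 + h * y" using 5 by linarith
    ultimately show ?thesis using A0 unfolding Yy[OF 5(1)] by linarith
  qed
  then show ?thesis unfolding Y_def A_def B_def .
qed

context iid_seq begin

text \<open>The clipped fourth moment serves as one quantity that dominates both the probability of exceeding
  \<open>K\<close> and the normalized fourth moment of the part below \<open>K\<close>. Unlike the latter it is antitone in \<open>K\<close>,
  which allows summation along a grid.\<close>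

definition clipped :: "real \<Rightarrow> real" where
  "clipped K = expectation (\<lambda>\<omega>. (min (\<bar>\<xi> 0 \<omega>\<bar> / K) 1) ^ 4)"

lemma integrable_clipped: "K > 0 \<Longrightarrow> integrable M (\<lambda>\<omega>. (min (\<bar>\<xi> 0 \<omega>\<bar> / K) 1) ^ 4)"
  by (rule integrable_const_bound[where B=1]) (auto simp: power_le_one)

lemma clipped_nonneg: "K > 0 \<Longrightarrow> 0 \<le> clipped K"
  unfolding clipped_def by (intro integral_nonneg_AE) auto

lemma clipped_antimono: "0 < K \<Longrightarrow> K \<le> K' \<Longrightarrow> clipped K' \<le> clipped K"
  unfolding clipped_def
proof (intro integral_mono integrable_clipped power_mono)
  fix \<omega> assume "0 < K" "K \<le> K'"
  then have "\<bar>\<xi> 0 \<omega>\<bar> / K' \<le> \<bar>\<xi> 0 \<omega>\<bar> / K" by (intro divide_left_mono) auto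
  then show "min (\<bar>\<xi> 0 \<omega>\<bar> / K') 1 \<le> min (\<bar>\<xi> 0 \<omega>\<bar> / K) 1" by simp
qed auto

lemma prob_large_le_clipped:
  assumes "K > 0" shows "prob {\<omega>\<in>space M. K < \<bar>\<xi> j \<omega>\<bar>} \<le> clipped K"
proof -
  have "prob {\<omega>\<in>space M. K < \<bar>\<xi> j \<omega>\<bar>} = prob {\<omega>\<in>space M. K < \<bar>\<xi> 0 \<omega>\<bar>}"
    by (rule prob_ident) simp
  also have "\<dots> = expectation (indicator {\<omega>\<in>space M. K < \<bar>\<xi> 0 \<omega>\<bar>})" by simp
  also have "\<dots> \<le> clipped K"
    unfolding clipped_def using assms
    by (intro integral_mono integrable_clipped integrable_real_indicator)
      (auto simp: min_def emeasure_eq_measure split: split_indicator)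
  finally show ?thesis .
qed

end

locale iid_centered = iid_seq +
  assumes square_integrable: "integrable M (\<lambda>\<omega>. (\<xi> 0 \<omega>)\<^sup>2)"
    and centered: "expectation (\<xi> 0) = 0"
begin

definition second_moment :: real where
  "second_moment = expectation (\<lambda>\<omega>. (\<xi> 0 \<omega>)\<^sup>2)"

lemma second_moment_nonneg: "0 \<le> second_moment"
  unfolding second_moment_def by (intro integral_nonneg_AE) auto

lemma integrable_rv [simp]: "integrable M (\<xi> j)"
proof -
  have "integrable M (\<xi> 0)" by (rule square_integrable_imp_integrable[OF rv square_integrable])
  then show ?thesis using integrable_ident[of "\<lambda>x. x" j] by simp
qed

lemma centered_all: "expectation (\<xi> j) = 0"
  using expectation_ident[of "\<lambda>x. x" j] centered by simp

lemma moments_sum: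
  assumes "finite J"
  shows "integrable M (\<lambda>\<omega>. (\<Sum>j\<in>J. \<xi> j \<omega>)\<^sup>2) \<and>
    expectation (\<lambda>\<omega>. (\<Sum>j\<in>J. \<xi> j \<omega>)\<^sup>2) = real (card J) * second_moment"
  using assms
proof (induction J rule: finite_induct)
  case empty then show ?case by simp
next
  case (insert i J)
  let ?S = "\<lambda>\<omega>. \<Sum>j\<in>J. \<xi> j \<omega>"
  have ind: "indep_var borel (\<xi> i) borel ?S" using indep_block_sums[of "{i}" J] insert by simp
  have int: "integrable M (\<lambda>\<omega>. \<xi> i \<omega> * ?S \<omega>)"
    and ex: "expectation (\<lambda>\<omega>. \<xi> i \<omega> * ?S \<omega>) = 0"
    using indep_var_integrable[OF ind] indep_var_lebesgue_integral[OF ind] centered_all[of i] by auto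
  have sq: "integrable M (\<lambda>\<omega>. (\<xi> i \<omega>)\<^sup>2)" "expectation (\<lambda>\<omega>. (\<xi> i \<omega>)\<^sup>2) = second_moment"
    using integrable_ident[of "\<lambda>x. x\<^sup>2" i] expectation_ident[of "\<lambda>x. x\<^sup>2" i] square_integrable
    by (auto simp: second_moment_def)
  have eq: "(\<lambda>\<omega>. (\<Sum>j\<in>insert i J. \<xi> j \<omega>)\<^sup>2) = (\<lambda>\<omega>. (\<xi> i \<omega>)\<^sup>2 + 2 * (\<xi> i \<omega> * ?S \<omega>) + (?S \<omega>)\<^sup>2)"
    using insert by (auto simp: power2_eq_square algebra_simps)
  show ?case unfolding eq using insert int ex sq by (simp add: algebra_simps)
qed

lemma chebyshev_sum:
  assumes "finite J" "u > 0"
  shows "prob {\<omega>\<in>space M. u \<le> \<bar>\<Sum>j\<in>J. \<xi> j \<omega>\<bar>} \<le> real (card J) * second_moment / u\<^sup>2"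
proof -
  let ?S = "\<lambda>\<omega>. \<Sum>j\<in>J. \<xi> j \<omega>"
  have mean: "expectation ?S = 0"
    by (subst Bochner_Integration.integral_sum) (auto simp: centered_all)
  have "?S \<in> borel_measurable M" by simp
  from Chebyshev_inequality[OF this conjunct1[OF moments_sum[OF assms(1)]] assms(2)]
  show ?thesis unfolding mean diff_0_right conjunct2[OF moments_sum[OF assms(1)]] .
qed

text \<open>Truncation from above only lowers the mean, so the linear term may be dropped. The bound is
  uniform in \<open>K\<close>; this is what permits a truncation level comparable to the deviation itself.\<close>

lemma truncated_mgf_bound:
  assumes V: "second_moment < V"
  shows "\<exists>h\<^sub>0>0. \<forall>h K. 0 < h \<longrightarrow> h \<le> h\<^sub>0 \<longrightarrow> 0 < K \<longrightarrow>
     expectation (\<lambda>\<omega>. exp (h * (if \<xi> 0 \<omega> \<le> K then \<xi> 0 \<omega> else 0))) \<le>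
       1 + h\<^sup>2 * V / 2 + exp (h * K) * clipped K"
proof -
  define \<epsilon> where "\<epsilon> = (V - second_moment) / 2"
  have "\<epsilon> > 0" using V by (simp add: \<epsilon>_def)
  define \<delta> where "\<delta> = ln (1 + \<epsilon> / (second_moment + 1))"
  have "second_moment + 1 > 0" using second_moment_nonneg by linarith
  then have pos: "\<epsilon> / (second_moment + 1) > 0" using \<open>\<epsilon> > 0\<close> by simp
  then have "\<delta> > 0" unfolding \<delta>_def by (intro ln_gt_zero) linarith
  have "exp \<delta> * second_moment \<le> second_moment + \<epsilon>"
  proof -
    have "exp \<delta> = 1 + \<epsilon> / (second_moment + 1)"
      unfolding \<delta>_def using pos by (intro exp_ln) linarith
    moreover have "\<epsilon> / (second_moment + 1) * second_moment \<le> \<epsilon>"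
    proof -
      have "\<epsilon> * second_moment \<le> \<epsilon> * (second_moment + 1)" using \<open>\<epsilon> > 0\<close> by (intro mult_left_mono) auto
      then show ?thesis using \<open>second_moment + 1 > 0\<close> by (simp only: times_divide_eq_left pos_divide_le_eq)
    qed
    ultimately show ?thesis by (simp add: distrib_right)
  qed
  define T where "T b \<omega> = (if b < \<bar>\<xi> 0 \<omega>\<bar> then (\<xi> 0 \<omega>)\<^sup>2 else 0)" for b \<omega>
  have [measurable]: "T b \<in> borel_measurable M" for b unfolding T_def by measurable
  have T_int: "integrable M (T b)" for b
    by (rule Bochner_Integration.integrable_bound[OF square_integrable]) (auto simp: T_def)
  have "(\<lambda>n. expectation (T (real n))) \<longlonglongrightarrow> expectation (\<lambda>\<omega>. 0)"
  proof (rule integral_dominated_convergence[where w="\<lambda>\<omega>. (\<xi> 0 \<omega>)\<^sup>2"])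
    show "AE \<omega> in M. (\<lambda>n. T (real n) \<omega>) \<longlonglongrightarrow> 0"
    proof (rule AE_I2, rule tendsto_eventually)
      fix \<omega>
      show "\<forall>\<^sub>F n in sequentially. T (real n) \<omega> = 0"
        using eventually_ge_at_top[of "nat \<lceil>\<bar>\<xi> 0 \<omega>\<bar>\<rceil>"]
      proof eventually_elim
        case (elim n)
        then have "\<bar>\<xi> 0 \<omega>\<bar> \<le> real n" by linarith
        then show ?case by (simp add: T_def)
      qed
    qed
  qed (auto simp: T_def square_integrable)
  then have "eventually (\<lambda>n. expectation (T (real n)) < \<epsilon> / exp 4) sequentially"
    using \<open>\<epsilon> > 0\<close> by (intro order_tendstoD) auto
  then have "eventually (\<lambda>n. n > 0 \<and> expectation (T (real n)) < \<epsilon> / exp 4) sequentially"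
    using eventually_gt_at_top[of "0::nat"] by eventually_elim auto
  then obtain b :: nat where b: "b > 0" "expectation (T (real b)) < \<epsilon> / exp 4"
    by (auto simp: eventually_sequentially)
  show ?thesis
  proof (intro exI[of _ "\<delta> / real b"] conjI allI impI)
    show "0 < \<delta> / real b" using \<open>\<delta> > 0\<close> b by simp
    fix h K :: real assume h: "0 < h" "h \<le> \<delta> / real b" and "0 < K"
    have bh: "real b \<le> \<delta> / h" using h b by (simp add: field_simps)
    let ?Y = "\<lambda>\<omega>. if \<xi> 0 \<omega> \<le> K then \<xi> 0 \<omega> else 0"
    have Yint: "integrable M ?Y"
      by (rule Bochner_Integration.integrable_bound[OF integrable_rv[of 0]]) auto
    have "expectation ?Y \<le> expectation (\<xi> 0)"
      using \<open>0 < K\<close> by (intro integral_mono Yint) auto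
    then have EY: "expectation ?Y \<le> 0" by (simp add: centered)
    have T: "expectation (T (\<delta> / h)) \<le> expectation (T (real b))"
      using bh by (intro integral_mono T_int) (auto simp: T_def)
    have "expectation (\<lambda>\<omega>. exp (h * ?Y \<omega>)) \<le>
       expectation (\<lambda>\<omega>. 1 + h * ?Y \<omega> + h\<^sup>2 / 2 * (exp \<delta> * (\<xi> 0 \<omega>)\<^sup>2 + exp 4 * T (\<delta> / h) \<omega>)
          + exp (h * K) * (min (\<bar>\<xi> 0 \<omega>\<bar> / K) 1) ^ 4)"
    proof (intro integral_mono)
      show "integrable M (\<lambda>\<omega>. exp (h * ?Y \<omega>))"
        by (rule integrable_const_bound[where B="exp (h * K)"]) (use \<open>0 < h\<close> \<open>0 < K\<close> in auto)
      show "exp (h * ?Y \<omega>) \<le> 1 + h * ?Y \<omega> + h\<^sup>2 / 2 * (exp \<delta> * (\<xi> 0 \<omega>)\<^sup>2 + exp 4 * T (\<delta> / h) \<omega>)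
          + exp (h * K) * (min (\<bar>\<xi> 0 \<omega>\<bar> / K) 1) ^ 4" for \<omega>
        unfolding T_def using exp_truncated_bound[OF h(1) \<open>0 < K\<close> \<open>\<delta> > 0\<close>] .
    qed (intro Bochner_Integration.integrable_add integrable_mult_right integrable_clipped
          Yint T_int square_integrable \<open>0 < K\<close> integrable_const)
    also have "\<dots> = 1 + h * expectation ?Y
        + h\<^sup>2 / 2 * (exp \<delta> * second_moment + exp 4 * expectation (T (\<delta> / h))) + exp (h * K) * clipped K"
      using Yint T_int square_integrable integrable_clipped[OF \<open>0 < K\<close>]
      by (simp add: prob_space second_moment_def clipped_def)
    also have "\<dots> \<le> 1 + h * 0 + h\<^sup>2 / 2 * V + exp (h * K) * clipped K"
    proof -
      have "exp 4 * expectation (T (\<delta> / h)) \<le> \<epsilon>"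
      proof -
        have "exp 4 * expectation (T (\<delta> / h)) \<le> exp 4 * (\<epsilon> / exp 4)"
          using T b(2) by (intro mult_left_mono) auto
        then show ?thesis by simp
      qed
      then have "exp \<delta> * second_moment + exp 4 * expectation (T (\<delta> / h)) \<le> V"
        using \<open>exp \<delta> * second_moment \<le> second_moment + \<epsilon>\<close> by (simp add: \<epsilon>_def field_simps)
      then have "h\<^sup>2 / 2 * (exp \<delta> * second_moment + exp 4 * expectation (T (\<delta> / h))) \<le> h\<^sup>2 / 2 * V"
        by (intro mult_left_mono) auto
      moreover have "h * expectation ?Y \<le> h * 0" using EY h by (intro mult_left_mono) auto
      ultimately show ?thesis by simp
    qed
    finally show "expectation (\<lambda>\<omega>. exp (h * ?Y \<omega>)) \<le> 1 + h\<^sup>2 * V / 2 + exp (h * K) * clipped K" by simp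
  qed
qed

text \<open>Markov's inequality for the exponential of the truncated sum, apart from the event that some
  summand exceeds \<open>K\<close>.\<close>

lemma tail_exponential_bound:
  assumes mgf: "expectation (\<lambda>\<omega>. exp (h * (if \<xi> 0 \<omega> \<le> K then \<xi> 0 \<omega> else 0))) \<le>
       1 + h\<^sup>2 * V / 2 + exp (h * K) * clipped K" and "0 < h" "0 < K"
  shows "tail N t \<le> real N * clipped K +
      exp (- h * t + real N * (h\<^sup>2 * V / 2) + exp (h * K) * (real N * clipped K))"
proof -
  define g where "g x = (if x \<le> K then x else 0)" for x :: real
  have [measurable]: "g \<in> borel_measurable borel" unfolding g_def by measurable
  have "tail N t \<le> prob ((\<Union>j<N. {\<omega>\<in>space M. K < \<bar>\<xi> j \<omega>\<bar>}) \<union> {\<omega>\<in>space M. exp (h * t) \<le> (\<Prod>j<N. exp (h * g (\<xi> j \<omega>)))})"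
    unfolding tail_def
  proof (intro finite_measure_mono subsetI)
    fix \<omega> assume \<omega>: "\<omega> \<in> {\<omega>\<in>space M. t \<le> (\<Sum>j<N. \<xi> j \<omega>)}"
    show "\<omega> \<in> (\<Union>j<N. {\<omega>\<in>space M. K < \<bar>\<xi> j \<omega>\<bar>}) \<union> {\<omega>\<in>space M. exp (h * t) \<le> (\<Prod>j<N. exp (h * g (\<xi> j \<omega>)))}"
    proof (cases "\<exists>j<N. K < \<bar>\<xi> j \<omega>\<bar>")
      case True then show ?thesis using \<omega> by auto
    next
      case False
      then have "g (\<xi> j \<omega>) = \<xi> j \<omega>" if "j < N" for j using that by (force simp: g_def)
      then have "(\<Prod>j<N. exp (h * g (\<xi> j \<omega>))) = exp (h * (\<Sum>j<N. \<xi> j \<omega>))"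
        by (simp add: exp_sum[symmetric] sum_distrib_left)
      then show ?thesis using \<omega> \<open>0 < h\<close> by auto
    qed
  qed auto
  also have "\<dots> \<le> prob (\<Union>j<N. {\<omega>\<in>space M. K < \<bar>\<xi> j \<omega>\<bar>}) +
      prob {\<omega>\<in>space M. exp (h * t) \<le> (\<Prod>j<N. exp (h * g (\<xi> j \<omega>)))}"
    by (rule measure_Un_le) auto
  also have "prob (\<Union>j<N. {\<omega>\<in>space M. K < \<bar>\<xi> j \<omega>\<bar>}) \<le> (\<Sum>j<N. prob {\<omega>\<in>space M. K < \<bar>\<xi> j \<omega>\<bar>})"
    by (rule finite_measure_subadditive_finite) auto
  also have "\<dots> \<le> (\<Sum>j<N. clipped K)" by (intro sum_mono prob_large_le_clipped \<open>0 < K\<close>)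
  also have "\<dots> = real N * clipped K" by simp
  also have "prob {\<omega>\<in>space M. exp (h * t) \<le> (\<Prod>j<N. exp (h * g (\<xi> j \<omega>)))} \<le>
      exp (- h * t + real N * (h\<^sup>2 * V / 2) + exp (h * K) * (real N * clipped K))"
  proof -
    have gb: "integrable M (\<lambda>\<omega>. exp (h * g (\<xi> j \<omega>)))" for j
      by (rule integrable_const_bound[where B="exp (h * K)"]) (use \<open>0 < h\<close> \<open>0 < K\<close> in \<open>auto simp: g_def\<close>)
    have iv: "indep_vars (\<lambda>_. borel) (\<lambda>j \<omega>. exp (h * g (\<xi> j \<omega>))) {..<N}"
      by (rule indep_vars_compose2[OF indep_vars_subset[OF indep]]) auto
    have int: "integrable M (\<lambda>\<omega>. \<Prod>j<N. exp (h * g (\<xi> j \<omega>)))"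
      by (rule indep_vars_integrable[OF _ iv gb]) simp
    have "prob {\<omega>\<in>space M. exp (h * t) \<le> (\<Prod>j<N. exp (h * g (\<xi> j \<omega>)))} \<le>
       expectation (\<lambda>\<omega>. \<Prod>j<N. exp (h * g (\<xi> j \<omega>))) / exp (h * t)"
      by (rule integral_Markov_inequality_measure[OF int, of "{}"]) (auto intro!: AE_I2 prod_nonneg)
    also have "expectation (\<lambda>\<omega>. \<Prod>j<N. exp (h * g (\<xi> j \<omega>))) = (\<Prod>j<N. expectation (\<lambda>\<omega>. exp (h * g (\<xi> j \<omega>))))"
      by (rule indep_vars_lebesgue_integral[OF _ iv gb]) simp
    also have "\<dots> = expectation (\<lambda>\<omega>. exp (h * g (\<xi> 0 \<omega>))) ^ N"
    proof -
      have "(\<Prod>j<N. expectation (\<lambda>\<omega>. exp (h * g (\<xi> j \<omega>)))) = (\<Prod>j<N. expectation (\<lambda>\<omega>. exp (h * g (\<xi> 0 \<omega>))))"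
        by (intro prod.cong refl expectation_ident) simp
      then show ?thesis by simp
    qed
    also have "\<dots> \<le> exp (h\<^sup>2 * V / 2 + exp (h * K) * clipped K) ^ N"
    proof (intro power_mono)
      show "expectation (\<lambda>\<omega>. exp (h * g (\<xi> 0 \<omega>))) \<le> exp (h\<^sup>2 * V / 2 + exp (h * K) * clipped K)"
        using mgf exp_ge_add_one_self[of "h\<^sup>2 * V / 2 + exp (h * K) * clipped K"] unfolding g_def by linarith
    qed (auto intro!: integral_nonneg_AE)
    also have "\<dots> = exp (real N * (h\<^sup>2 * V / 2) + exp (h * K) * (real N * clipped K))"
      by (simp add: exp_of_nat_mult[symmetric] algebra_simps)
    finally have "prob {\<omega>\<in>space M. exp (h * t) \<le> (\<Prod>j<N. exp (h * g (\<xi> j \<omega>)))} \<le>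
        exp (real N * (h\<^sup>2 * V / 2) + exp (h * K) * (real N * clipped K) - h * t)"
      by (simp only: exp_diff divide_right_mono exp_ge_zero)
    then show ?thesis by (simp add: algebra_simps)
  qed
  finally show ?thesis by simp
qed

text \<open>The exponent \<open>h\<close> is the smaller of the Gaussian optimum \<open>t / (N * V)\<close> and the value at which the
  jump term \<open>exp (h * K) * N * clipped K\<close> reaches \<open>1\<close>. In the second case the bound is, up
  to a constant, \<open>exp (- h * t / 2)\<close>, a power of \<open>N * clipped K\<close> with exponent \<open>t / (2 * K) \<ge> 1\<close>.\<close>

lemma fuk_nagaev:
  assumes V: "second_moment < V"
  shows "\<exists>h\<^sub>0>0. \<forall>N t K. 0 < K \<longrightarrow> 2 * K \<le> t \<longrightarrow> t \<le> h\<^sub>0 * real N \<longrightarrow>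
     tail N t \<le> 3 * exp (- t\<^sup>2 / (2 * real N * V)) + 4 * (real N * clipped K)"
proof -
  have "V > 0" using V second_moment_nonneg by linarith
  obtain h0 where "h0 > 0" and mgf: "\<And>h K. 0 < h \<Longrightarrow> h \<le> h0 \<Longrightarrow> 0 < K \<Longrightarrow>
     expectation (\<lambda>\<omega>. exp (h * (if \<xi> 0 \<omega> \<le> K then \<xi> 0 \<omega> else 0))) \<le>
       1 + h\<^sup>2 * V / 2 + exp (h * K) * clipped K"
    using truncated_mgf_bound[OF V] by blast
  show ?thesis
  proof (intro exI[of _ "h0 * V"] conjI allI impI)
    show "0 < h0 * V" using \<open>h0 > 0\<close> \<open>V > 0\<close> by simp
    fix N :: nat and t K :: real assume K: "0 < K" "2 * K \<le> t" and t: "t \<le> h0 * V * real N"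
    have "t > 0" using K by linarith
    have "N > 0" using t \<open>t > 0\<close> by (cases N) auto
    define h1 where "h1 = t / (real N * V)"
    have h1: "0 < h1" "h1 \<le> h0" using t \<open>t > 0\<close> \<open>N > 0\<close> \<open>V > 0\<close> by (auto simp: h1_def field_simps)
    define Q where "Q = real N * clipped K"
    have "Q \<ge> 0" using clipped_nonneg K by (simp add: Q_def)
    have bound: "tail N t \<le> Q + exp (- h * t + real N * (h\<^sup>2 * V / 2) + exp (h * K) * Q)" if "0 < h" "h \<le> h0" for h
      unfolding Q_def using tail_exponential_bound[OF mgf] that K by blast
    have quad: "- h * t + real N * (h\<^sup>2 * V / 2) \<le> - h * t / 2" if "0 < h" "h \<le> h1" for h
    proof -
      have "real N * V * h \<le> t" using that \<open>N > 0\<close> \<open>V > 0\<close> by (simp add: h1_def field_simps)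
      then have "real N * V * h * (h / 2) \<le> t * (h / 2)" using that by (intro mult_right_mono) auto
      then show ?thesis by (simp add: power2_eq_square algebra_simps)
    qed
    have e3: "exp 1 \<le> (3::real)" by (rule exp_le)
    consider "exp (h1 * K) * Q \<le> 1" | "Q \<ge> 1" | "exp (h1 * K) * Q > 1" "Q < 1" by linarith
    then show "tail N t \<le> 3 * exp (- t\<^sup>2 / (2 * real N * V)) + 4 * (real N * clipped K)"
    proof cases
      case 1
      have "- h1 * t / 2 = - t\<^sup>2 / (2 * real N * V)" by (simp add: h1_def power2_eq_square)
      then have "exp (- h1 * t + real N * (h1\<^sup>2 * V / 2) + exp (h1 * K) * Q) \<le> exp (- t\<^sup>2 / (2 * real N * V) + 1)"
        using quad[of h1] h1 1 by simp
      also have "\<dots> = exp (- t\<^sup>2 / (2 * real N * V)) * exp 1" by (rule exp_add)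
      also have "\<dots> \<le> exp (- t\<^sup>2 / (2 * real N * V)) * 3" by (intro mult_left_mono e3) auto
      finally show ?thesis using bound[OF h1] \<open>Q \<ge> 0\<close> unfolding Q_def by linarith
    next
      case 2
      then have "tail N t \<le> 4 * Q" using tail_le_1[of N t] by linarith
      then show ?thesis unfolding Q_def by (simp add: add_increasing)
    next
      case 3
      have "Q \<noteq> 0" using 3 by auto
      then have "Q > 0" using \<open>Q \<ge> 0\<close> by simp
      define h where "h = - ln Q / K"
      have "h > 0" using 3 \<open>Q > 0\<close> K by (simp add: h_def divide_neg_pos ln_less_zero)
      have hK: "exp (h * K) * Q = 1" using \<open>Q > 0\<close> K by (simp add: h_def exp_minus)
      have "h < h1"
      proof (rule ccontr)
        assume "\<not> h < h1"
        then have "exp (h1 * K) * Q \<le> exp (h * K) * Q" using K \<open>Q > 0\<close> by (intro mult_right_mono) auto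
        then show False using hK 3 by linarith
      qed
      have "h * (2 * K) \<le> h * t" using K \<open>h > 0\<close> by (intro mult_left_mono) auto
      then have "- h * t / 2 \<le> ln Q" using K by (simp add: h_def)
      then have "exp (- h * t + real N * (h\<^sup>2 * V / 2) + exp (h * K) * Q) \<le> exp (ln Q + 1)"
        using quad[of h] \<open>h > 0\<close> \<open>h < h1\<close> unfolding hK by simp
      also have "\<dots> = Q * exp 1" using \<open>Q > 0\<close> by (simp add: exp_add)
      also have "\<dots> \<le> Q * 3" using \<open>Q > 0\<close> by (intro mult_left_mono e3) auto
      finally have "tail N t \<le> 4 * Q" using bound[of h] \<open>h > 0\<close> \<open>h < h1\<close> h1 by linarith
      then show ?thesis unfolding Q_def by (simp add: add_increasing)
    qed
  qed
qed

text \<open>At the first time \<open>i\<close> when the partial sum reaches \<open>t + u\<close>, the remaining sum is independent of the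
  past and by Chebyshev's inequality at least \<open>- u\<close> with probability at least \<open>1/2\<close>; then the full sum
  is at least \<open>t\<close>.\<close>

lemma ottaviani:
  assumes "u > 0" and u: "2 * real N * second_moment \<le> u\<^sup>2"
  shows "prob {\<omega>\<in>space M. \<exists>i\<le>N. t + u \<le> (\<Sum>j\<in>{m..<m+i}. \<xi> j \<omega>)} \<le> 2 * tail N t"
proof -
  define D where "D i = {x \<in> space (PiM {m..<m+i} (\<lambda>_. borel :: real measure)).
      t + u \<le> (\<Sum>j\<in>{m..<m+i}. x j) \<and> (\<forall>k<i. (\<Sum>j\<in>{m..<m+k}. x j) < t + u)}" for i
  define E where "E i = {x \<in> space (PiM {m+i..<m+N} (\<lambda>_. borel :: real measure)). - u \<le> (\<Sum>j\<in>{m+i..<m+N}. x j)}" for i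
  have meas: "(\<lambda>x. \<Sum>j\<in>{m..<m+k}. x j) \<in> borel_measurable (PiM {m..<m+i} (\<lambda>_. borel :: real measure))" if "k \<le> i" for k i
    using that by (intro borel_measurable_sum measurable_component_singleton) auto
  have D[measurable]: "D i \<in> sets (PiM {m..<m+i} (\<lambda>_. borel))" for i
  proof -
    have m1: "Measurable.pred (PiM {m..<m+i} (\<lambda>_. borel :: real measure)) (\<lambda>x. \<forall>k\<in>{..<i}. (\<Sum>j\<in>{m..<m+k}. x j) < t + u)"
      by (intro pred_intros_finite) (use meas in \<open>auto intro!: borel_measurable_less\<close>)
    have m2: "Measurable.pred (PiM {m..<m+i} (\<lambda>_. borel :: real measure)) (\<lambda>x. t + u \<le> (\<Sum>j\<in>{m..<m+i}. x j))"
      using meas by (auto intro!: borel_measurable_le)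
    have "Measurable.pred (PiM {m..<m+i} (\<lambda>_. borel :: real measure))
        (\<lambda>x. t + u \<le> (\<Sum>j\<in>{m..<m+i}. x j) \<and> (\<forall>k\<in>{..<i}. (\<Sum>j\<in>{m..<m+k}. x j) < t + u))"
      by (intro pred_intros_logic m1 m2)
    then show ?thesis unfolding D_def by (simp add: pred_def Ball_def)
  qed
  have E[measurable]: "E i \<in> sets (PiM {m+i..<m+N} (\<lambda>_. borel))" for i
    unfolding E_def by measurable
  define A where "A i = {\<omega>\<in>space M. t + u \<le> (\<Sum>j\<in>{m..<m+i}. \<xi> j \<omega>) \<and> (\<forall>k<i. (\<Sum>j\<in>{m..<m+k}. \<xi> j \<omega>) < t + u)}" for i
  define B where "B i = {\<omega>\<in>space M. - u \<le> (\<Sum>j\<in>{m+i..<m+N}. \<xi> j \<omega>)}" for i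
  have [measurable]: "A i \<in> events" "B i \<in> events" for i unfolding A_def B_def by measurable
  have AD: "A i = {\<omega>\<in>space M. restrict (\<lambda>i. \<xi> i \<omega>) {m..<m+i} \<in> D i}" for i
  proof -
    have "(\<Sum>j\<in>{m..<m+k}. restrict (\<lambda>i. \<xi> i \<omega>) {m..<m+i} j) = (\<Sum>j\<in>{m..<m+k}. \<xi> j \<omega>)" if "k \<le> i" for k \<omega>
      using that by (intro sum.cong) auto
    then show ?thesis unfolding A_def D_def by (auto simp: space_PiM)
  qed
  have BE: "B i = {\<omega>\<in>space M. restrict (\<lambda>i. \<xi> i \<omega>) {m+i..<m+N} \<in> E i}" for i
    unfolding B_def E_def by (auto simp: space_PiM)
  have AB: "prob (A i \<inter> B i) = prob (A i) * prob (B i)" for i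
  proof -
    have "A i \<inter> B i = {\<omega>\<in>space M. restrict (\<lambda>i. \<xi> i \<omega>) {m..<m+i} \<in> D i \<and> restrict (\<lambda>i. \<xi> i \<omega>) {m+i..<m+N} \<in> E i}"
      unfolding AD BE by auto
    then show ?thesis unfolding AD BE by (simp add: indep_blocks)
  qed
  have Bhalf: "prob (B i) \<ge> 1 / 2" if "i \<le> N" for i
  proof -
    have "prob (space M - B i) \<le> prob {\<omega>\<in>space M. u \<le> \<bar>\<Sum>j\<in>{m+i..<m+N}. \<xi> j \<omega>\<bar>}"
      by (intro finite_measure_mono) (auto simp: B_def)
    also have "\<dots> \<le> real (card {m+i..<m+N}) * second_moment / u\<^sup>2"
      by (intro chebyshev_sum \<open>u > 0\<close>) auto
    also have "\<dots> \<le> real N * second_moment / u\<^sup>2"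
      using second_moment_nonneg by (intro divide_right_mono mult_right_mono) auto
    also have "\<dots> \<le> 1 / 2" using u \<open>u > 0\<close> by (simp add: field_simps)
    finally show ?thesis by (simp add: prob_compl)
  qed
  have "{\<omega>\<in>space M. \<exists>i\<le>N. t + u \<le> (\<Sum>j\<in>{m..<m+i}. \<xi> j \<omega>)} = (\<Union>i\<in>{..N}. A i)"
  proof (intro equalityI subsetI)
    fix \<omega> assume \<omega>: "\<omega> \<in> {\<omega>\<in>space M. \<exists>i\<le>N. t + u \<le> (\<Sum>j\<in>{m..<m+i}. \<xi> j \<omega>)}"
    define i where "i = (LEAST i. t + u \<le> (\<Sum>j\<in>{m..<m+i}. \<xi> j \<omega>))"
    from \<omega> obtain i' where i': "i' \<le> N" "t + u \<le> (\<Sum>j\<in>{m..<m+i'}. \<xi> j \<omega>)" by auto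
    have "t + u \<le> (\<Sum>j\<in>{m..<m+i}. \<xi> j \<omega>)" unfolding i_def by (rule LeastI[of _ i']) (rule i')
    moreover have "i \<le> i'" unfolding i_def by (rule Least_le) (rule i')
    moreover have "(\<Sum>j\<in>{m..<m+k}. \<xi> j \<omega>) < t + u" if "k < i" for k
      using not_less_Least[OF that[unfolded i_def]] by simp
    ultimately show "\<omega> \<in> (\<Union>i\<in>{..N}. A i)" using \<omega> i' by (auto simp: A_def intro!: bexI[of _ i])
  qed (auto simp: A_def)
  then have "prob {\<omega>\<in>space M. \<exists>i\<le>N. t + u \<le> (\<Sum>j\<in>{m..<m+i}. \<xi> j \<omega>)} \<le> (\<Sum>i\<le>N. prob (A i))"
    by (simp add: finite_measure_subadditive_finite image_subset_iff)
  also have "\<dots> \<le> (\<Sum>i\<le>N. 2 * prob (A i \<inter> B i))"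
  proof (intro sum_mono)
    fix i assume "i \<in> {..N}"
    then have "prob (A i) * (1 / 2) \<le> prob (A i) * prob (B i)" by (intro mult_left_mono Bhalf) auto
    then show "prob (A i) \<le> 2 * prob (A i \<inter> B i)" unfolding AB by simp
  qed
  also have "\<dots> = 2 * (\<Sum>i\<le>N. prob (A i \<inter> B i))" by (simp add: sum_distrib_left)
  also have "(\<Sum>i\<le>N. prob (A i \<inter> B i)) = prob (\<Union>i\<in>{..N}. A i \<inter> B i)"
  proof (rule finite_measure_finite_Union[symmetric])
    show "disjoint_family_on (\<lambda>i. A i \<inter> B i) {..N}"
    proof (rule disjoint_family_on_mono)
      show "disjoint_family (\<lambda>i. A i \<inter> B i)"
        by (rule disjoint_familyI_less) (force simp: A_def)
    qed simp
  qed auto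
  also have "\<dots> \<le> prob {\<omega>\<in>space M. t \<le> (\<Sum>j\<in>{m..<m+N}. \<xi> j \<omega>)}"
  proof (intro finite_measure_mono subsetI)
    fix \<omega> assume "\<omega> \<in> (\<Union>i\<in>{..N}. A i \<inter> B i)"
    then obtain i where i: "i \<le> N" "\<omega> \<in> A i" "\<omega> \<in> B i" by auto
    have "(\<Sum>j\<in>{m..<m+N}. \<xi> j \<omega>) = (\<Sum>j\<in>{m..<m+i}. \<xi> j \<omega>) + (\<Sum>j\<in>{m+i..<m+N}. \<xi> j \<omega>)"
      using i(1) by (subst sum.atLeastLessThan_concat) auto
    then show "\<omega> \<in> {\<omega>\<in>space M. t \<le> (\<Sum>j\<in>{m..<m+N}. \<xi> j \<omega>)}"
      using i by (auto simp: A_def B_def)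
  qed auto
  also have "\<dots> = tail N t" by (subst prob_sum_ge_eq_tail) auto
  finally show ?thesis by simp
qed

end

section \<open>Regularity of the window length\<close>

text \<open>Comparison with the telescoping series of the antiderivative \<open>- (ln x) powr (- \<eta>) / \<eta>\<close>; for the
  divergent borderline case the antiderivative is \<open>ln (ln x)\<close>.\<close>

lemma summable_bertrand:
  fixes \<eta> :: real assumes "\<eta> > 0"
  shows "summable (\<lambda>n. 1 / (real n * ln (real n) powr (1 + \<eta>)))"
proof -
  define G where "G x = - (ln x powr - \<eta> / \<eta>)" for x :: real
  have "(\<lambda>n. G (real n)) \<longlonglongrightarrow> 0" unfolding G_def using assms by real_asymp
  then have tele: "summable (\<lambda>n. G (real (Suc n)) - G (real n))" by (rule telescope_summable)
  have "summable (\<lambda>n. 1 / (real (Suc n) * ln (real (Suc n)) powr (1 + \<eta>)))"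
  proof (rule summable_comparison_test_ev[OF _ tele])
    show "\<forall>\<^sub>F n in sequentially. norm (1 / (real (Suc n) * ln (real (Suc n)) powr (1 + \<eta>))) \<le> G (real (Suc n)) - G (real n)"
      using eventually_ge_at_top[of 2]
    proof eventually_elim
      case (elim n)
      have "\<exists>z>real n. z < real (Suc n) \<and> G (real (Suc n)) - G (real n) = (real (Suc n) - real n) * (1 / (z * ln z powr (1 + \<eta>)))"
      proof (rule MVT2)
        fix z assume "real n \<le> z"
        then have z: "z > 1" "ln z > 0" using elim by auto
        have "(G has_real_derivative - (- \<eta> * ln z powr (- \<eta> - 1) * (1 / z) / \<eta>)) (at z)"
          unfolding G_def using z by (auto intro!: derivative_eq_intros)
        moreover have "- (- \<eta> * ln z powr (- \<eta> - 1) * (1 / z) / \<eta>) = 1 / (z * ln z powr (1 + \<eta>))"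
        proof -
          have "ln z powr (- \<eta> - 1) = 1 / ln z powr (1 + \<eta>)"
            unfolding powr_minus_divide[symmetric] by (rule arg_cong[where f="\<lambda>p. ln z powr p"]) simp
          then show ?thesis using assms by simp
        qed
        ultimately show "(G has_real_derivative 1 / (z * ln z powr (1 + \<eta>))) (at z)" by simp
      qed simp
      then obtain z where z: "real n < z" "z < real (Suc n)" "G (real (Suc n)) - G (real n) = 1 / (z * ln z powr (1 + \<eta>))" by auto
      have "ln z powr (1 + \<eta>) \<le> ln (real (Suc n)) powr (1 + \<eta>)" using z elim assms by (intro powr_mono2) auto
      then have "z * ln z powr (1 + \<eta>) \<le> real (Suc n) * ln (real (Suc n)) powr (1 + \<eta>)" using z by (intro mult_mono) auto
      moreover have "0 < z * ln z powr (1 + \<eta>)" using z elim by auto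
      ultimately show ?case unfolding z(3) by (simp add: frac_le del: of_nat_Suc)
    qed
  qed
  then show ?thesis by (subst (asm) summable_Suc_iff)
qed

lemma not_summable_bertrand: "\<not> summable (\<lambda>n. 1 / (real n * ln (real n)))"
proof
  assume s: "summable (\<lambda>n. 1 / (real n * ln (real n)))"
  define F where "F x = ln (ln x)" for x :: real
  have mvt: "0 \<le> F (real (Suc n)) - F (real n) \<and> F (real (Suc n)) - F (real n) \<le> 1 / (real n * ln (real n))" if "n \<ge> 2" for n
  proof -
    have "\<exists>z>real n. z < real (Suc n) \<and> F (real (Suc n)) - F (real n) = (real (Suc n) - real n) * (1 / (z * ln z))"
    proof (rule MVT2)
      fix z assume "real n \<le> z"
      then have "z > 1" "ln z > 0" using that by auto
      then show "(F has_real_derivative 1 / (z * ln z)) (at z)"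
        unfolding F_def by (auto intro!: derivative_eq_intros)
    qed simp
    then obtain z where z: "real n < z" "F (real (Suc n)) - F (real n) = 1 / (z * ln z)" by auto
    have "real n * ln (real n) \<le> z * ln z" using z that by (intro mult_mono) auto
    then show ?thesis unfolding z(2) using z(1) that by (auto intro!: divide_left_mono mult_pos_pos)
  qed
  have "summable (\<lambda>n. F (real (Suc n)) - F (real n))"
  proof (rule summable_comparison_test_ev[OF _ s])
    show "\<forall>\<^sub>F n in sequentially. norm (F (real (Suc n)) - F (real n)) \<le> 1 / (real n * ln (real n))"
      using eventually_ge_at_top[of 2] by eventually_elim (use mvt in fastforce)
  qed
  then have "convergent (\<lambda>m. F (real m) - F (real 0))"
    unfolding summable_iff_convergent sum_lessThan_telescope[of "\<lambda>n. F (real n)"] .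
  then have "Bseq (\<lambda>m. F (real m))" unfolding convergent_diff_const_right_iff by (rule convergent_imp_Bseq)
  then obtain B where B: "\<And>m. norm (F (real m)) \<le> B" by (rule BseqE) blast
  have "filterlim (\<lambda>m. F (real m)) at_top sequentially" unfolding F_def by real_asymp
  then have "eventually (\<lambda>m. B + 1 \<le> F (real m)) sequentially" unfolding filterlim_at_top by blast
  then obtain m where "B + 1 \<le> F (real m)" unfolding eventually_sequentially by blast
  then show False using B[of m] by simp
qed

text \<open>The interface between the analysis of \<open>L\<close> and the probabilistic part. In \<open>a_growth\<close>, an exponent
  above \<open>1/2\<close> makes \<open>(s n)^4\<close> grow faster than \<open>n\<close>, which the summation of clipped moments requires.\<close>

locale window_seq =
  fixes a d :: "nat \<Rightarrow> real" and n\<^sub>0 :: nat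
  assumes n0_pos: "1 \<le> n\<^sub>0"
    and a_ge: "n\<^sub>0 \<le> n \<Longrightarrow> 1 \<le> a n"
    and d_ge: "n\<^sub>0 \<le> n \<Longrightarrow> 1 \<le> d n"
    and a_mono: "n\<^sub>0 \<le> m \<Longrightarrow> m \<le> n \<Longrightarrow> a m \<le> a n"
    and a_slope: "n\<^sub>0 \<le> m \<Longrightarrow> m \<le> n \<Longrightarrow> a n - a m \<le> real n - real m"
    and a_ratio: "n\<^sub>0 \<le> m \<Longrightarrow> m \<le> n \<Longrightarrow> a n * real m \<le> a m * real n"
    and a_growth: "n\<^sub>0 \<le> m \<Longrightarrow> m \<le> n \<Longrightarrow> a m * (real n / real m) powr (3 / 4) \<le> a n"
    and d_mono: "n\<^sub>0 \<le> m \<Longrightarrow> m \<le> n \<Longrightarrow> d m \<le> d n"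
    and a_le: "n\<^sub>0 \<le> n \<Longrightarrow> a n \<le> real n"
    and d_top: "filterlim d at_top sequentially"
    and a_over_d: "filterlim (\<lambda>n. a n / d n) at_top sequentially"
    and summable_window: "\<eta> > 0 \<Longrightarrow> summable (\<lambda>n. exp (- (1 + \<eta>) * d n) / a n)"
    and not_summable_window: "\<not> summable (\<lambda>n. exp (- d n) / a n)"

text \<open>If the elasticity exceeded \<open>1/4\<close> at arbitrarily large arguments, then, being antitone, it would exceed
  \<open>1/4\<close> on a half-line, and \<open>L (2 * x) / L x\<close> would stay above \<open>exp (1 / 8)\<close>, contrary to slow variation.\<close>

lemma admissible_elasticity:
  assumes "admissible_L L"
  shows "\<exists>x\<^sub>1\<ge>1. (\<forall>x\<ge>x\<^sub>1. L x > 0 \<and> L differentiable (at x) \<and> x * deriv L x / L x \<le> 1 / 4) \<and> mono_on {x\<^sub>1..} L"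
proof -
  obtain x0 where L: "\<And>x. x \<ge> x0 \<Longrightarrow> L x > 0" "\<And>x. x \<ge> x0 \<Longrightarrow> L differentiable (at x)"
    and mono: "mono_on {x0..} L" and anti: "antimono_on {x0..} (\<lambda>x. x * deriv L x / L x)"
    and sv: "slowly_varying L"
    using assms unfolding admissible_L_def by blast
  define q where "q x = x * deriv L x / L x" for x
  have "\<exists>x\<ge>x0. q x \<le> 1 / 4"
  proof (rule ccontr)
    assume "\<not> ?thesis"
    then have q: "q x > 1 / 4" if "x \<ge> x0" for x using that by force
    have "exp (1 / 8) \<le> L (2 * x) / L x" if x: "x \<ge> max x0 1" for x
    proof -
      \<comment> \<open>the mean value theorem for \<open>ln (L x)\<close> on \<open>[x, 2 x]\<close>; the factor \<open>x / z \<ge> 1/2\<close> accounts for \<open>1/8\<close>\<close>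
      have "\<exists>z>x. z < 2 * x \<and> ln (L (2 * x)) - ln (L x) = (2 * x - x) * (deriv L z / L z)"
      proof (rule MVT2)
        show "x < 2 * x" using x by simp
        fix z assume z: "x \<le> z" "z \<le> 2 * x"
        then have "DERIV L z :> deriv L z" "L z > 0" using L x by (auto simp: DERIV_deriv_iff_real_differentiable)
        then show "((\<lambda>x. ln (L x)) has_real_derivative deriv L z / L z) (at z)"
          by (auto intro!: derivative_eq_intros)
      qed
      then obtain z where z: "x < z" "z < 2 * x" "ln (L (2 * x)) - ln (L x) = x * (deriv L z / L z)" by auto
      have "z > 0" "z \<ge> x0" using z x by auto
      have "1 / 8 \<le> (x / z) * (1 / 4)" using z \<open>z > 0\<close> by (simp add: field_simps)
      also have "\<dots> \<le> (x / z) * q z" using q[OF \<open>z \<ge> x0\<close>] x \<open>z > 0\<close> by (intro mult_left_mono) auto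
      also have "\<dots> = ln (L (2 * x)) - ln (L x)" unfolding z(3) q_def using \<open>z > 0\<close> by simp
      also have "\<dots> = ln (L (2 * x) / L x)" using L[of x] L[of "2 * x"] x by (subst ln_div) auto
      finally show ?thesis using L[of x] L[of "2 * x"] x by (subst (asm) ln_ge_iff) auto
    qed
    then have "eventually (\<lambda>x. exp (1 / 8) \<le> L (2 * x) / L x) at_top"
      unfolding eventually_at_top_linorder by blast
    moreover have "((\<lambda>x. L (2 * x) / L x) \<longlongrightarrow> 1) at_top" using sv unfolding slowly_varying_def by auto
    ultimately have "exp (1 / 8 :: real) \<le> 1" by (intro tendsto_lowerbound) auto
    then show False by simp
  qed
  then obtain x where x: "x \<ge> x0" "q x \<le> 1 / 4" by blast
  show ?thesis
  proof (intro exI[of _ "max x 1"] conjI allI impI)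
    fix y assume "max x 1 \<le> y"
    then have y: "y \<ge> x" "y \<ge> x0" using x by auto
    show "L y > 0" "L differentiable (at y)" using L y by auto
    have "q y \<le> q x" using monotone_onD[OF anti, of x y] x y by (simp add: q_def)
    then show "y * deriv L y / L y \<le> 1 / 4" using x unfolding q_def by linarith
  qed (use mono x in \<open>auto simp: monotone_on_def\<close>)
qed

text \<open>The elasticity bound says that \<open>ln (L x) - ln x / 4\<close> has nonpositive derivative.\<close>

lemma admissible_growth:
  assumes "admissible_L L"
  shows "\<exists>x\<^sub>1\<ge>1. (\<forall>x\<ge>x\<^sub>1. L x > 0) \<and>
    (\<forall>x y. x\<^sub>1 \<le> x \<longrightarrow> x \<le> y \<longrightarrow> L x \<le> L y \<and> L y \<le> L x * (y / x) powr (1 / 4))"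
proof -
  obtain x1 where "x1 \<ge> 1" and L: "\<And>x. x \<ge> x1 \<Longrightarrow> L x > 0" "\<And>x. x \<ge> x1 \<Longrightarrow> L differentiable (at x)"
      "\<And>x. x \<ge> x1 \<Longrightarrow> x * deriv L x / L x \<le> 1 / 4" and mono: "mono_on {x1..} L"
    using admissible_elasticity[OF assms] by blast
  have "L y \<le> L x * (y / x) powr (1 / 4)" if xy: "x1 \<le> x" "x \<le> y" for x y
  proof -
    have "x > 0" using xy \<open>x1 \<ge> 1\<close> by linarith
    have "ln (L y) - 1 / 4 * ln y \<le> ln (L x) - 1 / 4 * ln x"
    proof (rule DERIV_nonpos_imp_nonincreasing[OF xy(2)])
      fix z assume z: "x \<le> z" "z \<le> y"
      then have "z \<ge> x1" "z > 0" using xy \<open>x > 0\<close> by auto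
      have "((\<lambda>z. ln (L z) - 1 / 4 * ln z) has_real_derivative deriv L z / L z - 1 / 4 * (1 / z)) (at z)"
        using L(1,2)[OF \<open>z \<ge> x1\<close>] \<open>z > 0\<close>
        by (auto simp: DERIV_deriv_iff_real_differentiable[symmetric] intro!: derivative_eq_intros)
      moreover have "deriv L z / L z - 1 / 4 * (1 / z) \<le> 0"
        using L(3)[OF \<open>z \<ge> x1\<close>] \<open>z > 0\<close> by (simp add: field_simps)
      ultimately show "\<exists>D. ((\<lambda>z. ln (L z) - 1 / 4 * ln z) has_real_derivative D) (at z) \<and> D \<le> 0" by blast
    qed
    moreover have pos: "L x > 0" "L y > 0" "y > 0" using L(1) xy \<open>x > 0\<close> by auto
    ultimately have "ln (L y) \<le> ln (L x) + 1 / 4 * ln (y / x)"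
      using \<open>x > 0\<close> by (simp add: ln_div right_diff_distrib)
    also have "\<dots> = ln (L x * (y / x) powr (1 / 4))"
      using pos \<open>x > 0\<close> by (simp add: ln_mult ln_powr)
    finally show ?thesis using pos \<open>x > 0\<close> by (subst (asm) ln_le_cancel_iff) auto
  qed
  moreover have "L x \<le> L y" if "x1 \<le> x" "x \<le> y" for x y using monotone_onD[OF mono, of x y] that by simp
  ultimately show ?thesis using \<open>x1 \<ge> 1\<close> L(1) by blast
qed

lemma power_over_log_at_top:
  fixes c K B :: real assumes "c > 0" "K > 0"
  shows "filterlim (\<lambda>n::nat. c * (real n / K) powr (3 / 4)) at_top sequentially"
    and "filterlim (\<lambda>n::nat. c * (real n / K) powr (3 / 4) / (B + 1 / 4 * ln (real n / K) + ln (ln (real n)))) at_top sequentially"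
  using assms by real_asymp+

text \<open>Both series conditions reduce to Bertrand series, as \<open>exp (- c * d n) / a n\<close> equals
  \<open>L(n) powr (1 - c) / (n * (ln n) powr c)\<close>.\<close>

lemma admissible_window:
  assumes "admissible_L L"
  shows "\<exists>n\<^sub>0. window_seq (a_seq L) (d_seq L) n\<^sub>0"
proof -
  obtain x1 where "x1 \<ge> 1" and pos: "\<And>x. x \<ge> x1 \<Longrightarrow> L x > 0"
    and mono: "\<And>x y. x1 \<le> x \<Longrightarrow> x \<le> y \<Longrightarrow> L x \<le> L y"
    and growth: "\<And>x y. x1 \<le> x \<Longrightarrow> x \<le> y \<Longrightarrow> L y \<le> L x * (y / x) powr (1 / 4)"
    using admissible_growth[OF assms] by blast
  have Ltop: "filterlim (\<lambda>n. L (real n)) at_top sequentially"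
    using assms unfolding admissible_L_def
    by (auto intro: filterlim_compose[OF _ filterlim_real_sequentially])
  define k where "k = nat \<lceil>x1\<rceil>"
  have k: "real k \<ge> x1" "k \<ge> 1" using \<open>x1 \<ge> 1\<close> unfolding k_def by linarith+
  have a_growth: "a_seq L m * (real n / real m) powr (3 / 4) \<le> a_seq L n" if "k \<le> m" "m \<le> n" for m n
  proof -
    have mn: "x1 \<le> real m" "real m \<le> real n" "real m > 0" using that k by auto
    have "real n / real m = (real n / real m) powr (3 / 4) * (real n / real m) powr (1 / 4)"
      using mn by (simp add: powr_add[symmetric])
    then have "real n = real m * ((real n / real m) powr (3 / 4) * (real n / real m) powr (1 / 4))"
      using mn(3) by (simp add: field_simps)
    moreover have "0 < L (real m)" "0 < L (real n)" using pos mn by auto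
    moreover have "L (real n) * (real m * (real n / real m) powr (3 / 4)) \<le>
        L (real m) * (real n / real m) powr (1 / 4) * (real m * (real n / real m) powr (3 / 4))"
      using growth[OF mn(1,2)] by (intro mult_right_mono) auto
    moreover have "L (real m) * (real n / real m) powr (1 / 4) * (real m * (real n / real m) powr (3 / 4)) =
        L (real m) * (real m * ((real n / real m) powr (3 / 4) * (real n / real m) powr (1 / 4)))"
      by (simp only: ac_simps)
    ultimately have "L (real n) * (real m * (real n / real m) powr (3 / 4)) \<le> L (real m) * real n"
      by simp
    then show ?thesis using \<open>0 < L (real m)\<close> \<open>0 < L (real n)\<close>
      unfolding a_seq_def by (simp add: field_simps)
  qed
  have ak: "a_seq L k > 0" using pos[OF k(1)] k by (simp add: a_seq_def)
  have Lk: "L (real k) > 0" using pos[OF k(1)] .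
  have a_lower: "a_seq L k * (real n / real k) powr (3 / 4) \<le> a_seq L n" if "n \<ge> k" for n
    using a_growth[OF order_refl that] .
  have "filterlim (\<lambda>n. a_seq L k * (real n / real k) powr (3 / 4)) at_top sequentially"
    using ak k(2) by (intro power_over_log_at_top) auto
  then have a_top: "filterlim (a_seq L) at_top sequentially"
    by (rule filterlim_at_top_mono) (use a_lower in \<open>auto simp: eventually_sequentially\<close>)
  have d_upper: "d_seq L n \<le> ln (L (real k)) + 1 / 4 * ln (real n / real k) + ln (ln (real n))" if "n \<ge> k" "n \<ge> 3" for n
  proof -
    have kn: "x1 \<le> real k" "real k \<le> real n" "real k > 0" "real n > 0" using that k by auto
    have "ln (L (real n)) \<le> ln (L (real k) * (real n / real k) powr (1 / 4))"
      using growth[OF kn(1,2)] pos[of "real n"] kn Lk by (subst ln_le_cancel_iff) auto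
    then show ?thesis using kn Lk by (simp add: d_seq_def ln_mult ln_powr)
  qed
  have "eventually (\<lambda>n. n \<ge> k \<and> n \<ge> 3 \<and> a_seq L n \<ge> 1 \<and> L (real n) \<ge> exp 1) sequentially"
    using eventually_ge_at_top[of k] eventually_ge_at_top[of 3] a_top Ltop
    unfolding filterlim_at_top by (intro eventually_conj) auto
  then obtain N where N: "\<And>n. n \<ge> N \<Longrightarrow> n \<ge> k \<and> n \<ge> 3 \<and> a_seq L n \<ge> 1 \<and> L (real n) \<ge> exp 1"
    unfolding eventually_sequentially by blast
  have ln1: "1 \<le> ln (L (real n))" and lnln: "0 \<le> ln (ln (real n))" and L1: "1 \<le> L (real n)"
    and ln0: "1 \<le> ln (real n)" if "n \<ge> N" for n
  proof -
    have "L (real n) \<ge> exp 1" using N[OF that] by blast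
    then show "1 \<le> ln (L (real n))" by (subst ln_ge_iff) (auto intro: less_le_trans[OF exp_gt_zero])
    show "1 \<le> L (real n)" using \<open>L (real n) \<ge> exp 1\<close> exp_ge_add_one_self[of 1] by linarith
    have "exp 1 \<le> real n" using N[OF that] exp_le by (intro order_trans[OF exp_le]) auto
    then show "1 \<le> ln (real n)" using N[OF that] by (subst ln_ge_iff) auto
    then show "0 \<le> ln (ln (real n))" by simp
  qed
  have d_top: "filterlim (d_seq L) at_top sequentially"
  proof (rule filterlim_at_top_mono)
    show "filterlim (\<lambda>n. ln (ln (real n))) at_top sequentially" by real_asymp
    show "\<forall>\<^sub>F n in sequentially. ln (ln (real n)) \<le> d_seq L n"
      using eventually_ge_at_top[of N] by eventually_elim (use ln1 in \<open>force simp: d_seq_def\<close>)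
  qed
  have expd: "exp (- c * d_seq L n) = 1 / (L (real n) powr c * ln (real n) powr c)" if "n \<ge> N" for n c
  proof -
    have "L (real n) > 0" "ln (real n) > 0" using L1[OF that] ln0[OF that] by auto
    then show ?thesis
      by (simp add: d_seq_def powr_def distrib_left exp_add[symmetric] exp_minus inverse_eq_divide divide_simps)
  qed
  have "window_seq (a_seq L) (d_seq L) N"
  proof
    show "1 \<le> N" using N[of N] k by simp
    show "1 \<le> a_seq L n" if "N \<le> n" for n using N that by blast
    show d1: "1 \<le> d_seq L n" if "N \<le> n" for n using ln1[OF that] lnln[OF that] by (simp add: d_seq_def)
    have Lmn: "0 < L (real m)" "L (real m) \<le> L (real n)" if "N \<le> m" "m \<le> n" for m n
      using that N[of m] k pos[of "real m"] mono[of "real m" "real n"] by auto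
    show "a_seq L m * (real n / real m) powr (3 / 4) \<le> a_seq L n" if "N \<le> m" "m \<le> n" for m n
      using a_growth that N[of m] by auto
    then show "a_seq L m \<le> a_seq L n" if "N \<le> m" "m \<le> n" for m n
    proof -
      have "real n / real m \<ge> 1" using that N[of m] by simp
      then have "(real n / real m) powr (3 / 4) \<ge> 1" by (intro ge_one_powr_ge_zero) auto
      then have "a_seq L m * 1 \<le> a_seq L m * (real n / real m) powr (3 / 4)"
        using N[of m] that by (intro mult_left_mono) auto
      also have "\<dots> \<le> a_seq L n" using a_growth that N[of m] by auto
      finally show ?thesis by simp
    qed
    show "a_seq L n - a_seq L m \<le> real n - real m" if "N \<le> m" "m \<le> n" for m n
    proof -
      have "a_seq L n \<le> real n / L (real m)"
        unfolding a_seq_def using Lmn[OF that] by (intro divide_left_mono) (auto intro: mult_pos_pos less_le_trans)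
      then have "a_seq L n - a_seq L m \<le> (real n - real m) / L (real m)"
        by (simp add: a_seq_def diff_divide_distrib)
      also have "\<dots> \<le> (real n - real m) / 1"
        using L1[OF that(1)] that by (intro divide_left_mono) auto
      finally show ?thesis by simp
    qed
    show "a_seq L n * real m \<le> a_seq L m * real n" if "N \<le> m" "m \<le> n" for m n
    proof -
      have "0 < L (real n)" using Lmn[OF that] by linarith
      then have "real n * real m / L (real n) \<le> real n * real m / L (real m)"
        using Lmn[OF that] by (intro divide_left_mono) auto
      then show ?thesis by (simp add: a_seq_def mult.commute)
    qed
    show "d_seq L m \<le> d_seq L n" if "N \<le> m" "m \<le> n" for m n
    proof -
      have "ln (L (real m)) \<le> ln (L (real n))" using Lmn[OF that] by simp
      moreover have "ln (real m) > 0" using ln0[OF that(1)] by linarith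
      moreover have "ln (real m) \<le> ln (real n)" using that N[of m] by simp
      ultimately show ?thesis unfolding d_seq_def by (intro add_mono) auto
    qed
    show "a_seq L n \<le> real n" if "N \<le> n" for n
      using L1[OF that] unfolding a_seq_def by (simp add: divide_le_eq mult_left_le_one_le mult_left_mono mult_le_cancel_left1)
    show "filterlim (d_seq L) at_top sequentially" by (rule d_top)
    show "filterlim (\<lambda>n. a_seq L n / d_seq L n) at_top sequentially"
    proof (rule filterlim_at_top_mono)
      show "filterlim (\<lambda>n. a_seq L k * (real n / real k) powr (3 / 4) /
          (ln (L (real k)) + 1 / 4 * ln (real n / real k) + ln (ln (real n)))) at_top sequentially"
        using ak k(2) by (intro power_over_log_at_top) auto
      show "\<forall>\<^sub>F n in sequentially. a_seq L k * (real n / real k) powr (3 / 4) /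
          (ln (L (real k)) + 1 / 4 * ln (real n / real k) + ln (ln (real n))) \<le> a_seq L n / d_seq L n"
        using eventually_ge_at_top[of N]
      proof eventually_elim
        case (elim n)
        have "n \<ge> k" "n \<ge> 3" "a_seq L n \<ge> 1" using N[OF elim] by auto
        then show ?case
          using a_lower[of n] d_upper[of n] d1[OF elim] ak by (intro frac_le) auto
      qed
    qed
    show "summable (\<lambda>n. exp (- (1 + \<eta>) * d_seq L n) / a_seq L n)" if "\<eta> > 0" for \<eta>
    proof (rule summable_comparison_test_ev[OF _ summable_bertrand[OF that]])
      show "\<forall>\<^sub>F n in sequentially. norm (exp (- (1 + \<eta>) * d_seq L n) / a_seq L n) \<le> 1 / (real n * ln (real n) powr (1 + \<eta>))"
        using eventually_ge_at_top[of N]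
      proof eventually_elim
        case (elim n)
        have l: "L (real n) > 0" "ln (real n) > 0" "real n > 0" using L1[OF elim] ln0[OF elim] N[OF elim] by auto
        have "L (real n) powr 1 \<le> L (real n) powr (1 + \<eta>)" using L1[OF elim] that by (intro powr_mono) auto
        then have "L (real n) / L (real n) powr (1 + \<eta>) \<le> 1" using l by simp
        then have "L (real n) / L (real n) powr (1 + \<eta>) * (1 / (real n * ln (real n) powr (1 + \<eta>))) \<le> 1 * (1 / (real n * ln (real n) powr (1 + \<eta>)))"
          using l by (intro mult_right_mono) auto
        moreover have "exp (- (1 + \<eta>) * d_seq L n) / a_seq L n = L (real n) / L (real n) powr (1 + \<eta>) * (1 / (real n * ln (real n) powr (1 + \<eta>)))"
          unfolding expd[OF elim] a_seq_def by simp
        moreover have "0 \<le> exp (- (1 + \<eta>) * d_seq L n) / a_seq L n" using l by (simp add: a_seq_def)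
        ultimately show ?case by simp
      qed
    qed
    show "\<not> summable (\<lambda>n. exp (- d_seq L n) / a_seq L n)"
    proof
      assume s: "summable (\<lambda>n. exp (- d_seq L n) / a_seq L n)"
      have "summable (\<lambda>n. 1 / (real n * ln (real n)))"
      proof (rule summable_comparison_test_ev[OF _ s])
        show "\<forall>\<^sub>F n in sequentially. norm (1 / (real n * ln (real n))) \<le> exp (- d_seq L n) / a_seq L n"
          using eventually_ge_at_top[of N]
        proof eventually_elim
          case (elim n)
          have l: "L (real n) > 0" "ln (real n) > 0" "real n > 0" using L1[OF elim] ln0[OF elim] N[OF elim] by auto
          have "exp (- d_seq L n) / a_seq L n = 1 / (real n * ln (real n))"
            using expd[OF elim, of 1] l by (simp add: a_seq_def)
          then show ?case using l by simp
        qed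
      qed
      then show False using not_summable_bertrand by blast
    qed
  qed
  then show ?thesis ..
qed

section \<open>Dilations and grids\<close>

text \<open>Each block of \<open>k\<close> consecutive terms is at most \<open>k\<close> times its first one, so a partial sum \<open>S\<close> of \<open>p\<close>
  satisfies \<open>S \<le> k * c * S + k * (\<Sum>n. q n)\<close>, and \<open>k * c < 1\<close> allows solving for \<open>S\<close>.\<close>

lemma summable_of_dilation:
  fixes p q :: "nat \<Rightarrow> real"
  assumes "0 < k" "0 \<le> c" "real k * c < 1"
    and p_nonneg: "\<And>n. n\<^sub>0 \<le> n \<Longrightarrow> 0 \<le> p n" and p_anti: "\<And>m n. n\<^sub>0 \<le> m \<Longrightarrow> m \<le> n \<Longrightarrow> p n \<le> p m"
    and dil: "\<And>n. n\<^sub>0 \<le> n \<Longrightarrow> p (k * n) \<le> c * p n + q n"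
    and "summable q" and q_nonneg: "\<And>n. 0 \<le> q n"
  shows "summable p"
proof -
  define p' where "p' n = p (max n n\<^sub>0)" for n
  define q' where "q' n = (if n < n\<^sub>0 then p n\<^sub>0 else q n)" for n
  have p'0: "0 \<le> p' n" for n unfolding p'_def by (rule p_nonneg) simp
  have p'_anti: "p' n \<le> p' m" if "m \<le> n" for m n unfolding p'_def using that by (intro p_anti) auto
  have q'0: "0 \<le> q' n" for n unfolding q'_def using p_nonneg[of n\<^sub>0] q_nonneg by auto
  have "eventually (\<lambda>n. q' n = q n) sequentially"
    using eventually_ge_at_top[of n\<^sub>0] by eventually_elim (simp add: q'_def)
  then have q's: "summable q'" using \<open>summable q\<close> summable_cong by blast
  have dil': "p' (k * n) \<le> c * p' n + q' n" for n
  proof (cases "n < n\<^sub>0")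
    case True
    have "p' (k * n) \<le> p' 0" by (rule p'_anti) simp
    also have "\<dots> = q' n" using True by (simp add: p'_def q'_def)
    also have "\<dots> \<le> c * p' n + q' n" using \<open>0 \<le> c\<close> p'0 by simp
    finally show ?thesis .
  next
    case False
    then have "n \<le> k * n" "n\<^sub>0 \<le> n" using \<open>0 < k\<close> by auto
    then have "p' (k * n) = p (k * n)" "p' n = p n" "q' n = q n" by (auto simp: p'_def q'_def max_absorb1 le_trans)
    then show ?thesis using dil[of n] False by simp
  qed
  define S where "S m = (\<Sum>n<m. p' n)" for m
  have S_mono: "S m \<le> S n" if "m \<le> n" for m n
    unfolding S_def using that p'0 by (intro sum_mono2) auto
  have "S N \<le> real k * suminf q' / (1 - real k * c)" for N
  proof -
    have "S (N * k) = (\<Sum>m<N. \<Sum>n\<in>{m*k..<m*k+k}. p' n)" unfolding S_def by (rule sum.nat_group[symmetric])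
    also have "\<dots> \<le> (\<Sum>m<N. \<Sum>n\<in>{m*k..<m*k+k}. p' (k * m))"
      by (intro sum_mono p'_anti) (auto simp: mult.commute)
    also have "\<dots> = (\<Sum>m<N. real k * p' (k * m))" by simp
    also have "\<dots> \<le> (\<Sum>m<N. real k * (c * p' m + q' m))" by (intro sum_mono mult_left_mono dil') auto
    also have "\<dots> = real k * c * S N + real k * (\<Sum>m<N. q' m)"
      by (simp add: S_def sum_distrib_left sum.distrib algebra_simps)
    also have "\<dots> \<le> real k * c * S (N * k) + real k * suminf q'"
      using S_mono[of N "N * k"] \<open>0 < k\<close> \<open>0 \<le> c\<close> q's q'0
      by (intro add_mono mult_left_mono sum_le_suminf) auto
    finally have "S (N * k) * (1 - real k * c) \<le> real k * suminf q'" by (simp add: algebra_simps)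
    then have "S (N * k) \<le> real k * suminf q' / (1 - real k * c)"
      using assms(3) by (simp add: pos_le_divide_eq)
    then show ?thesis using S_mono[of N "N * k"] \<open>0 < k\<close> by simp
  qed
  then have "summable p'" unfolding S_def using p'0 by (intro summableI_nonneg_bounded) auto
  moreover have "eventually (\<lambda>n. p' n = p n) sequentially"
    using eventually_ge_at_top[of n\<^sub>0] by eventually_elim (simp add: p'_def max_def)
  ultimately show ?thesis using summable_cong by blast
qed

context window_seq
begin

definition s :: "nat \<Rightarrow> real" where "s n = sqrt (a n * d n)"

lemma s_sq: "n\<^sub>0 \<le> n \<Longrightarrow> (s n)\<^sup>2 = a n * d n"
  using a_ge[of n] d_ge[of n] by (simp add: s_def)

lemma s_pos: "n\<^sub>0 \<le> n \<Longrightarrow> 0 < s n"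
  using a_ge[of n] d_ge[of n] by (simp add: s_def)

lemma s_growth:
  assumes "n\<^sub>0 \<le> m" "m \<le> n"
  shows "s m * (real n / real m) powr (3 / 8) \<le> s n"
proof -
  have "a m * (real n / real m) powr (3 / 4) * d m \<le> a n * d n"
    using a_growth[OF assms] d_mono[OF assms] a_ge[of n] d_ge[of m] assms by (intro mult_mono) auto
  then have "sqrt (a m * d m * (real n / real m) powr (3 / 4)) \<le> s n"
    unfolding s_def by (intro real_sqrt_le_mono) (simp add: ac_simps)
  moreover have "sqrt ((real n / real m) powr (3 / 4)) = (real n / real m) powr (3 / 8)"
    by (simp add: powr_half_sqrt[symmetric] powr_powr)
  ultimately show ?thesis by (simp add: s_def real_sqrt_mult)
qed

lemma s_mono: "n\<^sub>0 \<le> m \<Longrightarrow> m \<le> n \<Longrightarrow> s m \<le> s n"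
  using a_mono[of m n] d_mono[of m n] a_ge[of m] a_ge[of n] d_ge[of m]
  unfolding s_def by (intro real_sqrt_le_mono mult_mono) auto

lemma s_dilate:
  assumes "n\<^sub>0 \<le> n" "1 \<le> k" shows "s n * real k powr (3 / 8) \<le> s (k * n)"
  using s_growth[of n "k * n"] assms n0_pos by simp

lemma a_top: "filterlim a at_top sequentially"
proof (rule filterlim_at_top_mono[OF a_over_d])
  show "\<forall>\<^sub>F n in sequentially. a n / d n \<le> a n"
    using eventually_ge_at_top[of n\<^sub>0]
  proof eventually_elim
    case (elim n)
    then have "a n / d n \<le> a n / 1" using a_ge[of n] d_ge[of n] by (intro divide_left_mono) auto
    then show ?case by simp
  qed
qed

lemma eventually_s_le:
  assumes "c > 0" shows "eventually (\<lambda>n. s n \<le> c * a n) sequentially"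
proof -
  have "eventually (\<lambda>n. a n / d n \<ge> 1 / c\<^sup>2) sequentially"
    using a_over_d unfolding filterlim_at_top by blast
  then show ?thesis using eventually_ge_at_top[of n\<^sub>0]
  proof eventually_elim
    case (elim n)
    have p: "a n > 0" "d n > 0" using a_ge[of n] d_ge[of n] elim by auto
    have "d n \<le> c\<^sup>2 * a n" using elim p assms by (simp add: field_simps)
    then have "a n * d n \<le> a n * (c\<^sup>2 * a n)" using p by (intro mult_left_mono) auto
    then have "sqrt (a n * d n) \<le> sqrt ((c * a n)\<^sup>2)"
      by (intro real_sqrt_le_mono) (simp add: power2_eq_square ac_simps)
    then show ?case using p assms by (simp add: s_def)
  qed
qed

definition len :: "nat \<Rightarrow> nat" where "len n = nat \<lfloor>a n\<rfloor>"

lemma len_le: "n\<^sub>0 \<le> n \<Longrightarrow> real (len n) \<le> a n"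
  and len_pos: "n\<^sub>0 \<le> n \<Longrightarrow> 1 \<le> len n"
  and len_gt: "n\<^sub>0 \<le> n \<Longrightarrow> a n < real (len n) + 1"
  using a_ge[of n] unfolding len_def by linarith+

lemma len_mono: "n\<^sub>0 \<le> m \<Longrightarrow> m \<le> n \<Longrightarrow> len m \<le> len n"
  using a_mono[of m n] unfolding len_def by (intro nat_mono floor_mono)

primrec grid :: "real \<Rightarrow> nat \<Rightarrow> nat \<Rightarrow> nat" where
  "grid \<delta> N 0 = N"
| "grid \<delta> N (Suc k) = grid \<delta> N k + nat \<lfloor>\<delta> * a (grid \<delta> N k)\<rfloor>"

end

text \<open>The grid starts at \<open>N\<close>, and the last assumption keeps its steps, which are rounded down, positive and
  at least half of \<open>\<delta> * a\<close>.\<close>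

locale window_grid = window_seq +
  fixes \<delta> :: real and N :: nat
  assumes N_ge: "n\<^sub>0 \<le> N" and \<delta>: "0 < \<delta>" "\<delta> \<le> 1" and \<delta>_a: "1 \<le> \<delta> * a N"
begin

abbreviation "g \<equiv> grid \<delta> N"

lemma grid_ge: "N \<le> g k"
  by (induction k) auto

lemma grid_ge_n0: "n\<^sub>0 \<le> g k"
  using grid_ge N_ge order_trans by blast

lemma step_real_ge: assumes "N \<le> n" shows "1 \<le> \<delta> * a n"
proof -
  have "\<delta> * a N \<le> \<delta> * a n" using a_mono[OF N_ge assms] \<delta> by (intro mult_left_mono) auto
  then show ?thesis using \<delta>_a by linarith
qed

lemma step_le: "real (g (Suc k)) - real (g k) \<le> \<delta> * a (g k)"
  and step_ge: "\<delta> * a (g k) / 2 \<le> real (g (Suc k)) - real (g k)"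
  and step_pos: "g k < g (Suc k)"
proof -
  define f where "f = \<lfloor>\<delta> * a (g k)\<rfloor>"
  have f: "1 \<le> f" "of_int f \<le> \<delta> * a (g k)" "\<delta> * a (g k) < of_int f + 1"
    using step_real_ge[OF grid_ge[of k]] unfolding f_def by linarith+
  have "real (g (Suc k)) - real (g k) = of_int f" using f(1) by (simp add: f_def[symmetric])
  then show "real (g (Suc k)) - real (g k) \<le> \<delta> * a (g k)"
    "\<delta> * a (g k) / 2 \<le> real (g (Suc k)) - real (g k)"
    "g k < g (Suc k)"
    using f by linarith+
qed

lemma strict_mono_grid: "strict_mono g"
  using step_pos by (intro strict_monoI_Suc) auto

lemma step_le_double: "g (Suc k) \<le> 2 * g k"
proof -
  have "\<delta> * a (g k) \<le> 1 * a (g k)" using \<delta> a_ge[OF grid_ge_n0[of k]] by (intro mult_right_mono) auto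
  then have "real (g (Suc k)) \<le> real (2 * g k)" using step_le[of k] a_le[OF grid_ge_n0[of k]] by simp
  then show ?thesis by (simp only: of_nat_le_iff)
qed

lemma a_grid_Suc: "a (g (Suc k)) \<le> 2 * a (g k)"
proof -
  have le: "g k \<le> g (Suc k)" using step_pos[of k] by simp
  have pos: "0 < real (g k)" using grid_ge_n0[of k] n0_pos by linarith
  have "a (g (Suc k)) * real (g k) \<le> a (g k) * real (g (Suc k))" by (rule a_ratio[OF grid_ge_n0 le])
  also have "\<dots> \<le> a (g k) * real (2 * g k)"
  proof (intro mult_left_mono)
    show "real (g (Suc k)) \<le> real (2 * g k)" unfolding of_nat_le_iff by (rule step_le_double)
    show "0 \<le> a (g k)" using a_ge[OF grid_ge_n0[of k]] by simp
  qed
  finally have "a (g (Suc k)) * real (g k) \<le> (2 * a (g k)) * real (g k)" by simp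
  then show ?thesis using pos by (rule mult_right_le_imp_le)
qed

lemma grid_block:
  assumes "N \<le> n" shows "\<exists>k. g k \<le> n \<and> n < g (Suc k)"
proof -
  have "\<exists>k. n < g k" using strict_mono_imp_increasing[OF strict_mono_grid, of "Suc n"] 
    by (intro exI[of _ "Suc n"]) (simp only: less_eq_Suc_le)
  define k where "k = (LEAST k. n < g k)"
  have "n < g k" unfolding k_def using \<open>\<exists>k. n < g k\<close> by (rule LeastI_ex)
  then obtain k' where k': "k = Suc k'" using assms by (cases k) auto
  have "\<not> n < g k'" using not_less_Least[of k' "\<lambda>k. n < g k"] k' unfolding k_def by simp
  then show ?thesis using \<open>n < g k\<close> k' by (auto simp: not_less intro!: exI[of _ k'])
qed

lemma sum_grid_blocks: "(\<Sum>k<m. \<Sum>n\<in>{g k..<g (Suc k)}. w n) = (\<Sum>n\<in>{N..<g m}. w n)"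
  for w :: "nat \<Rightarrow> real"
proof (induction m)
  case (Suc m)
  have "g m \<le> g (Suc m)" using step_pos[of m] by simp
  then show ?case using Suc grid_ge[of m] by (simp add: sum.atLeastLessThan_concat del: grid.simps(2))
qed simp

text \<open>The length of a grid block is comparable to \<open>a\<close>, also at its right end point, where the antitone
  \<open>w\<close> is smallest on the block.\<close>

lemma summable_grid:
  assumes w: "\<And>n. n\<^sub>0 \<le> n \<Longrightarrow> 0 \<le> w n" and anti: "\<And>m n. n\<^sub>0 \<le> m \<Longrightarrow> m \<le> n \<Longrightarrow> w n \<le> w m" and "summable w"
  shows "summable (\<lambda>k. a (g k) * w (g k))"
proof -
  have "summable (\<lambda>n. w (n + N))" using \<open>summable w\<close> by (simp add: summable_iff_shift)
  have w0: "0 \<le> w n" if "N \<le> n" for n using w that N_ge by auto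
  have le: "a (g (Suc k)) * w (g (Suc k)) \<le> 4 / \<delta> * (\<Sum>n\<in>{g k..<g (Suc k)}. w n)" for k
  proof -
    have "a (g (Suc k)) \<le> 2 * a (g k)" by (rule a_grid_Suc)
    also have "\<dots> \<le> 4 / \<delta> * (real (g (Suc k)) - real (g k))" using step_ge[of k] \<delta> by (simp add: field_simps del: grid.simps)
    also have "\<dots> = 4 / \<delta> * real (card {g k..<g (Suc k)})" using step_pos[of k] by (simp add: of_nat_diff del: grid.simps)
    finally have "a (g (Suc k)) * w (g (Suc k)) \<le> 4 / \<delta> * real (card {g k..<g (Suc k)}) * w (g (Suc k))"
      using w[OF grid_ge_n0] by (rule mult_right_mono)
    also have "\<dots> = 4 / \<delta> * (\<Sum>n\<in>{g k..<g (Suc k)}. w (g (Suc k)))" by simp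
    also have "\<dots> \<le> 4 / \<delta> * (\<Sum>n\<in>{g k..<g (Suc k)}. w n)"
      using \<delta> grid_ge_n0[of k] by (intro mult_left_mono sum_mono anti) (auto simp del: grid.simps)
    finally show ?thesis .
  qed
  have "summable (\<lambda>k. a (g (Suc k)) * w (g (Suc k)))"
  proof (rule summableI_nonneg_bounded)
    show "0 \<le> a (g (Suc k)) * w (g (Suc k))" for k
      using a_ge[OF grid_ge_n0[of "Suc k"]] w[OF grid_ge_n0[of "Suc k"]] by (intro mult_nonneg_nonneg) auto
    fix m
    have "(\<Sum>k<m. a (g (Suc k)) * w (g (Suc k))) \<le> (\<Sum>k<m. 4 / \<delta> * (\<Sum>n\<in>{g k..<g (Suc k)}. w n))"
      by (intro sum_mono le)
    also have "\<dots> = 4 / \<delta> * (\<Sum>n\<in>{N..<g m}. w n)" by (simp only: sum_distrib_left[symmetric] sum_grid_blocks)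
    also have "(\<Sum>n\<in>{N..<g m}. w n) = (\<Sum>n<g m - N. w (n + N))"
      using sum.shift_bounds_nat_ivl[of w 0 N "g m - N"] grid_ge[of m] by (simp add: lessThan_atLeast0)
    also have "\<dots> \<le> (\<Sum>n. w (n + N))"
      using \<open>summable (\<lambda>n. w (n + N))\<close> w0 by (intro sum_le_suminf) auto
    finally show "(\<Sum>k<m. a (g (Suc k)) * w (g (Suc k))) \<le> 4 / \<delta> * (\<Sum>n. w (n + N))"
      using \<delta> by (simp add: mult_left_mono divide_right_mono)
  qed
  then show ?thesis by (subst (asm) summable_Suc_iff)
qed

lemma not_summable_grid:
  assumes w: "\<And>n. n\<^sub>0 \<le> n \<Longrightarrow> 0 \<le> w n" and anti: "\<And>m n. n\<^sub>0 \<le> m \<Longrightarrow> m \<le> n \<Longrightarrow> w n \<le> w m" and "\<not> summable w"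
  shows "\<not> summable (\<lambda>k. a (g k) * w (g k))"
proof
  assume s: "summable (\<lambda>k. a (g k) * w (g k))"
  have w0: "0 \<le> w n" if "N \<le> n" for n using w that N_ge by auto
  have le: "(\<Sum>n\<in>{g k..<g (Suc k)}. w n) \<le> a (g k) * w (g k)" for k
  proof -
    have "(\<Sum>n\<in>{g k..<g (Suc k)}. w n) \<le> (\<Sum>n\<in>{g k..<g (Suc k)}. w (g k))"
      using grid_ge_n0[of k] by (intro sum_mono anti) auto
    also have "\<dots> = (real (g (Suc k)) - real (g k)) * w (g k)" using step_pos[of k] by (simp add: of_nat_diff del: grid.simps)
    also have "\<dots> \<le> a (g k) * w (g k)"
    proof (intro mult_right_mono w[OF grid_ge_n0])
      have "\<delta> * a (g k) \<le> 1 * a (g k)" using \<delta> a_ge[OF grid_ge_n0[of k]] by (intro mult_right_mono) auto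
      then show "real (g (Suc k)) - real (g k) \<le> a (g k)" using step_le[of k] by linarith
    qed
    finally show ?thesis .
  qed
  have nn: "0 \<le> a (g k) * w (g k)" for k
    using a_ge[OF grid_ge_n0[of k]] w[OF grid_ge_n0[of k]] by (intro mult_nonneg_nonneg) auto
  have "summable (\<lambda>n. w (n + N))"
  proof (rule summableI_nonneg_bounded)
    show "0 \<le> w (n + N)" for n by (rule w0) simp
    fix m
    have "(\<Sum>n<m. w (n + N)) = (\<Sum>n\<in>{N..<m + N}. w n)"
      using sum.shift_bounds_nat_ivl[of w 0 N m] by (simp add: lessThan_atLeast0)
    also have "\<dots> \<le> (\<Sum>n\<in>{N..<g (m + N)}. w n)"
      using strict_mono_imp_increasing[OF strict_mono_grid, of "m + N"] w0 by (intro sum_mono2) auto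
    also have "\<dots> = (\<Sum>k<m + N. \<Sum>n\<in>{g k..<g (Suc k)}. w n)" by (simp only: sum_grid_blocks)
    also have "\<dots> \<le> (\<Sum>k<m + N. a (g k) * w (g k))" by (intro sum_mono le)
    also have "\<dots> \<le> (\<Sum>k. a (g k) * w (g k))" using s nn by (intro sum_le_suminf) auto
    finally show "(\<Sum>n<m. w (n + N)) \<le> (\<Sum>k. a (g k) * w (g k))" .
  qed
  then show False using \<open>\<not> summable w\<close> by (simp add: summable_iff_shift)
qed

lemma exp_d_antimono:
  assumes "0 \<le> c" "n\<^sub>0 \<le> m" "m \<le> n" shows "exp (- c * d n) / a n \<le> exp (- c * d m) / a m"
  using d_mono[of m n] a_mono[of m n] a_ge[of m] assms by (intro frac_le) (auto intro: mult_left_mono)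

lemma summable_exp_grid:
  assumes "\<eta> > 0" shows "summable (\<lambda>k. exp (- (1 + \<eta>) * d (g k)))"
proof -
  have "summable (\<lambda>k. a (g k) * (exp (- (1 + \<eta>) * d (g k)) / a (g k)))"
  proof (rule summable_grid[OF _ _ summable_window[OF assms]])
    show "0 \<le> exp (- (1 + \<eta>) * d n) / a n" if "n\<^sub>0 \<le> n" for n using a_ge[OF that] by simp
  qed (intro exp_d_antimono, use assms in auto)
  moreover have "a (g k) \<noteq> 0" for k using a_ge[OF grid_ge_n0[of k]] by auto
  ultimately show ?thesis by simp
qed

lemma not_summable_exp_grid: "\<not> summable (\<lambda>k. exp (- d (g k)))"
proof -
  have "\<not> summable (\<lambda>k. a (g k) * (exp (- d (g k)) / a (g k)))"
  proof (rule not_summable_grid[OF _ _ not_summable_window])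
    show "0 \<le> exp (- d n) / a n" if "n\<^sub>0 \<le> n" for n using a_ge[OF that] by simp
  qed (use exp_d_antimono[of 1] in auto)
  moreover have "a (g k) \<noteq> 0" for k using a_ge[OF grid_ge_n0[of k]] by auto
  ultimately show ?thesis by simp
qed

end

section \<open>The limit superior of window sums\<close>

locale iid_windows = iid_seq M \<xi> + window_seq a d n\<^sub>0
  for M :: "'a measure" and \<xi> :: "nat \<Rightarrow> 'a \<Rightarrow> real" and a d :: "nat \<Rightarrow> real" and n\<^sub>0 :: nat
begin

text \<open>Indices are shifted by one against \<open>window_sum\<close>, so that a window is a half-open interval.\<close>

definition T :: "nat \<Rightarrow> 'a \<Rightarrow> real" where
  "T n \<omega> = (\<Sum>j\<in>{n..<n + len n}. \<xi> j \<omega>)"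

lemma T_measurable [measurable]: "T n \<in> borel_measurable M"
  unfolding T_def by measurable

text \<open>From \<open>n\<close> to \<open>4 n\<close> the norming sequence grows by at least the factor \<open>4 powr (3 / 8)\<close>, whose fourth
  power is \<open>8\<close>; the part of \<open>\<bar>\<xi> 0\<bar>\<close> above \<open>s n\<close> is charged to the tail probability.\<close>

lemma clipped_dilate:
  assumes "n\<^sub>0 \<le> n"
  shows "clipped (s (4 * n)) \<le> 1 / 8 * clipped (s n) + prob {\<omega>\<in>space M. s n < \<bar>\<xi> 0 \<omega>\<bar>}"
proof -
  have n4: "n\<^sub>0 \<le> 4 * n" using assms by simp
  note pos = s_pos[OF assms] s_pos[OF n4]
  define r :: real where "r = 4 powr (3 / 8)"
  have "r > 0" by (simp add: r_def)
  have "r ^ 4 = 4 powr (3 / 2)" unfolding r_def by (simp add: powr_realpow[symmetric] powr_powr)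
  also have "\<dots> = 4 powr 1 * 4 powr (1 / 2)" by (subst powr_add[symmetric]) simp
  also have "\<dots> = 8" by (simp add: powr_half_sqrt)
  finally have r4: "r ^ 4 = 8" .
  have sr: "s n * r \<le> s (4 * n)" using s_dilate[OF assms, of 4] by (simp add: r_def)
  have pw: "(min (x / s (4 * n)) 1) ^ 4 \<le> 1 / 8 * (min (x / s n) 1) ^ 4 + (if s n < x then 1 else 0)" if "0 \<le> x" for x
  proof (cases "s n < x")
    case True
    have "(min (x / s (4 * n)) 1) ^ 4 \<le> 1" using that pos by (intro power_le_one) auto
    moreover have "0 \<le> (min (x / s n) 1) ^ 4" by simp
    ultimately show ?thesis unfolding if_P[OF True] by linarith
  next
    case False
    have "min (x / s (4 * n)) 1 \<le> x / s (4 * n)" by simp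
    also have "\<dots> \<le> x / (s n * r)" using that pos sr \<open>r > 0\<close> by (intro divide_left_mono) auto
    finally have "(min (x / s (4 * n)) 1) ^ 4 \<le> (x / (s n * r)) ^ 4" using that pos by (intro power_mono) auto
    also have "\<dots> = 1 / 8 * (x / s n) ^ 4" by (simp add: power_divide power_mult_distrib r4)
    also have "x / s n = min (x / s n) 1" using False pos by (simp add: min_def)
    finally show ?thesis using False by simp
  qed
  have int: "integrable M (indicator {\<omega>\<in>space M. s n < \<bar>\<xi> 0 \<omega>\<bar>} :: 'a \<Rightarrow> real)"
    by (intro integrable_real_indicator) (auto simp: emeasure_eq_measure)
  have "clipped (s (4 * n)) \<le> expectation (\<lambda>\<omega>. 1 / 8 * (min (\<bar>\<xi> 0 \<omega>\<bar> / s n) 1) ^ 4 + indicator {\<omega>\<in>space M. s n < \<bar>\<xi> 0 \<omega>\<bar>} \<omega>)"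
    unfolding clipped_def
  proof (intro integral_mono integrable_clipped pos)
    fix \<omega> assume \<omega>: "\<omega> \<in> space M"
    have ind: "indicator {\<omega>\<in>space M. s n < \<bar>\<xi> 0 \<omega>\<bar>} \<omega> = (if s n < \<bar>\<xi> 0 \<omega>\<bar> then 1 else 0 :: real)"
      using \<omega> by (simp add: indicator_def)
    show "(min (\<bar>\<xi> 0 \<omega>\<bar> / s (4 * n)) 1) ^ 4 \<le>
        1 / 8 * (min (\<bar>\<xi> 0 \<omega>\<bar> / s n) 1) ^ 4 + indicator {\<omega>\<in>space M. s n < \<bar>\<xi> 0 \<omega>\<bar>} \<omega>"
      unfolding ind by (rule pw) simp
  qed (intro Bochner_Integration.integrable_add integrable_mult_right integrable_clipped pos int)
  also have "\<dots> = 1 / 8 * clipped (s n) + prob {\<omega>\<in>space M. s n < \<bar>\<xi> 0 \<omega>\<bar>}"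
    using integrable_clipped[OF pos(1)] int
    by (subst Bochner_Integration.integral_add) (auto simp: clipped_def)
  finally show ?thesis .
qed

lemma clipped_scale:
  assumes "0 < K" "0 < \<epsilon>" "\<epsilon> \<le> 1" shows "clipped (\<epsilon> * K) \<le> (1 / \<epsilon>) ^ 4 * clipped K"
proof -
  have "clipped (\<epsilon> * K) \<le> expectation (\<lambda>\<omega>. (1 / \<epsilon>) ^ 4 * (min (\<bar>\<xi> 0 \<omega>\<bar> / K) 1) ^ 4)"
    unfolding clipped_def
  proof (intro integral_mono integrable_mult_right integrable_clipped)
    fix \<omega>
    have "1 \<le> 1 / \<epsilon>" using assms by simp
    then have "min (\<bar>\<xi> 0 \<omega>\<bar> / (\<epsilon> * K)) 1 \<le> 1 / \<epsilon> * min (\<bar>\<xi> 0 \<omega>\<bar> / K) 1"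
      by (cases "\<bar>\<xi> 0 \<omega>\<bar> / K \<le> 1") (auto simp: min_def)
    then have "(min (\<bar>\<xi> 0 \<omega>\<bar> / (\<epsilon> * K)) 1) ^ 4 \<le> (1 / \<epsilon> * min (\<bar>\<xi> 0 \<omega>\<bar> / K) 1) ^ 4"
      using assms by (intro power_mono) auto
    then show "(min (\<bar>\<xi> 0 \<omega>\<bar> / (\<epsilon> * K)) 1) ^ 4 \<le> (1 / \<epsilon>) ^ 4 * (min (\<bar>\<xi> 0 \<omega>\<bar> / K) 1) ^ 4"
      by (simp only: power_mult_distrib)
  qed (use assms in auto)
  then show ?thesis by (simp add: clipped_def)
qed

text \<open>The contraction factor \<open>1/8\<close> of \<open>clipped_dilate\<close> is smaller than \<open>1/4\<close>, so the dilation criterion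
  with \<open>k = 4\<close> applies.\<close>

lemma summable_clipped:
  assumes tails: "summable (\<lambda>n. prob {\<omega>\<in>space M. s n < \<bar>\<xi> 0 \<omega>\<bar>})" and "0 < \<epsilon>" "\<epsilon> \<le> 1"
  shows "summable (\<lambda>n. clipped (\<epsilon> * s n))"
proof -
  have "summable (\<lambda>n. clipped (s n))"
  proof (rule summable_of_dilation[where k=4 and c="1/8" and n\<^sub>0=n\<^sub>0, OF _ _ _ _ _ clipped_dilate tails])
    show "clipped (s n) \<le> clipped (s m)" if "n\<^sub>0 \<le> m" "m \<le> n" for m n
      using that s_pos s_mono by (intro clipped_antimono) auto
  qed (auto intro!: clipped_nonneg s_pos)
  then have *: "summable (\<lambda>n. (1 / \<epsilon>) ^ 4 * clipped (s n))" by (rule summable_mult)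
  show ?thesis
  proof (rule summable_comparison_test_ev[OF _ *])
    show "\<forall>\<^sub>F n in sequentially. norm (clipped (\<epsilon> * s n)) \<le> (1 / \<epsilon>) ^ 4 * clipped (s n)"
      using eventually_ge_at_top[of n\<^sub>0]
    proof eventually_elim
      case (elim n)
      then have "0 < s n" by (rule s_pos)
      then show ?case using clipped_scale[of "s n" \<epsilon>] clipped_nonneg[of "\<epsilon> * s n"] assms by simp
    qed
  qed
qed

text \<open>The grid with \<open>\<delta> = 1\<close> consists of adjacent windows, whose sums are independent, and the sum of
  \<open>exp (- d)\<close> along it diverges.\<close>

lemma windows_infinitely_often:
  assumes [measurable]: "\<And>n. Measurable.pred borel (P n)" and "0 < c"
    and lb: "eventually (\<lambda>n. c * exp (- d n) \<le> prob {\<omega>\<in>space M. P n (T n \<omega>)}) sequentially"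
  shows "AE \<omega> in M. \<exists>\<^sub>F n in sequentially. P n (T n \<omega>)"
proof -
  interpret G: window_grid a d n\<^sub>0 1 n\<^sub>0
    using a_ge[of n\<^sub>0] by unfold_locales auto
  have Suc: "G.g (Suc k) = G.g k + len (G.g k)" for k by (simp add: len_def)
  have sm: "strict_mono G.g" by (rule G.strict_mono_grid)
  define A where "A k = {\<omega>\<in>space M. P (G.g k) (T (G.g k) \<omega>)}" for k
  have "indep_events A UNIV"
  proof -
    let ?B = "\<lambda>k. {G.g k..<G.g (Suc k)}"
    have "indep_vars (\<lambda>k. PiM (?B k) (\<lambda>_. borel :: real measure)) (\<lambda>k \<omega>. restrict (\<lambda>i. \<xi> i \<omega>) (?B k)) UNIV"
    proof (rule indep_vars_restrict[OF indep])
      show "disjoint_family_on ?B UNIV"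
      proof (rule disjoint_familyI_less)
        fix k l :: nat assume "k < l"
        then have "G.g (Suc k) \<le> G.g l" using sm by (simp only: strict_mono_less_eq Suc_le_eq)
        then show "?B k \<inter> ?B l = {}" by (auto simp del: grid.simps)
      qed
    qed auto
    then have "indep_vars (\<lambda>_. borel) (\<lambda>k \<omega>. (\<lambda>x. \<Sum>j\<in>?B k. x j) (restrict (\<lambda>i. \<xi> i \<omega>) (?B k))) UNIV"
      by (rule indep_vars_compose2) auto
    then have "indep_vars (\<lambda>_. borel) (\<lambda>k \<omega>. T (G.g k) \<omega>) UNIV"
      unfolding T_def Suc by simp
    then show ?thesis unfolding A_def by (rule indep_eventsI_indep_vars) auto
  qed
  moreover have "\<not> summable (\<lambda>k. prob (A k))"
  proof
    assume "summable (\<lambda>k. prob (A k))"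
    then have *: "summable (\<lambda>k. 1 / c * prob (A k))" by (rule summable_mult)
    have "summable (\<lambda>k. exp (- d (G.g k)))"
    proof (rule summable_comparison_test_ev[OF _ *])
      have "eventually (\<lambda>k. c * exp (- d (G.g k)) \<le> prob (A k)) sequentially"
        using filterlim_subseq[OF sm] lb unfolding A_def by (rule eventually_compose_filterlim[rotated])
      then show "\<forall>\<^sub>F k in sequentially. norm (exp (- d (G.g k))) \<le> 1 / c * prob (A k)"
        by eventually_elim (use \<open>0 < c\<close> in \<open>simp add: field_simps\<close>)
    qed
    then show False using G.not_summable_exp_grid by blast
  qed
  ultimately have "AE \<omega> in M. \<exists>\<^sub>F k in sequentially. \<omega> \<in> A k" by (rule borel_cantelli_independent)
  then show ?thesis
  proof eventually_elim
    case (elim \<omega>)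
    show ?case unfolding frequently_sequentially
    proof
      fix n0
      from elim obtain k where "k \<ge> n0" "\<omega> \<in> A k" unfolding frequently_sequentially by blast
      moreover have "k \<le> G.g k" by (rule strict_mono_imp_increasing[OF sm])
      ultimately show "\<exists>n\<ge>n0. P n (T n \<omega>)" by (intro exI[of _ "G.g k"]) (auto simp: A_def)
    qed
  qed
qed

lemma eventually_moderate:
  assumes "0 < D"
  shows "eventually (\<lambda>n. d n \<ge> D \<and> real (len n) \<ge> D * d n) sequentially"
proof -
  have 1: "eventually (\<lambda>n. d n \<ge> D) sequentially" using d_top unfolding filterlim_at_top by blast
  have 2: "eventually (\<lambda>n. a n / d n \<ge> 2 * D) sequentially" using a_over_d unfolding filterlim_at_top by blast
  show ?thesis using 1 2 eventually_ge_at_top[of n\<^sub>0]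
  proof eventually_elim
    case (elim n)
    have "2 * D * d n \<le> a n" using elim d_ge[of n] by (simp add: field_simps)
    moreover have "a n / 2 \<le> real (len n)" using len_pos[of n] len_gt[of n] elim by linarith
    ultimately show ?case using elim by auto
  qed
qed

lemma eventually_len_ge:
  assumes "q < 1" shows "eventually (\<lambda>n. q * a n \<le> real (len n)) sequentially"
proof -
  have "eventually (\<lambda>n. a n \<ge> 1 / (1 - q)) sequentially" using a_top unfolding filterlim_at_top by blast
  then show ?thesis using eventually_ge_at_top[of n\<^sub>0]
  proof eventually_elim
    case (elim n)
    have "1 \<le> (1 - q) * a n" using elim assms by (simp add: field_simps)
    then show ?case using len_gt[of n] elim by (simp add: algebra_simps)
  qed
qed

lemma prob_window_pred:
  assumes "Measurable.pred borel P"
  shows "prob {\<omega>\<in>space M. P (T n \<omega>)} = prob {\<omega>\<in>space M. P (\<Sum>j<len n. \<xi> j \<omega>)}"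
  unfolding T_def using prob_sum_pred[OF assms, of "{n..<n + len n}"] by simp

end

locale centered_windows = iid_centered M \<xi> + window_seq a d n\<^sub>0
  for M :: "'a measure" and \<xi> :: "nat \<Rightarrow> 'a \<Rightarrow> real" and a d :: "nat \<Rightarrow> real" and n\<^sub>0 :: nat
begin

sublocale iid_windows ..

lemma window_lower_bound:
  assumes "0 < z" "z < sqrt second_moment"
  shows "AE \<omega> in M. \<exists>\<^sub>F n in sequentially. z * sqrt 2 * s n \<le> T n \<omega>"
proof -
  define z' where "z' = (z + sqrt second_moment) / 2"
  have z': "z < z'" "z' < sqrt second_moment" "0 < z'" using assms by (auto simp: z'_def)
  have "expectation (\<lambda>\<omega>. (\<xi> 0 \<omega>)\<^sup>2) = (sqrt second_moment)\<^sup>2"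
    using second_moment_nonneg by (simp add: second_moment_def)
  from tail_moderate_deviation_finite_variance[OF square_integrable centered this z'(3) z'(2)]
  obtain D where D: "D > 0" "\<And>N d. d \<ge> D \<Longrightarrow> real N \<ge> D * d \<Longrightarrow> exp (- d) \<le> tail N (z' * sqrt 2 * sqrt (real N * d))"
    by blast
  have q: "(z / z')\<^sup>2 < 1" using z' assms by (simp add: power_less_one_iff abs_square_less_1)
  show ?thesis
  proof (rule windows_infinitely_often[where c=1])
    show "\<forall>\<^sub>F n in sequentially. 1 * exp (- d n) \<le> prob {\<omega>\<in>space M. z * sqrt 2 * s n \<le> T n \<omega>}"
      using eventually_moderate[OF D(1)] eventually_len_ge[OF q] eventually_ge_at_top[of n\<^sub>0]
    proof eventually_elim
      case (elim n)
      have "exp (- d n) \<le> tail (len n) (z' * sqrt 2 * sqrt (real (len n) * d n))" using D(2) elim by blast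
      also have "\<dots> \<le> tail (len n) (z * sqrt 2 * s n)"
      proof (rule tail_antimono)
        have "z\<^sup>2 * (a n * d n) = z'\<^sup>2 * ((z / z')\<^sup>2 * a n * d n)" using z' by (simp add: power_divide)
        also have "\<dots> \<le> z'\<^sup>2 * (real (len n) * d n)"
          using elim d_ge[of n] by (intro mult_left_mono mult_right_mono) auto
        finally have "sqrt (z\<^sup>2 * (a n * d n)) \<le> sqrt (z'\<^sup>2 * (real (len n) * d n))" by (rule real_sqrt_le_mono)
        then have "z * s n \<le> z' * sqrt (real (len n) * d n)" using z' assms by (simp add: real_sqrt_mult s_def)
        then show "z * sqrt 2 * s n \<le> z' * sqrt 2 * sqrt (real (len n) * d n)"
          by (simp add: mult.commute mult.left_commute)
      qed
      also have "\<dots> = prob {\<omega>\<in>space M. z * sqrt 2 * s n \<le> T n \<omega>}"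
        unfolding tail_def by (subst prob_window_pred) auto
      finally show ?case by simp
    qed
  qed auto
qed

lemma iid_centered_uminus: "iid_centered M (\<lambda>j \<omega>. - \<xi> j \<omega>)"
proof -
  interpret n: iid_seq M "\<lambda>j \<omega>. - \<xi> j \<omega>" by (rule iid_map) simp
  show ?thesis by unfold_locales (use square_integrable centered in auto)
qed

text \<open>The three events that can make a window sum starting in a grid block large: the window at the left
  end point is large, the part dropped on the left is very negative, or the part added on the
  right is large. The bound \<open>12 * V * \<delta> \<le> \<kappa>\<^sup>2\<close> makes the exponent in the last two at least \<open>2 * d n\<close>; the
  value \<open>3 * \<delta> * a n\<close> bounds the number of terms dropped or added.\<close>

lemma block_event_bound:
  assumes V: "second_moment < V" "V < y\<^sup>2" and "0 < y" and \<kappa>: "0 < \<kappa>" "\<kappa> \<le> y * sqrt 2"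
    and \<delta>: "0 < \<delta>" "\<delta> \<le> 1" "12 * V * \<delta> \<le> \<kappa>\<^sup>2"
  defines "N \<equiv> \<lambda>n. nat \<lfloor>3 * \<delta> * a n\<rfloor>"
  shows "\<exists>\<eta>>0. \<exists>\<epsilon>>0. \<epsilon> \<le> 1 \<and> eventually (\<lambda>n.
     prob {\<omega>\<in>space M. y * sqrt 2 * s n \<le> T n \<omega>} \<le> 3 * exp (- (1 + \<eta>) * d n) + 4 * (a n * clipped (\<epsilon> * s n)) \<and>
     prob {\<omega>\<in>space M. \<exists>i\<le>N n. 2 * \<kappa> * s n \<le> (\<Sum>j\<in>{n..<n+i}. - \<xi> j \<omega>)}
       \<le> 6 * exp (- (1 + \<eta>) * d n) + 24 * (a n * clipped (\<epsilon> * s n)) \<and>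
     prob {\<omega>\<in>space M. \<exists>i\<le>N n. 2 * \<kappa> * s n \<le> (\<Sum>j\<in>{n+len n..<n+len n+i}. \<xi> j \<omega>)}
       \<le> 6 * exp (- (1 + \<eta>) * d n) + 24 * (a n * clipped (\<epsilon> * s n))) sequentially"
proof -
  interpret neg: iid_centered M "\<lambda>j \<omega>. - \<xi> j \<omega>" by (rule iid_centered_uminus)
  have neg_eq: "neg.second_moment = second_moment" "neg.clipped K = clipped K" for K
    by (simp_all add: neg.second_moment_def second_moment_def neg.clipped_def clipped_def)
  have "V > 0" using V second_moment_nonneg by linarith
  obtain h1 where h1: "h1 > 0" "\<And>N t K. 0 < K \<Longrightarrow> 2 * K \<le> t \<Longrightarrow> t \<le> h1 * real N \<Longrightarrow>
     tail N t \<le> 3 * exp (- t\<^sup>2 / (2 * real N * V)) + 4 * (real N * clipped K)"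
    using fuk_nagaev[OF V(1)] by blast
  obtain h2 where h2: "h2 > 0" "\<And>N t K. 0 < K \<Longrightarrow> 2 * K \<le> t \<Longrightarrow> t \<le> h2 * real N \<Longrightarrow>
     neg.tail N t \<le> 3 * exp (- t\<^sup>2 / (2 * real N * V)) + 4 * (real N * clipped K)"
    using neg.fuk_nagaev[unfolded neg_eq, OF V(1)] by blast
  define h where "h = min h1 h2"
  have h: "h > 0" "h \<le> h1" "h \<le> h2" using h1 h2 by (auto simp: h_def)
  define \<epsilon> where "\<epsilon> = min (\<kappa> / 2) 1"
  have \<epsilon>: "0 < \<epsilon>" "\<epsilon> \<le> 1" "2 * \<epsilon> \<le> \<kappa>" using \<kappa> by (auto simp: \<epsilon>_def)
  define \<eta> where "\<eta> = min (y\<^sup>2 / V - 1) 1"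
  have \<eta>: "0 < \<eta>" "\<eta> \<le> 1" "(1 + \<eta>) * V \<le> y\<^sup>2"
    using V \<open>V > 0\<close> by (auto simp: \<eta>_def min_def field_simps)
  \<comment> \<open>eventually \<open>s n \<le> c * a n\<close>, which puts the deviations into the range of the tail inequality\<close>
  define c where "c = min (h / (2 * (y * sqrt 2))) (h * \<delta> / \<kappa>)"
  have c: "c > 0" using h \<kappa> \<delta> \<open>0 < y\<close> by (auto simp: c_def)
  have c_le: "c \<le> h / (2 * (y * sqrt 2))" "c \<le> h * \<delta> / \<kappa>" by (simp_all add: c_def)
  have c1: "c * (y * sqrt 2) \<le> h / 2" and c2: "c * \<kappa> \<le> h * \<delta>"
    using c_le \<kappa> \<open>0 < y\<close> by (simp_all add: pos_le_divide_eq mult.commute mult.left_commute)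
  have "eventually (\<lambda>n. a n \<ge> 1 / \<delta>) sequentially" using a_top unfolding filterlim_at_top by blast
  then have ev: "eventually (\<lambda>n. n\<^sub>0 \<le> n \<and> s n \<le> c * a n \<and> 1 \<le> \<delta> * a n) sequentially"
    using eventually_s_le[OF c] eventually_ge_at_top[of n\<^sub>0]
    by eventually_elim (use \<delta> in \<open>auto simp: field_simps\<close>)
  show ?thesis
  proof (rule exI[of _ \<eta>], rule conjI[OF \<eta>(1)], rule exI[of _ \<epsilon>], intro conjI \<epsilon>(1,2) eventually_mono[OF ev])
    fix n assume n: "n\<^sub>0 \<le> n \<and> s n \<le> c * a n \<and> 1 \<le> \<delta> * a n"
    have an: "a n \<ge> 1" "d n \<ge> 1" "s n > 0" "(s n)\<^sup>2 = a n * d n"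
      using n a_ge d_ge s_pos s_sq by auto
    have K: "0 < \<epsilon> * s n" "2 * (\<epsilon> * s n) \<le> \<kappa> * s n" using \<epsilon> an by auto
    have cl: "clipped (\<epsilon> * s n) \<ge> 0" using K(1) by (rule clipped_nonneg)
    have lenn: "real (len n) \<le> a n" "a n / 2 \<le> real (len n)" "0 < real (len n)"
      using len_le[of n] len_pos[of n] len_gt[of n] n by linarith+
    show "prob {\<omega>\<in>space M. y * sqrt 2 * s n \<le> T n \<omega>} \<le> 3 * exp (- (1 + \<eta>) * d n) + 4 * (a n * clipped (\<epsilon> * s n))"
    proof -
      have "prob {\<omega>\<in>space M. y * sqrt 2 * s n \<le> T n \<omega>} = tail (len n) (y * sqrt 2 * s n)"
        unfolding tail_def by (subst prob_window_pred) auto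
      also have "\<dots> \<le> 3 * exp (- (y * sqrt 2 * s n)\<^sup>2 / (2 * real (len n) * V)) + 4 * (real (len n) * clipped (\<epsilon> * s n))"
      proof (rule h1(2)[OF K(1)])
        show "2 * (\<epsilon> * s n) \<le> y * sqrt 2 * s n"
          using K(2) mult_right_mono[OF \<kappa>(2), of "s n"] an by linarith
        have "y * sqrt 2 * s n \<le> y * sqrt 2 * (c * a n)" using n \<open>0 < y\<close> by (intro mult_left_mono) auto
        also have "\<dots> = c * (y * sqrt 2) * a n" by simp
        also have "\<dots> \<le> h / 2 * a n" using c1 an by (intro mult_right_mono) auto
        also have "\<dots> \<le> h * real (len n)" using lenn h by (simp add: field_simps)
        also have "\<dots> \<le> h1 * real (len n)" using h by (intro mult_right_mono) auto
        finally show "y * sqrt 2 * s n \<le> h1 * real (len n)" .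
      qed
      also have "\<dots> \<le> 3 * exp (- (1 + \<eta>) * d n) + 4 * (a n * clipped (\<epsilon> * s n))"
      proof -
        have "(1 + \<eta>) * d n * (real (len n) * V) \<le> y\<^sup>2 * (a n * d n)"
        proof -
          have "(1 + \<eta>) * d n * (real (len n) * V) = ((1 + \<eta>) * V) * (real (len n) * d n)" by simp
          also have "\<dots> \<le> y\<^sup>2 * (a n * d n)" using \<eta> lenn an by (intro mult_mono) auto
          finally show ?thesis .
        qed
        then have "(1 + \<eta>) * d n \<le> (y * sqrt 2 * s n)\<^sup>2 / (2 * real (len n) * V)"
          using lenn(3) \<open>V > 0\<close> an(4) by (simp add: power_mult_distrib pos_le_divide_eq)
        then have "exp (- (y * sqrt 2 * s n)\<^sup>2 / (2 * real (len n) * V)) \<le> exp (- (1 + \<eta>) * d n)" 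
          by (simp only: exp_le_cancel_iff mult_minus_left minus_divide_left[symmetric] neg_le_iff_le)
        moreover have "real (len n) * clipped (\<epsilon> * s n) \<le> a n * clipped (\<epsilon> * s n)"
          using lenn cl by (intro mult_right_mono) auto
        ultimately show ?thesis by linarith
      qed
      finally show ?thesis .
    qed
    have Nn: "real (N n) \<le> 3 * \<delta> * a n" "\<delta> * a n \<le> real (N n)" "0 < real (N n)" using n unfolding N_def by linarith+
    have N3: "real (N n) \<le> 3 * a n"
      using Nn(1) mult_right_mono[OF \<delta>(2), of "a n"] an by linarith
    have expo: "3 * exp (- (\<kappa> * s n)\<^sup>2 / (2 * real (N n) * V)) + 4 * (real (N n) * clipped (\<epsilon> * s n)) \<le>
        3 * exp (- (1 + \<eta>) * d n) + 12 * (a n * clipped (\<epsilon> * s n))"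
    proof -
      have "(1 + \<eta>) * d n * (2 * real (N n) * V) \<le> 2 * d n * (2 * (3 * \<delta> * a n) * V)"
        using \<eta> an Nn \<open>V > 0\<close> \<delta> by (intro mult_mono) auto
      also have "\<dots> = (12 * V * \<delta>) * (a n * d n)" by simp
      also have "\<dots> \<le> \<kappa>\<^sup>2 * (a n * d n)" using \<delta> an by (intro mult_right_mono) auto
      also have "\<dots> = (\<kappa> * s n)\<^sup>2" by (simp add: power_mult_distrib an)
      finally have "(1 + \<eta>) * d n \<le> (\<kappa> * s n)\<^sup>2 / (2 * real (N n) * V)"
        using Nn(3) \<open>V > 0\<close> by (simp add: pos_le_divide_eq)
      then have "exp (- (\<kappa> * s n)\<^sup>2 / (2 * real (N n) * V)) \<le> exp (- (1 + \<eta>) * d n)" 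
          by (simp only: exp_le_cancel_iff mult_minus_left minus_divide_left[symmetric] neg_le_iff_le)
      moreover have "real (N n) * clipped (\<epsilon> * s n) \<le> 3 * a n * clipped (\<epsilon> * s n)"
        using N3 cl by (intro mult_right_mono) auto
      ultimately show ?thesis by linarith
    qed
    have ths: "\<kappa> * s n \<le> h * real (N n)"
    proof -
      have "\<kappa> * s n \<le> \<kappa> * (c * a n)" using n \<kappa> by (intro mult_left_mono) auto
      also have "\<dots> = c * \<kappa> * a n" by simp
      also have "\<dots> \<le> h * \<delta> * a n" using c2 an by (intro mult_right_mono) auto
      also have "\<dots> = h * (\<delta> * a n)" by simp
      also have "\<dots> \<le> h * real (N n)" using Nn h by (intro mult_left_mono) auto
      finally show ?thesis .
    qed
    have u: "2 * real (N n) * second_moment \<le> (\<kappa> * s n)\<^sup>2"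
    proof -
      have "2 * real (N n) * second_moment \<le> 2 * (3 * \<delta> * a n) * V"
        using Nn V second_moment_nonneg \<delta> an by (intro mult_mono) auto
      also have "\<dots> \<le> (12 * V * \<delta>) * a n" using \<open>V > 0\<close> \<delta> an by simp
      also have "\<dots> \<le> \<kappa>\<^sup>2 * (a n * d n)"
      proof (rule mult_mono)
        show "a n \<le> a n * d n" using an by (simp add: mult_le_cancel_left1)
      qed (use \<delta> an in auto)
      also have "\<dots> = (\<kappa> * s n)\<^sup>2" by (simp add: power_mult_distrib an)
      finally show ?thesis .
    qed
    have us: "0 < \<kappa> * s n" using \<kappa> an by simp
    have two: "2 * \<kappa> * s n = \<kappa> * s n + \<kappa> * s n" by simp
    show "prob {\<omega>\<in>space M. \<exists>i\<le>N n. 2 * \<kappa> * s n \<le> (\<Sum>j\<in>{n..<n+i}. - \<xi> j \<omega>)}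
       \<le> 6 * exp (- (1 + \<eta>) * d n) + 24 * (a n * clipped (\<epsilon> * s n))"
    proof -
      have "prob {\<omega>\<in>space M. \<exists>i\<le>N n. 2 * \<kappa> * s n \<le> (\<Sum>j\<in>{n..<n+i}. - \<xi> j \<omega>)} \<le> 2 * neg.tail (N n) (\<kappa> * s n)"
        unfolding two by (rule neg.ottaviani[OF us]) (simp add: neg_eq u)
      moreover have "neg.tail (N n) (\<kappa> * s n) \<le> 3 * exp (- (\<kappa> * s n)\<^sup>2 / (2 * real (N n) * V)) + 4 * (real (N n) * clipped (\<epsilon> * s n))"
        using ths mult_right_mono[OF h(3), of "real (N n)"] by (intro h2(2)[OF K]) linarith
      ultimately show ?thesis using expo by linarith
    qed
    show "prob {\<omega>\<in>space M. \<exists>i\<le>N n. 2 * \<kappa> * s n \<le> (\<Sum>j\<in>{n+len n..<n+len n+i}. \<xi> j \<omega>)}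
       \<le> 6 * exp (- (1 + \<eta>) * d n) + 24 * (a n * clipped (\<epsilon> * s n))"
    proof -
      have "prob {\<omega>\<in>space M. \<exists>i\<le>N n. 2 * \<kappa> * s n \<le> (\<Sum>j\<in>{n+len n..<n+len n+i}. \<xi> j \<omega>)} \<le> 2 * tail (N n) (\<kappa> * s n)"
        unfolding two by (rule ottaviani[OF us u])
      moreover have "tail (N n) (\<kappa> * s n) \<le> 3 * exp (- (\<kappa> * s n)\<^sup>2 / (2 * real (N n) * V)) + 4 * (real (N n) * clipped (\<epsilon> * s n))"
        using ths mult_right_mono[OF h(2), of "real (N n)"] by (intro h1(2)[OF K]) linarith
      ultimately show ?thesis using expo by linarith
    qed
  qed
qed

text \<open>The first Borel-Cantelli lemma along a grid so fine that each window differs from the one at the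
  preceding grid point only by two boundary pieces that are short compared with \<open>a n\<close>.\<close>

lemma window_upper_bound:
  assumes tails: "summable (\<lambda>n. prob {\<omega>\<in>space M. s n < \<bar>\<xi> 0 \<omega>\<bar>})" and y: "sqrt second_moment < y"
  shows "AE \<omega> in M. \<forall>\<^sub>F n in sequentially. T n \<omega> \<le> y * sqrt 2 * s n"
proof -
  define y1 where "y1 = (y + sqrt second_moment) / 2"
  have sm0: "0 \<le> sqrt second_moment" using second_moment_nonneg by simp
  have y1: "sqrt second_moment < y1" "y1 < y" using y by (auto simp: y1_def)
  note y1 = y1 le_less_trans[OF sm0 y1(1)]
  have "(sqrt second_moment)\<^sup>2 < y1\<^sup>2" using y1 sm0 by (intro power_strict_mono) auto
  then have "second_moment < y1\<^sup>2" using second_moment_nonneg by simp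
  then obtain V where V: "second_moment < V" "V < y1\<^sup>2" using dense by blast
  have "V > 0" using V second_moment_nonneg by linarith
  \<comment> \<open>the gap between \<open>y1\<close> and \<open>y\<close> is shared by the two boundary pieces, each of which may reach \<open>2 * \<kappa> * s n\<close>\<close>
  define \<kappa> where "\<kappa> = (y - y1) * sqrt 2 / 4"
  have \<kappa>: "0 < \<kappa>" "\<kappa> \<le> y1 * sqrt 2" "y1 * sqrt 2 + 4 * \<kappa> = y * sqrt 2"
  proof -
    show "0 < \<kappa>" using y1 by (simp add: \<kappa>_def)
    have "y - y1 \<le> y1" using sm0 unfolding y1_def by argo
    then have "(y - y1) * sqrt 2 \<le> y1 * sqrt 2" by (intro mult_right_mono) auto
    moreover have "0 < y1 * sqrt 2" using y1 by simp
    ultimately show "\<kappa> \<le> y1 * sqrt 2" unfolding \<kappa>_def by linarith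
    show "y1 * sqrt 2 + 4 * \<kappa> = y * sqrt 2"
      unfolding \<kappa>_def left_diff_distrib by argo
  qed
  define \<delta> where "\<delta> = min 1 (\<kappa>\<^sup>2 / (12 * V))"
  have \<delta>: "0 < \<delta>" "\<delta> \<le> 1" using \<kappa> \<open>V > 0\<close> by (auto simp: \<delta>_def)
  have "\<delta> \<le> \<kappa>\<^sup>2 / (12 * V)" by (simp add: \<delta>_def)
  then have \<delta>V: "12 * V * \<delta> \<le> \<kappa>\<^sup>2" using \<open>V > 0\<close> by (simp add: pos_le_divide_eq mult.commute)
  define N' where "N' n = nat \<lfloor>3 * \<delta> * a n\<rfloor>" for n
  define A1 where "A1 n = {\<omega>\<in>space M. y1 * sqrt 2 * s n \<le> T n \<omega>}" for n
  define A2 where "A2 n = {\<omega>\<in>space M. \<exists>i\<le>N' n. 2 * \<kappa> * s n \<le> (\<Sum>j\<in>{n..<n+i}. - \<xi> j \<omega>)}" for n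
  define A3 where "A3 n = {\<omega>\<in>space M. \<exists>i\<le>N' n. 2 * \<kappa> * s n \<le> (\<Sum>j\<in>{n+len n..<n+len n+i}. \<xi> j \<omega>)}" for n
  have [measurable]: "A1 n \<in> events" "A2 n \<in> events" "A3 n \<in> events" for n
    unfolding A1_def A2_def A3_def by measurable
  obtain \<eta> \<epsilon> where \<eta>: "\<eta> > 0" and \<epsilon>: "0 < \<epsilon>" "\<epsilon> \<le> 1"
    and ev: "eventually (\<lambda>n.
      prob (A1 n) \<le> 3 * exp (- (1 + \<eta>) * d n) + 4 * (a n * clipped (\<epsilon> * s n)) \<and>
      prob (A2 n) \<le> 6 * exp (- (1 + \<eta>) * d n) + 24 * (a n * clipped (\<epsilon> * s n)) \<and>
      prob (A3 n) \<le> 6 * exp (- (1 + \<eta>) * d n) + 24 * (a n * clipped (\<epsilon> * s n))) sequentially"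
    using block_event_bound[OF V y1(3) \<kappa>(1,2) \<delta> \<delta>V] unfolding A1_def A2_def A3_def N'_def by blast
  define A where "A n = A1 n \<union> A2 n \<union> A3 n" for n
  have evA: "eventually (\<lambda>n. prob (A n) \<le> 15 * exp (- (1 + \<eta>) * d n) + 52 * (a n * clipped (\<epsilon> * s n))) sequentially"
    using ev
  proof eventually_elim
    case (elim n)
    have "prob (A n) \<le> prob (A1 n \<union> A2 n) + prob (A3 n)" unfolding A_def by (rule measure_Un_le) auto
    also have "prob (A1 n \<union> A2 n) \<le> prob (A1 n) + prob (A2 n)" by (rule measure_Un_le) auto
    finally show ?case using elim by linarith
  qed
  have "eventually (\<lambda>n. a n \<ge> 1 / \<delta>) sequentially" using a_top unfolding filterlim_at_top by blast
  then have "eventually (\<lambda>n. n\<^sub>0 \<le> n \<and> 1 \<le> \<delta> * a n) sequentially"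
    using eventually_ge_at_top[of n\<^sub>0] by eventually_elim (use \<delta> in \<open>auto simp: field_simps\<close>)
  then obtain N where N: "n\<^sub>0 \<le> N" "1 \<le> \<delta> * a N" unfolding eventually_sequentially by blast
  interpret G: window_grid a d n\<^sub>0 \<delta> N using N \<delta> by unfold_locales
  have [measurable]: "A n \<in> events" for n unfolding A_def by measurable
  have "summable (\<lambda>k. prob (A (G.g k)))"
  proof (rule summable_comparison_test_ev)
    show "summable (\<lambda>k. 15 * exp (- (1 + \<eta>) * d (G.g k)) + 52 * (a (G.g k) * clipped (\<epsilon> * s (G.g k))))"
    proof (intro summable_add summable_mult G.summable_exp_grid \<eta>)
      show "summable (\<lambda>k. a (G.g k) * clipped (\<epsilon> * s (G.g k)))"
      proof (rule G.summable_grid[OF _ _ summable_clipped[OF tails \<epsilon>]])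
        show "0 \<le> clipped (\<epsilon> * s n)" if "n\<^sub>0 \<le> n" for n using s_pos[OF that] \<epsilon> by (intro clipped_nonneg) auto
        show "clipped (\<epsilon> * s n) \<le> clipped (\<epsilon> * s m)" if "n\<^sub>0 \<le> m" "m \<le> n" for m n
          using s_pos[OF that(1)] s_mono[OF that] \<epsilon> by (intro clipped_antimono mult_left_mono) auto
      qed
    qed
    have "eventually (\<lambda>k. prob (A (G.g k)) \<le> 15 * exp (- (1 + \<eta>) * d (G.g k)) + 52 * (a (G.g k) * clipped (\<epsilon> * s (G.g k)))) sequentially"
      using filterlim_subseq[OF G.strict_mono_grid] evA by (rule eventually_compose_filterlim[rotated])
    then show "\<forall>\<^sub>F k in sequentially. norm (prob (A (G.g k))) \<le> 15 * exp (- (1 + \<eta>) * d (G.g k)) + 52 * (a (G.g k) * clipped (\<epsilon> * s (G.g k)))"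
      by simp
  qed
  then have "AE \<omega> in M. eventually (\<lambda>k. \<omega> \<in> space M - A (G.g k)) sequentially"
    by (intro borel_cantelli_AE1) (auto simp: emeasure_eq_measure)
  then show ?thesis
  proof eventually_elim
    case (elim \<omega>)
    then obtain k0 where k0: "\<And>k. k \<ge> k0 \<Longrightarrow> \<omega> \<in> space M - A (G.g k)" unfolding eventually_sequentially by blast
    show ?case
      using eventually_ge_at_top[of "G.g k0"]
    proof eventually_elim
      case (elim n)
      then have "N \<le> n" using G.grid_ge[of k0] by simp
      then obtain k where k: "G.g k \<le> n" "n < G.g (Suc k)" using G.grid_block by blast
      have "k0 < Suc k" using elim k(2) G.strict_mono_grid by (meson le_less_trans strict_mono_less)
      then have \<omega>: "\<omega> \<in> space M - A (G.g k)" by (intro k0) simp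
      \<comment> \<open>compare the window at \<open>n\<close> with the one at the grid point \<open>m\<close> to its left\<close>
      define m where "m = G.g k"
      have m: "n\<^sub>0 \<le> m" "m \<le> n" "N \<le> m" using k G.grid_ge_n0[of k] G.grid_ge[of k] by (auto simp: m_def)
      have n0n: "n\<^sub>0 \<le> n" using m by simp
      have nm: "real n - real m \<le> \<delta> * a m"
        using k(2) G.step_le[of k] unfolding m_def by (simp del: grid.simps)
      have da: "1 \<le> \<delta> * a m" using G.step_real_ge[OF m(3)] .
      define m' where "m' = m + len m"
      have m'n: "m' \<le> n + len n" using m len_mono[OF m(1,2)] by (simp add: m'_def)
      have len_diff: "real (len n) - real (len m) \<le> real n - real m + 1"
        using a_slope[OF m(1,2)] len_le[OF n0n] len_gt[OF m(1)] by linarith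
      have i1: "n - m \<le> N' m"
      proof -
        have "real n - real m \<le> 3 * \<delta> * a m" using nm da by linarith
        then show ?thesis using m unfolding N'_def by linarith
      qed
      have i2: "n + len n - m' \<le> N' m"
      proof -
        have "real (n + len n - m') = real n - real m + (real (len n) - real (len m))"
          using m'n by (simp add: m'_def of_nat_diff)
        also have "\<dots> \<le> 3 * (\<delta> * a m)" using len_diff nm da by linarith
        finally show ?thesis unfolding N'_def by (simp add: le_nat_iff le_floor_iff)
      qed
      have notA: "T m \<omega> < y1 * sqrt 2 * s m"
        "\<And>i. i \<le> N' m \<Longrightarrow> (\<Sum>j\<in>{m..<m+i}. - \<xi> j \<omega>) < 2 * \<kappa> * s m"
        "\<And>i. i \<le> N' m \<Longrightarrow> (\<Sum>j\<in>{m'..<m'+i}. \<xi> j \<omega>) < 2 * \<kappa> * s m"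
        using \<omega> unfolding A_def A1_def A2_def A3_def m_def[symmetric] m'_def
        by (auto simp: not_le) (meson not_le)+
      have b: "(\<Sum>j\<in>{m..<n}. - \<xi> j \<omega>) < 2 * \<kappa> * s m" using notA(2)[OF i1] m by simp
      have c: "(\<Sum>j\<in>{m'..<n + len n}. \<xi> j \<omega>) < 2 * \<kappa> * s m" using notA(3)[OF i2] m'n by simp
      have "(\<Sum>j\<in>{m..<n}. \<xi> j \<omega>) + (\<Sum>j\<in>{n..<n + len n}. \<xi> j \<omega>) =
            (\<Sum>j\<in>{m..<m'}. \<xi> j \<omega>) + (\<Sum>j\<in>{m'..<n + len n}. \<xi> j \<omega>)"
        using m m'n by (simp add: sum.atLeastLessThan_concat m'_def)
      then have "T n \<omega> = T m \<omega> + (\<Sum>j\<in>{m..<n}. - \<xi> j \<omega>) + (\<Sum>j\<in>{m'..<n + len n}. \<xi> j \<omega>)"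
        unfolding T_def m'_def by (simp add: sum_negf)
      also have "\<dots> \<le> y1 * sqrt 2 * s m + 2 * \<kappa> * s m + 2 * \<kappa> * s m" using notA(1) b c by linarith
      also have "\<dots> = (y1 * sqrt 2 + 4 * \<kappa>) * s m" by (simp add: algebra_simps)
      also have "\<dots> = y * sqrt 2 * s m" unfolding \<kappa>(3) ..
      also have "\<dots> \<le> y * sqrt 2 * s n" using s_mono[OF m(1,2)] y1 by (intro mult_left_mono) auto
      finally show ?case .
    qed
  qed
qed

lemma degenerate_windows:
  assumes "second_moment = 0" shows "AE \<omega> in M. \<forall>n. T n \<omega> = 0"
proof -
  have "AE \<omega> in M. \<xi> j \<omega> = 0" for j
  proof -
    have "integrable M (\<lambda>\<omega>. (\<xi> j \<omega>)\<^sup>2)" "expectation (\<lambda>\<omega>. (\<xi> j \<omega>)\<^sup>2) = 0"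
      using integrable_ident[of "\<lambda>x. x\<^sup>2" j] expectation_ident[of "\<lambda>x. x\<^sup>2" j] square_integrable assms
      by (auto simp: second_moment_def)
    then show ?thesis by (subst (asm) integral_nonneg_eq_0_iff_AE) auto
  qed
  then have "AE \<omega> in M. \<forall>j. \<xi> j \<omega> = 0" by (simp add: AE_all_countable)
  then show ?thesis by eventually_elim (simp add: T_def)
qed

theorem window_limsup:
  assumes tails: "summable (\<lambda>n. prob {\<omega>\<in>space M. s n < \<bar>\<xi> 0 \<omega>\<bar>})"
  shows "AE \<omega> in M. limsup (\<lambda>n. ereal (T n \<omega> / (sqrt 2 * s n))) = ereal (sqrt second_moment)"
proof (cases "second_moment = 0")
  case True
  have "AE \<omega> in M. \<forall>n. T n \<omega> = 0" by (rule degenerate_windows[OF True])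
  then show ?thesis by eventually_elim (simp add: True Limsup_const zero_ereal_def[symmetric])
next
  case False
  define \<sigma> where "\<sigma> = sqrt second_moment"
  have "\<sigma> > 0" using False second_moment_nonneg by (simp add: \<sigma>_def)
  have up: "AE \<omega> in M. \<forall>i::nat. \<forall>\<^sub>F n in sequentially. T n \<omega> \<le> (\<sigma> + 1 / (real i + 1)) * sqrt 2 * s n"
    unfolding AE_all_countable by (intro allI window_upper_bound tails) (simp add: \<sigma>_def)
  have lo: "AE \<omega> in M. \<forall>i::nat. \<exists>\<^sub>F n in sequentially. \<sigma> * (1 - 1 / (real i + 2)) * sqrt 2 * s n \<le> T n \<omega>"
    unfolding AE_all_countable
  proof (intro allI window_lower_bound)
    fix i :: nat
    have "\<sigma> * (1 - 1 / (real i + 2)) < \<sigma> * 1" using \<open>\<sigma> > 0\<close> by (intro mult_strict_left_mono) auto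
    then show "\<sigma> * (1 - 1 / (real i + 2)) < sqrt second_moment" by (simp add: \<sigma>_def)
    show "0 < \<sigma> * (1 - 1 / (real i + 2))" using \<open>\<sigma> > 0\<close> by (intro mult_pos_pos) auto
  qed
  from up lo show ?thesis unfolding \<sigma>_def[symmetric]
  proof eventually_elim
    case (elim \<omega>)
    let ?x = "\<lambda>n. ereal (T n \<omega> / (sqrt 2 * s n))"
    have U: "limsup ?x \<le> ereal (\<sigma> + 1 / (real i + 1))" for i
    proof (rule Limsup_bounded)
      show "\<forall>\<^sub>F n in sequentially. ?x n \<le> ereal (\<sigma> + 1 / (real i + 1))"
        using elim(1)[rule_format, of i] eventually_ge_at_top[of n\<^sub>0]
      proof eventually_elim
        case (elim n)
        then show ?case using s_pos[OF elim(2)] by (simp add: pos_divide_le_eq mult.assoc)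
      qed
    qed
    have L: "ereal (\<sigma> * (1 - 1 / (real i + 2))) \<le> limsup ?x" for i
    proof (rule ccontr)
      assume "\<not> ?thesis"
      then have "limsup ?x < ereal (\<sigma> * (1 - 1 / (real i + 2)))" by simp
      then have "\<forall>\<^sub>F n in sequentially. ?x n < ereal (\<sigma> * (1 - 1 / (real i + 2)))" by (rule Limsup_lessD)
      then have "\<forall>\<^sub>F n in sequentially. \<not> \<sigma> * (1 - 1 / (real i + 2)) * sqrt 2 * s n \<le> T n \<omega>"
        using eventually_ge_at_top[of n\<^sub>0]
      proof eventually_elim
        case (elim n)
        then show ?case using s_pos[OF elim(2)] by (simp add: pos_divide_less_eq mult.assoc)
      qed
      then show False using elim(2)[rule_format, of i] by (simp add: frequently_def)
    qed
    have limU: "(\<lambda>i. ereal (\<sigma> + 1 / (real i + 1))) \<longlonglongrightarrow> ereal (\<sigma> + 0)"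
      by (intro tendsto_intros LIMSEQ_Suc[OF lim_1_over_n, unfolded of_nat_Suc add.commute[of 1]])
    have limL: "(\<lambda>i. ereal (\<sigma> * (1 - 1 / (real i + 2)))) \<longlonglongrightarrow> ereal (\<sigma> * (1 - 0))"
    proof (intro tendsto_intros)
      show "(\<lambda>i. 1 / (real i + 2)) \<longlonglongrightarrow> 0"
        using LIMSEQ_ignore_initial_segment[OF lim_1_over_n[where 'a=real], of 2] by (simp add: add.commute)
    qed
    show "limsup ?x = ereal \<sigma>"
    proof (rule antisym)
      show "limsup ?x \<le> ereal \<sigma>"
        using tendsto_lowerbound[OF limU, of "limsup ?x"] U by simp
      show "ereal \<sigma> \<le> limsup ?x"
        using tendsto_upperbound[OF limL, of "limsup ?x"] L by simp
    qed
  qed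
qed

end

section \<open>Necessary conditions for bounded window sums\<close>

text \<open>The tail sum is the expectation of \<open>\<lceil>Z\<rceil>\<close>, which differs from \<open>Z\<close> by at most one.\<close>

lemma (in prob_space) integrable_iff_summable_tails:
  fixes Z :: "'a \<Rightarrow> real"
  assumes [measurable]: "Z \<in> borel_measurable M" and nonneg: "\<And>\<omega>. 0 \<le> Z \<omega>"
  shows "integrable M Z \<longleftrightarrow> summable (\<lambda>n. prob {\<omega>\<in>space M. real n < Z \<omega>})"
proof -
  define N where "N \<omega> = nat \<lceil>Z \<omega>\<rceil>" for \<omega>
  have [measurable]: "N \<in> measurable M (count_space UNIV)" unfolding N_def by measurable
  have N: "Z \<omega> \<le> real (N \<omega>)" "real (N \<omega>) \<le> Z \<omega> + 1" "n < N \<omega> \<longleftrightarrow> real n < Z \<omega>" for n \<omega>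
    using nonneg[of \<omega>] unfolding N_def by linarith+
  have sum: "(\<integral>\<^sup>+\<omega>. ennreal (real (N \<omega>)) \<partial>M) = (\<Sum>n. ennreal (prob {\<omega>\<in>space M. real n < Z \<omega>}))"
  proof -
    have "(\<integral>\<^sup>+\<omega>. ennreal (real (N \<omega>)) \<partial>M) = (\<integral>\<^sup>+\<omega>. of_nat (N \<omega>) \<partial>M)"
      by (simp only: ennreal_of_nat_eq_real_of_nat)
    also have "\<dots> = (\<Sum>n. emeasure M {\<omega>\<in>space M. n < N \<omega>})" by (rule nn_integral_nat_function) simp
    finally show ?thesis unfolding N(3) emeasure_eq_measure .
  qed
  show ?thesis
  proof
    assume int: "integrable M Z"
    have "(\<integral>\<^sup>+\<omega>. ennreal (real (N \<omega>)) \<partial>M) \<le> (\<integral>\<^sup>+\<omega>. ennreal (Z \<omega> + 1) \<partial>M)"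
      by (intro nn_integral_mono ennreal_leI N)
    also have "\<dots> < \<infinity>" using int nonneg by (subst nn_integral_eq_integral) auto
    finally have "(\<Sum>n. ennreal (prob {\<omega>\<in>space M. real n < Z \<omega>})) \<noteq> \<top>" unfolding sum by simp
    then show "summable (\<lambda>n. prob {\<omega>\<in>space M. real n < Z \<omega>})" by (rule summable_suminf_not_top[rotated]) simp
  next
    assume s: "summable (\<lambda>n. prob {\<omega>\<in>space M. real n < Z \<omega>})"
    have "(\<integral>\<^sup>+\<omega>. ennreal (Z \<omega>) \<partial>M) \<le> (\<integral>\<^sup>+\<omega>. ennreal (real (N \<omega>)) \<partial>M)"
      by (intro nn_integral_mono ennreal_leI N)
    also have "\<dots> < \<infinity>" unfolding sum using s by (subst suminf_ennreal2) auto
    finally show "integrable M Z" by (intro integrableI_nonneg) (auto simp: nonneg)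
  qed
qed

lemma (in prob_space) frequently_if_prob_tendsto_1:
  assumes [measurable]: "\<And>n. Measurable.pred M (P n)"
    and lim: "(\<lambda>n. prob {\<omega>\<in>space M. P n \<omega>}) \<longlonglongrightarrow> 1"
  shows "AE \<omega> in M. \<exists>\<^sub>F n in sequentially. P n \<omega>"
proof -
  have "prob {\<omega>\<in>space M. \<exists>n\<ge>m. P n \<omega>} = 1" for m
  proof (rule antisym)
    show "1 \<le> prob {\<omega>\<in>space M. \<exists>n\<ge>m. P n \<omega>}"
    proof (rule tendsto_upperbound[OF lim])
      show "\<forall>\<^sub>F n in sequentially. prob {\<omega>\<in>space M. P n \<omega>} \<le> prob {\<omega>\<in>space M. \<exists>n\<ge>m. P n \<omega>}"
        using eventually_ge_at_top[of m] by eventually_elim (intro finite_measure_mono, auto)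
    qed simp
  qed simp
  then have "AE \<omega> in M. \<exists>n\<ge>m. P n \<omega>" for m
    by (subst (asm) prob_Collect_eq_1) auto
  then have "AE \<omega> in M. \<forall>m. \<exists>n\<ge>m. P n \<omega>" by (simp add: AE_all_countable)
  then show ?thesis by (simp add: frequently_sequentially)
qed

context iid_windows
begin

lemma limsup_infinite:
  assumes "\<And>K. 0 < K \<Longrightarrow> AE \<omega> in M. \<exists>\<^sub>F n in sequentially. K * s n \<le> \<bar>T n \<omega>\<bar>"
  shows "AE \<omega> in M. limsup (\<lambda>n. ereal (\<bar>T n \<omega>\<bar> / s n)) = \<infinity>"
proof -
  have "AE \<omega> in M. \<forall>i::nat. \<exists>\<^sub>F n in sequentially. (real i + 1) * s n \<le> \<bar>T n \<omega>\<bar>"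
    unfolding AE_all_countable by (intro allI assms) simp
  then show ?thesis
  proof eventually_elim
    case (elim \<omega>)
    let ?x = "\<lambda>n. ereal (\<bar>T n \<omega>\<bar> / s n)"
    have "ereal (real i) \<le> limsup ?x" for i
    proof (rule ccontr)
      assume "\<not> ?thesis"
      then have "limsup ?x < ereal (real i)" by simp
      then have "\<forall>\<^sub>F n in sequentially. ?x n < ereal (real i)" by (rule Limsup_lessD)
      then have "\<forall>\<^sub>F n in sequentially. \<not> (real i + 1) * s n \<le> \<bar>T n \<omega>\<bar>"
        using eventually_ge_at_top[of n\<^sub>0]
      proof eventually_elim
        case (elim n)
        have "0 < s n" using s_pos elim by blast
        then have "\<bar>T n \<omega>\<bar> < real i * s n" using elim by (simp add: pos_divide_less_eq)
        then show ?case using \<open>0 < s n\<close> by (simp add: algebra_simps)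
      qed
      then show False using elim[rule_format, of i] by (simp add: frequently_def)
    qed
    then show ?case by (metis ereal_top real_arch_simple order_trans ereal_less_eq(3))
  qed
qed

lemma infinite_variance_unbounded:
  assumes "\<not> integrable M (\<lambda>\<omega>. (\<xi> 0 \<omega>)\<^sup>2)" and "0 < K"
  shows "AE \<omega> in M. \<exists>\<^sub>F n in sequentially. K * s n \<le> \<bar>T n \<omega>\<bar>"
proof -
  obtain D where D: "D > 0" "\<And>N d. d \<ge> D \<Longrightarrow> real N \<ge> D * d \<Longrightarrow>
     exp (- d) / 2 \<le> prob {\<omega>\<in>space M. 2 * K * sqrt (real N * d) \<le> \<bar>\<Sum>j<N. \<xi> j \<omega>\<bar>}"
    using two_sided_moderate_deviation_infinite_variance[OF assms(1), of "2 * K"] \<open>0 < K\<close> by auto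
  show ?thesis
  proof (rule windows_infinitely_often[where c="1/2"])
    have q: "(1 / 4 :: real) < 1" by simp
    show "\<forall>\<^sub>F n in sequentially. 1 / 2 * exp (- d n) \<le> prob {\<omega>\<in>space M. K * s n \<le> \<bar>T n \<omega>\<bar>}"
      using eventually_moderate[OF D(1)] eventually_len_ge[OF q] eventually_ge_at_top[of n\<^sub>0]
    proof eventually_elim
      case (elim n)
      have "s n \<le> 2 * sqrt (real (len n) * d n)"
      proof -
        have "a n * d n \<le> 4 * (real (len n) * d n)" using elim d_ge[of n] by simp
        then have "sqrt (a n * d n) \<le> sqrt (4 * (real (len n) * d n))" by (rule real_sqrt_le_mono)
        then show ?thesis by (simp add: s_def real_sqrt_mult)
      qed
      then have le: "K * s n \<le> 2 * K * sqrt (real (len n) * d n)" using \<open>0 < K\<close> by simp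
      have "exp (- d n) / 2 \<le> prob {\<omega>\<in>space M. 2 * K * sqrt (real (len n) * d n) \<le> \<bar>\<Sum>j<len n. \<xi> j \<omega>\<bar>}"
        using D(2) elim by blast
      also have "\<dots> \<le> prob {\<omega>\<in>space M. K * s n \<le> \<bar>\<Sum>j<len n. \<xi> j \<omega>\<bar>}"
        using le by (intro finite_measure_mono) auto
      also have "\<dots> = prob {\<omega>\<in>space M. K * s n \<le> \<bar>T n \<omega>\<bar>}" by (subst prob_window_pred) auto
      finally show ?case by simp
    qed
  qed auto
qed

text \<open>The window sum deviates from \<open>len n * \<mu>\<close> by less than \<open>\<bar>\<mu>\<bar> * a n / 4\<close> with probability tending to
  one, and \<open>s n\<close> is negligible compared with \<open>a n\<close>.\<close>

lemma nonzero_mean_unbounded: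
  assumes sq: "integrable M (\<lambda>\<omega>. (\<xi> 0 \<omega>)\<^sup>2)" and \<mu>: "expectation (\<xi> 0) \<noteq> 0" and "0 < K"
  shows "AE \<omega> in M. \<exists>\<^sub>F n in sequentially. K * s n \<le> \<bar>T n \<omega>\<bar>"
proof -
  define \<mu> where "\<mu> = expectation (\<xi> 0)"
  have \<mu>0: "0 < \<bar>\<mu>\<bar>" using assms(2) by (simp add: \<mu>_def)
  have int: "integrable M (\<xi> 0)" by (rule square_integrable_imp_integrable[OF rv sq])
  interpret z: iid_seq M "\<lambda>j \<omega>. \<xi> j \<omega> - \<mu>" by (rule iid_map) simp
  interpret z: iid_centered M "\<lambda>j \<omega>. \<xi> j \<omega> - \<mu>"
  proof
    show "integrable M (\<lambda>\<omega>. (\<xi> 0 \<omega> - \<mu>)\<^sup>2)" using sq int by (simp add: power2_diff)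
    show "expectation (\<lambda>\<omega>. \<xi> 0 \<omega> - \<mu>) = 0" using int by (simp add: \<mu>_def prob_space)
  qed
  show ?thesis
  proof (rule frequently_if_prob_tendsto_1)
    show "(\<lambda>n. prob {\<omega>\<in>space M. K * s n \<le> \<bar>T n \<omega>\<bar>}) \<longlonglongrightarrow> 1"
    proof (rule tendsto_sandwich)
      have "filterlim (\<lambda>n. \<bar>\<mu>\<bar>\<^sup>2 * a n) at_top sequentially"
        using \<mu>0 by (intro filterlim_tendsto_pos_mult_at_top[OF tendsto_const _ a_top]) auto
      then have "(\<lambda>n. 1 - 16 * z.second_moment / (\<bar>\<mu>\<bar>\<^sup>2 * a n)) \<longlonglongrightarrow> 1 - 0"
        by (intro tendsto_intros real_tendsto_divide_at_top[OF tendsto_const])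
      then show "(\<lambda>n. 1 - 16 * z.second_moment / (\<bar>\<mu>\<bar>\<^sup>2 * a n)) \<longlonglongrightarrow> 1" by simp
      have c: "0 < \<bar>\<mu>\<bar> / (4 * K)" using \<mu>0 \<open>0 < K\<close> by simp
      have q: "(1 / 2 :: real) < 1" by simp
      show "\<forall>\<^sub>F n in sequentially. 1 - 16 * z.second_moment / (\<bar>\<mu>\<bar>\<^sup>2 * a n) \<le> prob {\<omega>\<in>space M. K * s n \<le> \<bar>T n \<omega>\<bar>}"
        using eventually_s_le[OF c] eventually_len_ge[OF q] eventually_ge_at_top[of n\<^sub>0]
      proof eventually_elim
        case (elim n)
        let ?Z = "\<lambda>\<omega>. \<Sum>j\<in>{n..<n+len n}. (\<xi> j \<omega> - \<mu>)"
        let ?B = "{\<omega>\<in>space M. \<bar>\<mu>\<bar> * a n / 4 \<le> \<bar>?Z \<omega>\<bar>}"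
        have an: "1 \<le> a n" using a_ge elim by blast
        have u: "0 < \<bar>\<mu>\<bar> * a n / 4" using \<mu>0 an by simp
        have "prob ?B \<le> real (len n) * z.second_moment / (\<bar>\<mu>\<bar> * a n / 4)\<^sup>2"
          using z.chebyshev_sum[OF _ u, of "{n..<n+len n}"] by simp
        also have "\<dots> \<le> a n * z.second_moment / (\<bar>\<mu>\<bar> * a n / 4)\<^sup>2"
          using len_le[of n] elim z.second_moment_nonneg by (intro divide_right_mono mult_right_mono) auto
        also have "\<dots> = 16 * z.second_moment / (\<bar>\<mu>\<bar>\<^sup>2 * a n)"
          using an \<mu>0 by (simp add: power2_eq_square field_simps)
        finally have "1 - 16 * z.second_moment / (\<bar>\<mu>\<bar>\<^sup>2 * a n) \<le> 1 - prob ?B" by simp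
        also have "\<dots> = prob (space M - ?B)" by (subst prob_compl) auto
        also have "\<dots> \<le> prob {\<omega>\<in>space M. K * s n \<le> \<bar>T n \<omega>\<bar>}"
        proof (intro finite_measure_mono subsetI)
          fix \<omega> assume "\<omega> \<in> space M - ?B"
          then have \<omega>: "\<omega> \<in> space M" "\<bar>?Z \<omega>\<bar> < \<bar>\<mu>\<bar> * a n / 4" by auto
          have "T n \<omega> = ?Z \<omega> + real (len n) * \<mu>" by (simp add: T_def sum_subtractf)
          then have "real (len n) * \<bar>\<mu>\<bar> - \<bar>?Z \<omega>\<bar> \<le> \<bar>T n \<omega>\<bar>"
            using abs_triangle_ineq2[of "real (len n) * \<mu>" "- ?Z \<omega>"] by (simp add: abs_mult)
          moreover have "1 / 2 * a n * \<bar>\<mu>\<bar> \<le> real (len n) * \<bar>\<mu>\<bar>" using elim by (intro mult_right_mono) auto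
          moreover have "K * s n \<le> \<bar>\<mu>\<bar> * a n / 4"
          proof -
            have "K * s n \<le> K * (\<bar>\<mu>\<bar> / (4 * K) * a n)" using elim \<open>0 < K\<close> by (intro mult_left_mono) auto
            then show ?thesis using \<open>0 < K\<close> by simp
          qed
          ultimately have "K * s n \<le> \<bar>T n \<omega>\<bar>" using \<omega>(2) by argo
          then show "\<omega> \<in> {\<omega>\<in>space M. K * s n \<le> \<bar>T n \<omega>\<bar>}" using \<omega> by simp
        qed auto
        finally show ?case .
      qed
    qed auto
  qed auto
qed

text \<open>Since \<open>s (k * n)\<close> exceeds \<open>K * s n\<close> for a suitable \<open>k\<close>, the dilation criterion applies with \<open>c = 0\<close>.\<close>

lemma summable_tails_rescale:
  assumes "0 < K" and tails: "summable (\<lambda>n. prob {\<omega>\<in>space M. K * s n < \<bar>\<xi> 0 \<omega>\<bar>})"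
  shows "summable (\<lambda>n. prob {\<omega>\<in>space M. s n < \<bar>\<xi> 0 \<omega>\<bar>})"
proof -
  define k where "k = nat \<lceil>K powr (8 / 3)\<rceil> + 1"
  have k: "1 \<le> k" "K powr (8 / 3) \<le> real k" unfolding k_def by linarith+
  have "K = (K powr (8 / 3)) powr (3 / 8)" using \<open>0 < K\<close> by (simp add: powr_powr)
  also have "\<dots> \<le> real k powr (3 / 8)" using k by (intro powr_mono2) auto
  finally have Kk: "K \<le> real k powr (3 / 8)" .
  show ?thesis
  proof (rule summable_of_dilation[where k=k and c=0 and n\<^sub>0=n\<^sub>0, OF _ _ _ _ _ _ tails])
    show "prob {\<omega>\<in>space M. s n < \<bar>\<xi> 0 \<omega>\<bar>} \<le> prob {\<omega>\<in>space M. s m < \<bar>\<xi> 0 \<omega>\<bar>}" if "n\<^sub>0 \<le> m" "m \<le> n" for m n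
      using s_mono[OF that] by (intro finite_measure_mono) auto
    show "prob {\<omega>\<in>space M. s (k * n) < \<bar>\<xi> 0 \<omega>\<bar>} \<le>
        0 * prob {\<omega>\<in>space M. s n < \<bar>\<xi> 0 \<omega>\<bar>} + prob {\<omega>\<in>space M. K * s n < \<bar>\<xi> 0 \<omega>\<bar>}" if "n\<^sub>0 \<le> n" for n
    proof -
      have "K * s n \<le> real k powr (3 / 8) * s n" using Kk s_pos[OF that] by (intro mult_right_mono) auto
      also have "\<dots> \<le> s (k * n)" using s_dilate[OF that k(1)] by (simp add: mult.commute)
      finally have "K * s n \<le> s (k * n)" .
      then have "prob {\<omega>\<in>space M. s (k * n) < \<bar>\<xi> 0 \<omega>\<bar>} \<le> prob {\<omega>\<in>space M. K * s n < \<bar>\<xi> 0 \<omega>\<bar>}"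
        by (intro finite_measure_mono) auto
      then show ?thesis by simp
    qed
  qed (use k in auto)
qed

end

context centered_windows
begin

text \<open>A summand above \<open>(K + 1) * s n\<close> occurs infinitely often. Decomposing according to the first index
  after \<open>N\<close> where this happens, the rest \<open>R\<close> of the window starting there is independent of the past
  and exceeds \<open>s n\<close> only with probability at most \<open>second_moment / d N\<close>. So with probability tending
  to one the large summand is not compensated.\<close>

lemma heavy_tails_unbounded:
  assumes ns: "\<not> summable (\<lambda>n. prob {\<omega>\<in>space M. (K + 1) * s n < \<bar>\<xi> 0 \<omega>\<bar>})" and "0 < K"
  shows "AE \<omega> in M. \<exists>\<^sub>F n in sequentially. K * s n \<le> \<bar>T n \<omega>\<bar>"
proof -
  define E where "E n = {\<omega>\<in>space M. (K + 1) * s n < \<bar>\<xi> n \<omega>\<bar>}" for n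
  define R where "R n \<omega> = (\<Sum>j\<in>{n+1..<n+len n}. \<xi> j \<omega>)" for n \<omega>
  define F where "F n = {\<omega>\<in>space M. \<bar>R n \<omega>\<bar> \<le> s n}" for n
  have [measurable]: "R n \<in> borel_measurable M" for n unfolding R_def by measurable
  have [measurable]: "E n \<in> events" "F n \<in> events" for n unfolding E_def F_def by measurable
  have "indep_events E UNIV" unfolding E_def by (rule indep_eventsI_indep_vars[OF indep]) auto
  moreover have "prob (E n) = prob {\<omega>\<in>space M. (K + 1) * s n < \<bar>\<xi> 0 \<omega>\<bar>}" for n
    unfolding E_def by (rule prob_ident) simp
  ultimately have Eio: "AE \<omega> in M. \<exists>\<^sub>F n in sequentially. \<omega> \<in> E n"
    using ns by (intro borel_cantelli_independent) auto
  have F: "1 - second_moment / d n \<le> prob (F n)" if "n\<^sub>0 \<le> n" for n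
  proof -
    note pos = s_pos[OF that] a_ge[OF that] d_ge[OF that]
    have "prob (space M - F n) \<le> prob {\<omega>\<in>space M. s n \<le> \<bar>\<Sum>j\<in>{n+1..<n+len n}. \<xi> j \<omega>\<bar>}"
      by (intro finite_measure_mono) (auto simp: F_def R_def)
    also have "\<dots> \<le> real (card {n+1..<n+len n}) * second_moment / (s n)\<^sup>2" by (intro chebyshev_sum pos) auto
    also have "\<dots> \<le> a n * second_moment / (s n)\<^sup>2"
      using len_le[OF that] second_moment_nonneg by (intro divide_right_mono mult_right_mono) auto
    also have "\<dots> = second_moment / d n" unfolding s_sq[OF that] using pos by simp
    finally show ?thesis by (simp add: prob_compl)
  qed
  define first where "first N n = {\<omega>\<in>space M. N \<le> n \<and> \<omega> \<in> E n \<and> (\<forall>i. N \<le> i \<and> i < n \<longrightarrow> \<omega> \<notin> E i)}" for N n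
  have first_ev [measurable]: "first N n \<in> events" for N n unfolding first_def by measurable
  have indepF: "prob (first N n \<inter> F n) = prob (first N n) * prob (F n)" for N n
  proof (cases "N \<le> n")
    case True
    let ?A = "{N..n}" and ?B = "{n+1..<n+len n}"
    define P where "P = {x \<in> space (PiM ?A (\<lambda>_. borel :: real measure)). (K + 1) * s n < \<bar>x n\<bar> \<and>
        (\<forall>i\<in>{N..<n}. \<not> (K + 1) * s i < \<bar>x i\<bar>)}"
    define Q where "Q = {x \<in> space (PiM ?B (\<lambda>_. borel :: real measure)). \<bar>\<Sum>j\<in>?B. x j\<bar> \<le> s n}"
    have c: "(\<lambda>x. x i) \<in> borel_measurable (PiM ?A (\<lambda>_. borel :: real measure))" if "i \<in> ?A" for i
      using that by (rule measurable_component_singleton)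
    have "Measurable.pred (PiM ?A (\<lambda>_. borel :: real measure)) (\<lambda>x. \<forall>i\<in>{N..<n}. \<not> (K + 1) * s i < \<bar>x i\<bar>)"
    proof (intro pred_intros_finite)
      fix i assume "i \<in> {N..<n}"
      then have [measurable]: "(\<lambda>x. x i) \<in> borel_measurable (PiM ?A (\<lambda>_. borel :: real measure))" by (intro c) auto
      show "Measurable.pred (PiM ?A (\<lambda>_. borel :: real measure)) (\<lambda>x. \<not> (K + 1) * s i < \<bar>x i\<bar>)" by measurable
    qed simp
    moreover have "Measurable.pred (PiM ?A (\<lambda>_. borel :: real measure)) (\<lambda>x. (K + 1) * s n < \<bar>x n\<bar>)"
    proof -
      have [measurable]: "(\<lambda>x. x n) \<in> borel_measurable (PiM ?A (\<lambda>_. borel :: real measure))" using True by (intro c) auto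
      show ?thesis by measurable
    qed
    ultimately have P: "P \<in> sets (PiM ?A (\<lambda>_. borel))"
      unfolding P_def pred_def[symmetric] by (intro pred_intros_logic)
    have Q: "Q \<in> sets (PiM ?B (\<lambda>_. borel))" unfolding Q_def by measurable
    have 1: "first N n = {\<omega>\<in>space M. restrict (\<lambda>i. \<xi> i \<omega>) ?A \<in> P}"
      using True by (auto simp: first_def P_def E_def space_PiM)
    have 2: "F n = {\<omega>\<in>space M. restrict (\<lambda>i. \<xi> i \<omega>) ?B \<in> Q}"
      by (auto simp: F_def R_def Q_def space_PiM)
    have 3: "first N n \<inter> F n = {\<omega>\<in>space M. restrict (\<lambda>i. \<xi> i \<omega>) ?A \<in> P \<and> restrict (\<lambda>i. \<xi> i \<omega>) ?B \<in> Q}"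
      unfolding 1 2 by auto
    show ?thesis unfolding 3 unfolding 1 2 by (rule indep_blocks[OF _ P Q]) auto
  next
    case False
    then have "first N n = {}" by (auto simp: first_def)
    then show ?thesis by simp
  qed
  define G where "G m = {\<omega>\<in>space M. \<exists>n\<ge>m. \<omega> \<in> E n \<and> \<omega> \<in> F n}" for m
  have [measurable]: "G m \<in> events" for m unfolding G_def by measurable
  have GN: "1 - second_moment / d N \<le> prob (G N)" if "n\<^sub>0 \<le> N" for N
  proof -
    let ?c = "1 - second_moment / d N"
    have disj: "disjoint_family (first N)"
      by (rule disjoint_familyI_less) (auto simp: first_def)
    have un: "(\<Union>n. first N n) = {\<omega>\<in>space M. \<exists>n\<ge>N. \<omega> \<in> E n}"
    proof (intro equalityI subsetI)
      fix \<omega> assume \<omega>: "\<omega> \<in> {\<omega>\<in>space M. \<exists>n\<ge>N. \<omega> \<in> E n}"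
      define n where "n = (LEAST n. N \<le> n \<and> \<omega> \<in> E n)"
      have "\<exists>n. N \<le> n \<and> \<omega> \<in> E n" using \<omega> by blast
      then have "N \<le> n \<and> \<omega> \<in> E n" unfolding n_def by (rule LeastI_ex)
      moreover have "\<not> (N \<le> i \<and> \<omega> \<in> E i)" if "i < n" for i
        using that unfolding n_def by (rule not_less_Least)
      ultimately have "\<omega> \<in> first N n" using \<omega> unfolding first_def by blast
      then show "\<omega> \<in> (\<Union>n. first N n)" by blast
    qed (auto simp: first_def)
    have "prob (\<Union>n. first N n) = 1"
      unfolding un using Eio by (subst prob_Collect_eq_1) (auto simp: frequently_sequentially elim!: eventually_mono)
    then have s1: "(\<lambda>n. prob (first N n)) sums 1"
      using finite_measure_UNION[OF _ disj] first_ev by (simp add: image_subset_iff)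
    have s2: "(\<lambda>n. prob (first N n \<inter> F n)) sums prob (\<Union>n. first N n \<inter> F n)"
    proof (rule finite_measure_UNION)
      show "range (\<lambda>n. first N n \<inter> F n) \<subseteq> events" by (simp add: image_subset_iff)
      show "disjoint_family (\<lambda>n. first N n \<inter> F n)" using disj unfolding disjoint_family_on_def by blast
    qed
    have "?c * 1 \<le> prob (\<Union>n. first N n \<inter> F n)"
    proof (rule sums_le[OF _ sums_mult[OF s1] s2])
      fix n
      show "?c * prob (first N n) \<le> prob (first N n \<inter> F n)"
      proof (cases "N \<le> n")
        case True
        have "second_moment / d n \<le> second_moment / d N"
          using d_mono[OF that True] d_ge[OF that] second_moment_nonneg by (intro divide_left_mono) auto
        then have "?c \<le> prob (F n)" using F[of n] True that by linarith
        then have "?c * prob (first N n) \<le> prob (F n) * prob (first N n)" by (intro mult_right_mono) auto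
        then show ?thesis unfolding indepF by (simp only: mult.commute)
      next
        case False
        then have "first N n = {}" by (auto simp: first_def)
        then show ?thesis by simp
      qed
    qed
    also have "\<dots> \<le> prob (G N)" by (intro finite_measure_mono) (auto simp: first_def G_def)
    finally show ?thesis by simp
  qed
  have "prob (G m) = 1" for m
  proof (rule antisym)
    have "(\<lambda>N. 1 - second_moment / d N) \<longlonglongrightarrow> 1 - 0"
      by (intro tendsto_intros real_tendsto_divide_at_top[OF tendsto_const d_top])
    moreover have "\<forall>\<^sub>F N in sequentially. 1 - second_moment / d N \<le> prob (G m)"
      using eventually_ge_at_top[of "max m n\<^sub>0"]
    proof eventually_elim
      case (elim N)
      have "m \<le> n" if "N \<le> n" for n using elim that by simp
      then have "G N \<subseteq> G m" unfolding G_def by blast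
      then have "prob (G N) \<le> prob (G m)" by (intro finite_measure_mono) auto
      then show ?case using GN[of N] elim by simp
    qed
    ultimately show "1 \<le> prob (G m)" by (intro tendsto_upperbound[of "\<lambda>N. 1 - second_moment / d N"]) auto
  qed simp
  then have "AE \<omega> in M. \<exists>n\<ge>m. \<omega> \<in> E n \<and> \<omega> \<in> F n" for m
    unfolding G_def by (subst (asm) prob_Collect_eq_1) auto
  then have "AE \<omega> in M. \<forall>m. \<exists>n\<ge>m. \<omega> \<in> E n \<and> \<omega> \<in> F n" by (simp add: AE_all_countable)
  then show ?thesis
  proof eventually_elim
    case (elim \<omega>)
    show ?case unfolding frequently_sequentially
    proof
      fix m
      obtain n where n: "n \<ge> max m n\<^sub>0" "\<omega> \<in> E n" "\<omega> \<in> F n" using elim by blast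
      have "{n..<n+len n} = insert n {n+1..<n+len n}" using len_pos[of n] n by auto
      then have "T n \<omega> = \<xi> n \<omega> + R n \<omega>" unfolding T_def R_def by simp
      moreover have "\<bar>R n \<omega>\<bar> \<le> s n" "(K + 1) * s n < \<bar>\<xi> n \<omega>\<bar>" using n by (auto simp: E_def F_def)
      ultimately have "K * s n \<le> \<bar>T n \<omega>\<bar>" by (simp add: algebra_simps)
      then show "\<exists>n\<ge>m. K * s n \<le> \<bar>T n \<omega>\<bar>" using n by auto
    qed
  qed
qed

end

section \<open>The moment condition and the theorem\<close>

text \<open>The equivalence rests on \<open>f_real\<close> being constant on \<open>[n, n + 1)\<close>: the set whose infimum is taken
  contains no point of this interval, nor any to its left, unless it contains \<open>n\<close>.\<close>

lemma
  assumes adm: "admissible_L L" and start: "admissible_start L x\<^sub>0"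
  shows f_inv_gt_iff: "x\<^sub>0 \<le> real n \<Longrightarrow> real n < f_inv L x\<^sub>0 y \<longleftrightarrow> f_seq L n < y"
    and f_inv_ge_start: "x\<^sub>0 \<le> f_inv L x\<^sub>0 y"
    and mono_f_inv: "mono (f_inv L x\<^sub>0)"
proof -
  have mono: "mono_on {x\<^sub>0..} (f_real L)" and "2 \<le> x\<^sub>0" using start by (auto simp: admissible_start_def)
  define S where "S y = {x. x\<^sub>0 \<le> x \<and> y \<le> f_real L x}" for y
  have S: "f_inv L x\<^sub>0 y = Inf (S y)" for y by (simp add: f_inv_def S_def)
  have bdd: "bdd_below (S y)" for y by (rule bdd_belowI[of _ x\<^sub>0]) (simp add: S_def)
  obtain k where "window_seq (a_seq L) (d_seq L) k" using admissible_window[OF adm] by blast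
  then interpret window_seq "a_seq L" "d_seq L" k .
  have ne: "S y \<noteq> {}" for y
  proof -
    have "eventually (\<lambda>m. a_seq L m \<ge> max y 0) sequentially" using a_top unfolding filterlim_at_top by blast
    then have "eventually (\<lambda>m. m \<ge> k \<and> real m \<ge> x\<^sub>0 \<and> real m \<ge> y \<and> a_seq L m \<ge> max y 0) sequentially"
      using eventually_ge_at_top[of k] eventually_ge_at_top[of "nat \<lceil>max x\<^sub>0 y\<rceil>"]
      by eventually_elim (auto simp: nat_ceiling_le_eq)
    then obtain m where m: "m \<ge> k" "real m \<ge> x\<^sub>0" "real m \<ge> y" "a_seq L m \<ge> max y 0"
      unfolding eventually_sequentially by blast
    have "a_seq L m * 1 \<le> a_seq L m * d_seq L m" using d_ge[OF m(1)] m(4) by (intro mult_left_mono) auto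
    then have "real m \<in> S y" using m by (simp add: S_def f_real_def f_seq_def)
    then show ?thesis by blast
  qed
  show "real n < f_inv L x\<^sub>0 y \<longleftrightarrow> f_seq L n < y" if n: "x\<^sub>0 \<le> real n"
  proof
    assume less: "real n < f_inv L x\<^sub>0 y"
    show "f_seq L n < y"
    proof (rule ccontr)
      assume "\<not> f_seq L n < y"
      then have "real n \<in> S y" using n by (simp add: S_def f_real_def)
      then have "f_inv L x\<^sub>0 y \<le> real n" unfolding S by (intro cInf_lower bdd)
      then show False using less by simp
    qed
  next
    assume f: "f_seq L n < y"
    have "real n + 1 \<le> Inf (S y)"
    proof (rule cInf_greatest[OF ne])
      fix x assume x: "x \<in> S y"
      show "real n + 1 \<le> x"
      proof (rule ccontr)
        assume "\<not> real n + 1 \<le> x"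
        then consider "x \<le> real n" | "real n < x" "x < real n + 1" by linarith
        then have "f_real L x \<le> f_seq L n"
        proof cases
          case 1
          then have "f_real L x \<le> f_real L (real n)" using monotone_onD[OF mono, of x "real n"] x by (simp add: S_def)
          then show ?thesis by (simp add: f_real_def)
        next
          case 2
          then have "nat \<lfloor>x\<rfloor> = n" by linarith
          then show ?thesis by (simp add: f_real_def)
        qed
        then show False using f x by (simp add: S_def)
      qed
    qed
    then show "real n < f_inv L x\<^sub>0 y" unfolding S by linarith
  qed
  show "x\<^sub>0 \<le> f_inv L x\<^sub>0 y" unfolding S by (rule cInf_greatest[OF ne]) (simp add: S_def)
  show "mono (f_inv L x\<^sub>0)"
    unfolding S by (intro monoI cInf_superset_mono ne bdd) (auto simp: S_def)
qed

lemma (in prob_space) integrable_f_inv_iff: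
  assumes adm: "admissible_L L" and start: "admissible_start L x\<^sub>0"
    and X[measurable]: "X \<in> borel_measurable M"
  shows "integrable M (\<lambda>\<omega>. f_inv L x\<^sub>0 ((X \<omega>)\<^sup>2)) \<longleftrightarrow> summable (\<lambda>n. prob {\<omega>\<in>space M. f_seq L n < (X \<omega>)\<^sup>2})"
proof -
  define m where "m = nat \<lceil>x\<^sub>0\<rceil>"
  have "x\<^sub>0 \<le> real m" unfolding m_def by linarith
  have [measurable]: "f_inv L x\<^sub>0 \<in> borel_measurable borel" by (rule borel_measurable_mono[OF mono_f_inv[OF adm start]])
  have "2 \<le> x\<^sub>0" using start by (simp add: admissible_start_def)
  have "integrable M (\<lambda>\<omega>. f_inv L x\<^sub>0 ((X \<omega>)\<^sup>2)) \<longleftrightarrow> summable (\<lambda>n. prob {\<omega>\<in>space M. real n < f_inv L x\<^sub>0 ((X \<omega>)\<^sup>2)})"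
    using f_inv_ge_start[OF adm start] \<open>2 \<le> x\<^sub>0\<close>
    by (intro integrable_iff_summable_tails) (auto intro: order_trans[of 0 x\<^sub>0])
  also have "\<dots> \<longleftrightarrow> summable (\<lambda>n. prob {\<omega>\<in>space M. f_seq L n < (X \<omega>)\<^sup>2})"
  proof (rule summable_cong)
    show "\<forall>\<^sub>F n in sequentially. prob {\<omega>\<in>space M. real n < f_inv L x\<^sub>0 ((X \<omega>)\<^sup>2)} = prob {\<omega>\<in>space M. f_seq L n < (X \<omega>)\<^sup>2}"
      using eventually_ge_at_top[of m]
    proof eventually_elim
      case (elim n)
      then have "x\<^sub>0 \<le> real n" using \<open>x\<^sub>0 \<le> real m\<close> by (meson of_nat_le_iff order_trans)
      then show ?case by (simp add: f_inv_gt_iff[OF adm start])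
    qed
  qed
  finally show ?thesis .
qed

lemma window_sum_shift: "window_sum Xs n a \<omega> = (\<Sum>j\<in>{n..<n + nat \<lfloor>a\<rfloor>}. Xs (Suc j) \<omega>)"
proof -
  have eq: "{n+1..n + nat \<lfloor>a\<rfloor>} = Suc ` {n..<n + nat \<lfloor>a\<rfloor>}"
    by (simp add: image_Suc_atLeastLessThan atLeastLessThanSuc_atLeastAtMost)
  show ?thesis unfolding window_sum_def eq by (subst sum.reindex) (simp_all del: image_Suc_atLeastLessThan)
qed

lemma iid_copies_imp_iid_seq:
  assumes "prob_space M" "iid_copies M X Xs"
  shows "iid_seq M (\<lambda>j. Xs (Suc j))" and "distr M borel (Xs (Suc j)) = distr M borel X"
proof -
  interpret prob_space M by fact
  have "indep_vars (\<lambda>_. borel) Xs {1..}" using assms by (simp add: iid_copies_def)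
  then have ind: "indep_sets (\<lambda>i. {Xs i -` A \<inter> space M |A. A \<in> sets borel}) {1..}"
    and rv: "\<And>i. i \<ge> 1 \<Longrightarrow> Xs i \<in> borel_measurable M"
    unfolding indep_vars_def2 by auto
  show eq: "distr M borel (Xs (Suc j)) = distr M borel X" for j using assms by (simp add: iid_copies_def)
  show "iid_seq M (\<lambda>j. Xs (Suc j))"
  proof
    show "indep_vars (\<lambda>_. borel) (\<lambda>j. Xs (Suc j)) UNIV"
      unfolding indep_vars_def2
    proof (intro conjI ballI)
      show "indep_sets (\<lambda>i. {Xs (Suc i) -` A \<inter> space M |A. A \<in> sets borel}) UNIV"
        unfolding indep_sets_def
      proof (intro conjI ballI allI impI)
        fix i show "{Xs (Suc i) -` A \<inter> space M |A. A \<in> sets borel} \<subseteq> events"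
          using rv[of "Suc i"] by (auto intro: measurable_sets)
      next
        fix J :: "nat set" and A assume J: "J \<noteq> {}" "finite J"
          and A: "A \<in> Pi J (\<lambda>i. {Xs (Suc i) -` A \<inter> space M |A. A \<in> sets borel})"
        define B where "B i = A (i - 1)" for i
        have "prob (\<Inter>j\<in>Suc ` J. B j) = (\<Prod>j\<in>Suc ` J. prob (B j))"
          using J A by (intro indep_setsD[OF ind]) (auto simp: B_def)
        then show "prob (\<Inter>j\<in>J. A j) = (\<Prod>j\<in>J. prob (A j))"
          by (simp add: B_def prod.reindex image_image)
      qed
    qed (use rv in auto)
  qed (simp add: eq)
qed

theorem theorem2p1:
  fixes M :: "'a measure" and X :: "'a \<Rightarrow> real" and Xs :: "nat \<Rightarrow> 'a \<Rightarrow> real"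
    and L :: "real \<Rightarrow> real" and n\<^sub>0 :: real
  assumes "prob_space M"
    and "admissible_L L"
    and "admissible_start L n\<^sub>0"
    and "iid_copies M X Xs"
  shows "(\<forall>\<sigma>\<ge>0. integrable M X \<and> prob_space.expectation M X = 0 \<and>
             integrable M (\<lambda>\<omega>. (X \<omega>)\<^sup>2) \<and> prob_space.variance M X = \<sigma>\<^sup>2 \<and>
             integrable M (\<lambda>\<omega>. f_inv L n\<^sub>0 ((X \<omega>)\<^sup>2))
           \<longrightarrow> window_limsup_eq M L Xs \<sigma>) \<and>
         (measure M (window_limsup_finite_event M L Xs) > 0
           \<longrightarrow> integrable M (\<lambda>\<omega>. f_inv L n\<^sub>0 ((X \<omega>)\<^sup>2)) \<and>
               integrable M X \<and> prob_space.expectation M X = 0 \<and>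
               integrable M (\<lambda>\<omega>. (X \<omega>)\<^sup>2) \<and>
               window_limsup_eq M L Xs (sqrt (prob_space.variance M X)))"
proof -
  interpret prob_space M by fact
  define \<xi> where "\<xi> j = Xs (Suc j)" for j
  have X [measurable]: "X \<in> borel_measurable M" using assms(4) by (simp add: iid_copies_def)
  interpret iid_seq M \<xi>
    using iid_copies_imp_iid_seq(1)[OF assms(1,4)] by (simp add: \<xi>_def[abs_def])
  have law: "distr M borel (\<xi> 0) = distr M borel X"
    using iid_copies_imp_iid_seq(2)[OF assms(1,4), of 0] by (simp add: \<xi>_def)
  have int_iff: "integrable M (\<lambda>\<omega>. g (\<xi> 0 \<omega>)) \<longleftrightarrow> integrable M (\<lambda>\<omega>. g (X \<omega>))"
    and exp_eq: "expectation (\<lambda>\<omega>. g (\<xi> 0 \<omega>)) = expectation (\<lambda>\<omega>. g (X \<omega>))"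
    if "g \<in> borel_measurable borel" for g :: "real \<Rightarrow> real"
    using integrable_distr_eq[of "\<xi> 0" M borel g] integrable_distr_eq[of X M borel g]
      integral_distr[of "\<xi> 0" M borel g] integral_distr[of X M borel g] that law by auto
  have prob_eq: "prob {\<omega>\<in>space M. P (X \<omega>)} = prob {\<omega>\<in>space M. P (\<xi> 0 \<omega>)}" if [measurable]: "Measurable.pred borel P" for P
  proof -
    have "prob {\<omega>\<in>space M. P (Y \<omega>)} = measure (distr M borel Y) {x. P x}" if [measurable]: "Y \<in> borel_measurable M" for Y
      by (subst measure_distr) (auto intro!: arg_cong[where f=prob] simp: vimage_def)
    then show ?thesis using law by simp
  qed
  obtain k where "window_seq (a_seq L) (d_seq L) k" using admissible_window[OF assms(2)] by blast
  then interpret window_seq "a_seq L" "d_seq L" k .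
  interpret iid_windows M \<xi> "a_seq L" "d_seq L" k ..
  have T: "window_sum Xs n (a_seq L n) \<omega> = T n \<omega>" for n \<omega>
    unfolding T_def len_def \<xi>_def by (rule window_sum_shift)
  have tails_iff: "integrable M (\<lambda>\<omega>. f_inv L n\<^sub>0 ((X \<omega>)\<^sup>2)) \<longleftrightarrow> summable (\<lambda>n. prob {\<omega>\<in>space M. f_seq L n < (\<xi> 0 \<omega>)\<^sup>2})"
    unfolding integrable_f_inv_iff[OF assms(2,3) X] using prob_eq[of "\<lambda>x. f_seq L _ < x\<^sup>2"] by simp
  have s_iff: "s n < \<bar>x\<bar> \<longleftrightarrow> a_seq L n * d_seq L n < x\<^sup>2" if "k \<le> n" for n x
  proof -
    have "s n < \<bar>x\<bar> \<longleftrightarrow> (s n)\<^sup>2 < x\<^sup>2"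
      using abs_le_square_iff[of x "s n"] s_pos[OF that] by auto
    then show ?thesis by (simp only: s_sq[OF that])
  qed
  have sufficiency: "window_limsup_eq M L Xs \<sigma>"
    if "0 \<le> \<sigma>" "expectation X = 0" "integrable M (\<lambda>\<omega>. (X \<omega>)\<^sup>2)"
      "variance X = \<sigma>\<^sup>2" "integrable M (\<lambda>\<omega>. f_inv L n\<^sub>0 ((X \<omega>)\<^sup>2))" for \<sigma>
  proof -
    interpret iid_centered M \<xi>
      by unfold_locales (use that int_iff[of "\<lambda>x. x\<^sup>2"] exp_eq[of "\<lambda>x. x"] in auto)
    interpret centered_windows M \<xi> "a_seq L" "d_seq L" k ..
    have "sqrt second_moment = \<sigma>" using that exp_eq[of "\<lambda>x. x\<^sup>2"] by (simp add: second_moment_def)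
    have "summable (\<lambda>n. prob {\<omega>\<in>space M. s n < \<bar>\<xi> 0 \<omega>\<bar>})"
    proof (rule summable_comparison_test_ev)
      show "summable (\<lambda>n. prob {\<omega>\<in>space M. f_seq L n < (\<xi> 0 \<omega>)\<^sup>2})" using that(5) tails_iff by simp
      show "\<forall>\<^sub>F n in sequentially. norm (prob {\<omega>\<in>space M. s n < \<bar>\<xi> 0 \<omega>\<bar>}) \<le> prob {\<omega>\<in>space M. f_seq L n < (\<xi> 0 \<omega>)\<^sup>2}"
        using eventually_ge_at_top[of k]
      proof eventually_elim
        case (elim n)
        have "prob {\<omega>\<in>space M. s n < \<bar>\<xi> 0 \<omega>\<bar>} \<le> prob {\<omega>\<in>space M. f_seq L n < (\<xi> 0 \<omega>)\<^sup>2}"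
          by (intro finite_measure_mono) (auto simp: s_iff[OF elim] f_seq_def)
        then show ?case by simp
      qed
    qed
    from window_limsup[OF this] show ?thesis
      unfolding window_limsup_eq_def T \<open>sqrt second_moment = \<sigma>\<close> s_def
      by (simp add: real_sqrt_mult mult.assoc)
  qed
  have necessity: "integrable M (\<lambda>\<omega>. f_inv L n\<^sub>0 ((X \<omega>)\<^sup>2)) \<and> integrable M X \<and> expectation X = 0 \<and> integrable M (\<lambda>\<omega>. (X \<omega>)\<^sup>2)"
    if pos: "0 < measure M (window_limsup_finite_event M L Xs)"
  proof -
    \<comment> \<open>the window sums exceed some multiple of \<open>s n\<close> only finitely often with positive probability; the three alternatives are excluded in turn\<close>
    have bounded: "\<exists>K>0. \<not> (AE \<omega> in M. \<exists>\<^sub>F n in sequentially. K * s n \<le> \<bar>T n \<omega>\<bar>)"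
    proof (rule ccontr)
      assume "\<not> ?thesis"
      then have "AE \<omega> in M. limsup (\<lambda>n. ereal (\<bar>T n \<omega>\<bar> / s n)) = \<infinity>" by (intro limsup_infinite) blast
      then have "AE \<omega> in M. \<omega> \<notin> window_limsup_finite_event M L Xs"
        by eventually_elim (simp add: window_limsup_finite_event_def T s_def)
      then have "measure M (window_limsup_finite_event M L Xs) = 0"
        by (cases "window_limsup_finite_event M L Xs \<in> events")
          (auto simp: measure_notin_sets prob_eq_0)
      then show False using pos by simp
    qed
    have sq: "integrable M (\<lambda>\<omega>. (\<xi> 0 \<omega>)\<^sup>2)" using infinite_variance_unbounded bounded by blast
    have mean: "expectation (\<xi> 0) = 0" using nonzero_mean_unbounded[OF sq] bounded by blast
    interpret iid_centered M \<xi> by unfold_locales (fact sq, fact mean)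
    interpret centered_windows M \<xi> "a_seq L" "d_seq L" k ..
    obtain K where "0 < K" "summable (\<lambda>n. prob {\<omega>\<in>space M. (K + 1) * s n < \<bar>\<xi> 0 \<omega>\<bar>})"
      using heavy_tails_unbounded bounded by blast
    then have tails: "summable (\<lambda>n. prob {\<omega>\<in>space M. s n < \<bar>\<xi> 0 \<omega>\<bar>})"
      by (intro summable_tails_rescale[of "K + 1"]) auto
    have "summable (\<lambda>n. prob {\<omega>\<in>space M. real n < (\<xi> 0 \<omega>)\<^sup>2})"
      using sq by (subst (asm) integrable_iff_summable_tails) auto
    with tails have "summable (\<lambda>n. prob {\<omega>\<in>space M. s n < \<bar>\<xi> 0 \<omega>\<bar>} + prob {\<omega>\<in>space M. real n < (\<xi> 0 \<omega>)\<^sup>2})"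
      by (rule summable_add)
    then have "summable (\<lambda>n. prob {\<omega>\<in>space M. f_seq L n < (\<xi> 0 \<omega>)\<^sup>2})"
    proof (rule summable_comparison_test_ev[rotated])
      show "\<forall>\<^sub>F n in sequentially. norm (prob {\<omega>\<in>space M. f_seq L n < (\<xi> 0 \<omega>)\<^sup>2}) \<le>
          prob {\<omega>\<in>space M. s n < \<bar>\<xi> 0 \<omega>\<bar>} + prob {\<omega>\<in>space M. real n < (\<xi> 0 \<omega>)\<^sup>2}"
        using eventually_ge_at_top[of k]
      proof eventually_elim
        case (elim n)
        have "prob {\<omega>\<in>space M. f_seq L n < (\<xi> 0 \<omega>)\<^sup>2} \<le>
            prob ({\<omega>\<in>space M. s n < \<bar>\<xi> 0 \<omega>\<bar>} \<union> {\<omega>\<in>space M. real n < (\<xi> 0 \<omega>)\<^sup>2})"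
          by (intro finite_measure_mono) (auto simp: s_iff[OF elim] f_seq_def)
        also have "\<dots> \<le> prob {\<omega>\<in>space M. s n < \<bar>\<xi> 0 \<omega>\<bar>} + prob {\<omega>\<in>space M. real n < (\<xi> 0 \<omega>)\<^sup>2}"
          by (rule measure_Un_le) auto
        finally show ?case by simp
      qed
    qed
    then show ?thesis
      using tails_iff mean sq int_iff[of "\<lambda>x. x"] int_iff[of "\<lambda>x. x\<^sup>2"] exp_eq[of "\<lambda>x. x"] by simp
  qed
  show ?thesis
  proof (intro conjI allI impI)
    fix \<sigma> :: real
    assume "0 \<le> \<sigma>" and "integrable M X \<and> expectation X = 0 \<and> integrable M (\<lambda>\<omega>. (X \<omega>)\<^sup>2) \<and>
      variance X = \<sigma>\<^sup>2 \<and> integrable M (\<lambda>\<omega>. f_inv L n\<^sub>0 ((X \<omega>)\<^sup>2))"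
    then show "window_limsup_eq M L Xs \<sigma>" by (intro sufficiency) auto
  next
    assume pos: "0 < measure M (window_limsup_finite_event M L Xs)"
    note nec = necessity[OF pos]
    show "window_limsup_eq M L Xs (sqrt (variance X))"
      using nec variance_positive[of X] by (intro sufficiency) auto
  qed (use necessity in auto)
qed

end
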